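(* Let $\{\alpha_n\}_{n=0}^\infty$ and $\{\widetilde{\alpha}_n\}_{n=0}^\infty$ be two sequences of complex numbers (Verblunsky coefficients), and put $\Delta_n=\widetilde{\alpha}_n-\alpha_n$. Suppose that (i) $|\alpha_n|<1$ and $|\widetilde{\alpha}_n|<1$ for all $n$; (ii) there exist sequences $\{m_j\}_{j=1}^\infty$, $\{n_j\}_{j=1}^\infty$ of non-negative integers with $n_j-m_j\to\infty$ such that $\lim_{j\to\infty}\ \sup_{m_j\le n<n_j}|\Delta_n|=0$; (iii) $\limsup_{j\to\infty}|\Delta_{n_j}|>0$. Let $\mathcal{C}$ and $\widetilde{\mathcal{C}}$ be the half-line CMV matrices with Verblunsky coefficients $\{\alpha_n\}_{n=0}^\infty$ and $\{\widetilde{\alpha}_n\}_{n=0}^\infty$ respectively. Then $$\mathrm{Leb}\bigl(\Sigma_{\rm ac}(\mathcal{C})\cap\Sigma_{\rm ac}(\widetilde{\mathcal{C}})\bigr)=0,$$ where $\mathrm{Leb}$ denotes Lebesgue measure. In particular, if $\mathcal{C}$ is the half-line CMV matrix of a sequence $\{\alpha_n\}_{n=0}^\infty$ of Verblunsky coefficients ($|\alpha_n|<1$) satisfying $$\lim_{n\to\infty}\alpha_n\alpha_{n+k}=0\ \text{ for all } k\ge 1,\qquad \limsup_{n\to\infty}|\alpha_n|>0,$$ then $\mathcal{C}$ has purely singular spectrum (its spectral measure $\mu$ is purely singular with respect to Lebesgue measure).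
   Context: Let $\mathbb{D}$ be the open unit disc. A probability measure $\mu$ on $\partial\mathbb{D}$ with infinite support has monic orthogonal polynomials $\Phi_n$ satisfying $\Phi_{n+1}(z)=z\Phi_n(z)-\overline{\alpha_n}\,\Phi_n^*(z)$, with $\Phi_n^*(z)=z^n\overline{\Phi_n(1/\bar z)}$; the numbers $\alpha_n\in\mathbb{D}$ are the Verblunsky coefficients of $\mu$, and $\mu\leftrightarrow\{\alpha_n\}_{n\ge0}\in\mathbb{D}^{\mathbb{Z}_+}$ is a bijection ($\mathbb{Z}_+=\{0,1,2,\dots\}$). The half-line CMV matrix $\mathcal{C}$ of $\{\alpha_n\}_{n\ge 0}$ is the unitary operator on $\ell^2(\mathbb{Z}_+)$ given by $\mathcal{C}=\mathcal{L}\mathcal{M}$, $\mathcal{L}=\Theta_0\oplus\Theta_2\oplus\Theta_4\oplus\cdots$, $\mathcal{M}=(1)\oplus\Theta_1\oplus\Theta_3\oplus\cdots$, $\Theta_k=\begin{pmatrix}\bar\alpha_k&\rho_k\\ \rho_k&-\alpha_k\end{pmatrix}$, $\rho_k=(1-|\alpha_k|^2)^{1/2}$. It is unitarily equivalent to multiplication by $z$ on $L^2(\partial\mathbb{D},d\mu)$, and $\mu$ is called its spectral measure. Writing $d\mu(\theta)=w(\theta)\,d\theta+d\mu_{\rm sing}(\theta)$ (decomposition with respect to Lebesgue measure on $\partial\mathbb{D}\cong[0,2\pi)$), the essential support of the absolutely continuous spectrum is $\Sigma_{\rm ac}(\mathcal{C})=\{\theta: w(\theta)>0\}$, defined up to sets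 of Lebesgue measure zero. *)

theory Defs
  imports "HOL-Analysis.Analysis" "HOL-Probability.Probability_Measure"
begin

section \<open>Half-line CMV matrices\<close>

definition rho :: "(nat \<Rightarrow> complex) \<Rightarrow> nat \<Rightarrow> real" where
  "rho \<alpha> k = sqrt (1 - (cmod (\<alpha> k))\<^sup>2)"

definition Theta :: "(nat \<Rightarrow> complex) \<Rightarrow> nat \<Rightarrow> complex \<times> complex \<Rightarrow> complex \<times> complex" where
  "Theta \<alpha> k = (\<lambda>(x, y). (cnj (\<alpha> k) * x + of_real (rho \<alpha> k) * y, of_real (rho \<alpha> k) * x - \<alpha> k * y))"

text \<open>
  The block-diagonal matrices act on sequences (columns).  In \<open>cmv_L\<close> the block \<open>Theta \<alpha> k\<close>,
  \<open>k\<close> even, acts on the coordinates \<open>k\<close> and \<open>k + 1\<close>; in \<open>cmv_M\<close> the same holds for odd \<open>k\<close>, and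
  coordinate 0 is left fixed.
\<close>

definition cmv_L :: "(nat \<Rightarrow> complex) \<Rightarrow> (nat \<Rightarrow> complex) \<Rightarrow> (nat \<Rightarrow> complex)" where
  "cmv_L \<alpha> f n =
    (if even n then fst (Theta \<alpha> n (f n, f (n + 1)))
     else snd (Theta \<alpha> (n - 1) (f (n - 1), f n)))"

definition cmv_M :: "(nat \<Rightarrow> complex) \<Rightarrow> (nat \<Rightarrow> complex) \<Rightarrow> (nat \<Rightarrow> complex)" where
  "cmv_M \<alpha> f n =
    (if n = 0 then f 0
     else if odd n then fst (Theta \<alpha> n (f n, f (n + 1)))
     else snd (Theta \<alpha> (n - 1) (f (n - 1), f n)))"

definition cmv :: "(nat \<Rightarrow> complex) \<Rightarrow> (nat \<Rightarrow> complex) \<Rightarrow> (nat \<Rightarrow> complex)" where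
  "cmv \<alpha> = cmv_L \<alpha> \<circ> cmv_M \<alpha>"


section \<open>Spectral measures\<close>

definition ell2 :: "(nat \<Rightarrow> complex) set" where
  "ell2 = {f. summable (\<lambda>n. (cmod (f n))\<^sup>2)}"

definition L2 :: "complex measure \<Rightarrow> (complex \<Rightarrow> complex) set" where
  "L2 \<mu> = {h \<in> borel_measurable \<mu>. integrable \<mu> (\<lambda>z. (cmod (h z))\<^sup>2)}"

text \<open>
  Unitary maps from \<open>ell2\<close> onto the Hilbert space of classes of functions in \<open>L2 \<mu>\<close> modulo
  equality almost everywhere: \<open>V f\<close> is a representative of the image of \<open>f\<close>.
\<close>

definition unitary_to_L2 ::
  "((nat \<Rightarrow> complex) \<Rightarrow> (complex \<Rightarrow> complex)) \<Rightarrow> complex measure \<Rightarrow> bool" where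
  "unitary_to_L2 V \<mu> \<longleftrightarrow>
    (\<forall>f\<in>ell2. V f \<in> L2 \<mu>) \<and>
    (\<forall>f\<in>ell2. \<forall>g\<in>ell2. \<forall>a b.
       AE z in \<mu>. V (\<lambda>n. a * f n + b * g n) z = a * V f z + b * V g z) \<and>
    (\<forall>f\<in>ell2. (\<integral>z. (cmod (V f z))\<^sup>2 \<partial>\<mu>) = (\<Sum>n. (cmod (f n))\<^sup>2)) \<and>
    (\<forall>h\<in>L2 \<mu>. \<exists>f\<in>ell2. AE z in \<mu>. V f z = h z)"

text \<open>
  \<open>\<mu>\<close> is a probability measure on the unit circle such that the operator \<open>U\<close> on \<open>ell2\<close> is unitarily
  equivalent to multiplication by \<open>z\<close> on \<open>L2 \<mu>\<close>.  Without the normalisation that the unit vector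
  \<open>(1, 0, 0, \<dots>)\<close> goes to the constant function 1, only the mutual absolute continuity class of
  \<open>\<mu>\<close> would be determined; for \<open>U = cmv \<alpha>\<close>, the normalised \<open>\<mu>\<close> is the measure whose Verblunsky
  coefficients are \<open>\<alpha>\<close>.
\<close>

definition is_spectral_measure ::
  "((nat \<Rightarrow> complex) \<Rightarrow> (nat \<Rightarrow> complex)) \<Rightarrow> complex measure \<Rightarrow> bool" where
  "is_spectral_measure U \<mu> \<longleftrightarrow>
    sets \<mu> = sets borel \<and> prob_space \<mu> \<and> (AE z in \<mu>. z \<in> sphere 0 1) \<and>
    (\<exists>V. unitary_to_L2 V \<mu> \<and>
         (AE z in \<mu>. V (\<lambda>n. if n = 0 then 1 else 0) z = 1) \<and>
         (\<forall>f\<in>ell2. AE z in \<mu>. V (U f) z = z * V f z))"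


section \<open>Lebesgue decomposition on the circle\<close>

definition circle_lebesgue :: "complex measure" where
  "circle_lebesgue = distr (restrict_space lborel {0..<2 * pi}) borel cis"

definition mutually_singular :: "'a measure \<Rightarrow> 'a measure \<Rightarrow> bool" where
  "mutually_singular M N \<longleftrightarrow>
    sets M = sets N \<and> (\<exists>A\<in>sets M. emeasure M A = 0 \<and> emeasure N (space N - A) = 0)"

text \<open>\<open>d\<mu> = w d\<theta> + d\<sigma>\<close>, where \<open>\<theta>\<close> ranges over \<open>[0, 2\<pi>)\<close> and \<open>\<sigma>\<close> is singular.\<close>

definition lebesgue_decomposition ::
  "complex measure \<Rightarrow> (real \<Rightarrow> real) \<Rightarrow> complex measure \<Rightarrow> bool" where
  "lebesgue_decomposition \<mu> w \<sigma> \<longleftrightarrow>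
    w \<in> borel_measurable borel \<and> (\<forall>\<theta>. 0 \<le> w \<theta>) \<and>
    mutually_singular \<sigma> circle_lebesgue \<and>
    (\<forall>A\<in>sets borel. emeasure \<mu> A =
       (\<integral>\<^sup>+\<theta>\<in>{0..<2 * pi}. ennreal (w \<theta>) * indicator A (cis \<theta>) \<partial>lborel) + emeasure \<sigma> A)"

text \<open>
  The essential support of the absolutely continuous spectrum is only defined up to null sets;
  \<open>S\<close> is one of its versions.
\<close>

definition is_ac_support ::
  "((nat \<Rightarrow> complex) \<Rightarrow> (nat \<Rightarrow> complex)) \<Rightarrow> real set \<Rightarrow> bool" where
  "is_ac_support U S \<longleftrightarrow>
    (\<exists>\<mu> w \<sigma>. is_spectral_measure U \<mu> \<and> lebesgue_decomposition \<mu> w \<sigma> \<and>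
       S = {\<theta> \<in> {0..<2 * pi}. w \<theta> > 0})"

definition purely_singular_spectrum ::
  "((nat \<Rightarrow> complex) \<Rightarrow> (nat \<Rightarrow> complex)) \<Rightarrow> bool" where
  "purely_singular_spectrum U \<longleftrightarrow>
    (\<forall>\<mu>. is_spectral_measure U \<mu> \<longrightarrow> mutually_singular \<mu> circle_lebesgue)"

end

(* Let f_n be the Schur function with parameters \<alpha>_n, \<alpha>_{n+1}, ... .  The entries of the resolvent
   vector (C - z)^{-1} e_0 identify f_0 with the Schur function of the spectral measure, so
   |f_0| < 1 almost everywhere on {w > 0}.  On the circle, cnj(f_n) arises
   from cnj(f_0) by n disc automorphisms, which are hyperbolic isometries.  Where f_0 is close to a
   constant c in the disc, f_n is therefore uniformly in n close to cnj(g_n), where g_n is obtained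
   in the same way from cnj(c); but g_n is the boundary value of an analytic function whose values in
   the disc depend essentially only on \<alpha>_{n-1}, ..., \<alpha>_{n-L}.  Hence, if \<alpha> and \<alpha>' are close before
   n_j, the functions f_{n_j} - f'_{n_j} tend weakly to 0 on the set where both |f_0| and |f'_0| are
   less than 1.  If that set A has positive measure, testing against an analytic G with G(0) = 1 that
   is small off A gives \<alpha>_{n_j} - \<alpha>'_{n_j} -> 0.  The second claim is the case \<alpha>' = 0. *)

theory Submission
  imports Defs "HOL-Complex_Analysis.Cauchy_Integral_Formula"
begin

section \<open>Disc automorphisms and the Schur algorithm\<close>

text \<open>As a function on the disc, f_n depends on the coefficients from n on, whereas the
  hypothesis compares those before n_j. The inverse Schur step divides by z; for |z| = 1 this is
  multiplication by cnj z, and conjugation turns the iteration into a chain in z that starts at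
  cnj(f_0) and uses the past coefficients. The price is that such a step is only an isometry on the
  circle, so f_0 is not forgotten there. Contraction returns once cnj(f_0) is frozen to a constant,
  because the chain then extends analytically into the disc. Since f_0 is merely measurable,
  finitely many constants on finitely many level sets are used, and the error is controlled only
  where |f_0| < 1: points of the circle are infinitely far from the constants. Convergence inside
  the disc is pointwise, while weak convergence on the circle is wanted; uniform bounds and the
  density of Laurent polynomials in L1 connect the two. Radial limits are taken along a sequence of
  radii that depends on the function.\<close>

definition disk_aut :: "complex \<Rightarrow> complex \<Rightarrow> complex" where
  "disk_aut a x = (x + a) / (1 + cnj a * x)"

text \<open>The factor \<open>z\<close> stands outside each automorphism, so the running value is z
  f rather than the Schur function f itself. In this form one chain serves both for the Schur
  algorithm and, with parameters \<open>- cnj a\<close> in reverse order, for its inverse on the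
  circle.\<close>

definition mob_chain :: "complex \<Rightarrow> complex list \<Rightarrow> complex \<Rightarrow> complex" where
  "mob_chain z as s = foldr (\<lambda>a x. z * disk_aut a x) as s"

lemma mob_chain_simps [simp]:
  "mob_chain z [] s = s"
  "mob_chain z (a # as) s = z * disk_aut a (mob_chain z as s)"
  "mob_chain z (as @ bs) s = mob_chain z as (mob_chain z bs s)"
  by (simp_all add: mob_chain_def)

lemma disk_aut_denom_ge:
  assumes "cmod x \<le> r" "cmod a \<le> 1"
  shows "1 - r \<le> cmod (1 + cnj a * x)"
proof -
  have "cmod (cnj a * x) \<le> 1 * r"
    unfolding norm_mult complex_mod_cnj using assms by (intro mult_mono) auto
  then show ?thesis
    using norm_diff_ineq[of 1 "cnj a * x"] by simp
qed

lemma disk_aut_denom_ne: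
  assumes "cmod a < 1" "cmod x \<le> 1"
  shows "1 + cnj a * x \<noteq> 0"
proof
  assume "1 + cnj a * x = 0"
  then have "cnj a * x = -1" by (simp add: add_eq_0_iff)
  then have "cmod a * cmod x = 1"
    by (metis complex_mod_cnj norm_minus_cancel norm_mult norm_one)
  moreover have "cmod a * cmod x \<le> cmod a * 1"
    using assms by (intro mult_left_mono) auto
  ultimately show False using assms by linarith
qed

lemma one_minus_cnj_mult_ne:
  assumes "cmod a < 1" "cmod x \<le> 1"
  shows "1 - cnj a * x \<noteq> 0"
  using disk_aut_denom_ne[of "-a" x] assms by simp

text \<open>The right-hand side is nonnegative on the closed disc. This gives
  \<open>disk_aut_norm_le\<close> and, with \<open>a\<close> taken to be \<open>-x\<close>, also
  \<open>phyp_1\<close>.\<close>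

lemma disk_aut_norm_identity:
  "(cmod (1 + cnj a * x))\<^sup>2 - (cmod (x + a))\<^sup>2 = (1 - (cmod a)\<^sup>2) * (1 - (cmod x)\<^sup>2)"
  unfolding cmod_power2 by (simp add: power2_eq_square algebra_simps)

lemma disk_aut_norm_le:
  assumes "cmod a < 1" "cmod x \<le> 1"
  shows "cmod (disk_aut a x) \<le> 1"
proof -
  have "0 \<le> (1 - (cmod a)\<^sup>2) * (1 - (cmod x)\<^sup>2)"
    using assms by (intro mult_nonneg_nonneg) (auto simp: power_le_one)
  then have "(cmod (x + a))\<^sup>2 \<le> (cmod (1 + cnj a * x))\<^sup>2"
    using disk_aut_norm_identity[of a x] by linarith
  then have "cmod (x + a) \<le> cmod (1 + cnj a * x)"
    by (simp add: power2_le_iff_abs_le)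
  then show ?thesis
    using disk_aut_denom_ne[OF assms] by (simp add: disk_aut_def norm_divide divide_le_eq)
qed

lemma disk_aut_inverse:
  assumes "cmod a < 1" "cmod x \<le> 1"
  shows "disk_aut (-a) (disk_aut a x) = x"
proof -
  have n: "1 + cnj a * x \<noteq> 0" by (rule disk_aut_denom_ne[OF assms])
  have "1 - cnj a * a \<noteq> 0"
    using one_minus_cnj_mult_ne[of a a] assms by auto
  moreover have "(x + a) / (1 + cnj a * x) - a = x * (1 - cnj a * a) / (1 + cnj a * x)"
    using n by (simp add: field_simps)
  moreover have "1 - cnj a * ((x + a) / (1 + cnj a * x)) = (1 - cnj a * a) / (1 + cnj a * x)"
    using n by (simp add: field_simps)
  ultimately show ?thesis
    using n by (simp add: disk_aut_def)
qed

lemma cnj_disk_aut: "cnj (disk_aut a x) = disk_aut (cnj a) (cnj x)"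
  by (simp add: disk_aut_def)

lemma disk_aut_diff:
  assumes "cmod a < 1" "cmod x \<le> 1" "cmod y \<le> 1"
  shows "disk_aut a x - disk_aut a y =
    of_real (1 - (cmod a)\<^sup>2) * (x - y) / ((1 + cnj a * x) * (1 + cnj a * y))"
proof -
  have n: "1 + cnj a * x \<noteq> 0" "1 + cnj a * y \<noteq> 0"
    using assms by (auto dest: disk_aut_denom_ne)
  have "disk_aut a x - disk_aut a y =
    ((x + a) * (1 + cnj a * y) - (y + a) * (1 + cnj a * x)) / ((1 + cnj a * x) * (1 + cnj a * y))"
    using n by (simp add: disk_aut_def diff_frac_eq)
  also have "(x + a) * (1 + cnj a * y) - (y + a) * (1 + cnj a * x) = (1 - a * cnj a) * (x - y)"
    by (simp add: algebra_simps)
  also have "1 - a * cnj a = of_real (1 - (cmod a)\<^sup>2)"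
    by (simp only: of_real_diff of_real_power complex_norm_square[symmetric]) simp
  finally show ?thesis .
qed

text \<open>The factor \<open>1 - (cmod a)\<^sup>2\<close> is the one of
  \<open>disk_aut_diff\<close>, and the two denominators have equal modulus. Hence both sides of the
  inequality in \<open>phyp\<close> are scaled alike by an automorphism.\<close>

lemma disk_aut_cross:
  assumes "cmod a < 1" "cmod x \<le> 1" "cmod y \<le> 1"
  shows "1 - cnj (disk_aut a x) * disk_aut a y =
    of_real (1 - (cmod a)\<^sup>2) * (1 - cnj x * y) / (cnj (1 + cnj a * x) * (1 + cnj a * y))"
proof -
  have n: "cnj (1 + cnj a * x) \<noteq> 0" "1 + cnj a * y \<noteq> 0"
    using disk_aut_denom_ne[of a x] disk_aut_denom_ne[of a y] assms
    by (simp_all only: complex_cnj_zero_iff not_False_eq_True)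
  have "1 - cnj (disk_aut a x) * disk_aut a y =
    (cnj (1 + cnj a * x) * (1 + cnj a * y) - cnj (x + a) * (y + a)) / (cnj (1 + cnj a * x) * (1 + cnj a * y))"
    using n by (simp add: disk_aut_def diff_divide_distrib del: complex_cnj_add)
  also have "cnj (1 + cnj a * x) * (1 + cnj a * y) - cnj (x + a) * (y + a) = (1 - a * cnj a) * (1 - cnj x * y)"
    by (simp add: algebra_simps)
  also have "1 - a * cnj a = of_real (1 - (cmod a)\<^sup>2)"
    by (simp only: of_real_diff of_real_power complex_norm_square[symmetric]) simp
  finally show ?thesis .
qed

text \<open>In the disc, \<open>phyp t x y\<close> says that the pseudo-hyperbolic distance of \<open>x\<close> and \<open>y\<close> is at
  most \<open>t\<close>; this multiplicative form still makes sense on the boundary.\<close>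

definition phyp :: "real \<Rightarrow> complex \<Rightarrow> complex \<Rightarrow> bool" where
  "phyp t x y \<longleftrightarrow> cmod (x - y) \<le> t * cmod (1 - cnj x * y)"

lemma phyp_disk_aut:
  assumes "cmod a < 1" "cmod x \<le> 1" "cmod y \<le> 1" "phyp t x y"
  shows "phyp t (disk_aut a x) (disk_aut a y)"
proof -
  define d where "d = cmod (1 + cnj a * x) * cmod (1 + cnj a * y)"
  define c where "c = \<bar>1 - (cmod a)\<^sup>2\<bar>"
  have "c * cmod (x - y) / d \<le> c * (t * cmod (1 - cnj x * y)) / d"
    using assms(4) unfolding phyp_def
    by (intro divide_right_mono mult_left_mono) (auto simp: c_def d_def)
  moreover have "cmod (cnj (1 + cnj a * x)) = cmod (1 + cnj a * x)"
    by (rule complex_mod_cnj)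
  ultimately show ?thesis
    unfolding phyp_def disk_aut_diff[OF assms(1-3)] disk_aut_cross[OF assms(1-3)]
      norm_divide norm_mult norm_of_real
    by (simp add: c_def d_def mult_ac)
qed

text \<open>With p = cnj x * y the loss is governed by |z| |1 - p| / |1 - |z|^2 p|, whose worst case
  over |p| <= 1 is p = -1; this is the factor 2 |z| / (1 + |z|^2). It is less than 1 in the disc and
  equal to 1 on the circle, so the lemma covers contraction inside and non-expansion on the
  boundary.\<close>

lemma phyp_mult:
  assumes "cmod z \<le> 1" "cmod x \<le> 1" "cmod y \<le> 1" "phyp t x y" "0 \<le> t"
  shows "phyp (t * (2 * cmod z / (1 + (cmod z)\<^sup>2))) (z * x) (z * y)"
proof -
  define p where "p = cnj x * y"
  define s where "s = (cmod z)\<^sup>2"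
  have s: "0 \<le> s" "s \<le> 1" using assms by (auto simp: s_def power_le_one)
  have p: "cmod p \<le> 1" using assms by (simp add: p_def norm_mult mult_le_one)
  then have p2: "(cmod p)\<^sup>2 \<le> 1" by (simp add: power_le_one)
  \<comment> \<open>The gap is a sum of nonnegative terms, both of which vanish at p = -1.\<close>
  have "(2 * cmod (1 - of_real s * p))\<^sup>2 - ((1 + s) * cmod (1 - p))\<^sup>2 =
     (1 - s)\<^sup>2 * (cmod (1 + p))\<^sup>2 + 2 * ((1 - s) * (1 + s)) * (1 - (cmod p)\<^sup>2)"
    unfolding power_mult_distrib cmod_power2 by (simp add: power2_eq_square algebra_simps)
  moreover have "0 \<le> (1 - s)\<^sup>2 * (cmod (1 + p))\<^sup>2 + 2 * ((1 - s) * (1 + s)) * (1 - (cmod p)\<^sup>2)"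
    using s p2 by simp
  ultimately have "((1 + s) * cmod (1 - p))\<^sup>2 \<le> (2 * cmod (1 - of_real s * p))\<^sup>2"
    by linarith
  then have key: "(1 + s) * cmod (1 - p) \<le> 2 * cmod (1 - of_real s * p)"
    by (rule power2_le_imp_le) simp
  have zz: "cnj (z * x) * (z * y) = of_real s * p"
    unfolding s_def p_def using complex_norm_square[of z] by (simp add: mult_ac)
  have "cmod (z * x - z * y) = cmod z * cmod (x - y)"
    by (metis norm_mult right_diff_distrib)
  also have "\<dots> \<le> cmod z * (t * cmod (1 - p))"
    using assms(4) by (intro mult_left_mono) (auto simp: phyp_def p_def)
  also have "\<dots> = cmod z * t * ((1 + s) * cmod (1 - p)) / (1 + s)"
    using s by simp
  also have "\<dots> \<le> cmod z * t * (2 * cmod (1 - of_real s * p)) / (1 + s)"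
    using key s assms by (intro divide_right_mono mult_left_mono) auto
  finally show ?thesis
    unfolding phyp_def zz by (simp add: s_def mult_ac)
qed

lemma phyp_imp_dist:
  assumes "phyp t x y" "cmod x \<le> 1" "cmod y \<le> 1" "0 \<le> t"
  shows "cmod (x - y) \<le> 2 * t"
proof -
  have "cmod (1 - cnj x * y) \<le> 1 + cmod (cnj x * y)"
    using norm_triangle_ineq4[of 1 "cnj x * y"] by simp
  also have "\<dots> \<le> 2"
    using assms by (simp add: norm_mult mult_le_one)
  finally have "t * cmod (1 - cnj x * y) \<le> t * 2"
    using assms by (intro mult_left_mono) auto
  then show ?thesis using assms unfolding phyp_def by linarith
qed

text \<open>This supplies the initial distance for contraction estimates: \<open>t = 1\<close>
  covers any two points of the closed disc, so the inner end of a chain may be arbitrary.\<close>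

lemma phyp_1:
  assumes "cmod x \<le> 1" "cmod y \<le> 1"
  shows "phyp 1 x y"
proof -
  have "(cmod (1 - cnj x * y))\<^sup>2 - (cmod (x - y))\<^sup>2 = (1 - (cmod x)\<^sup>2) * (1 - (cmod y)\<^sup>2)"
    using disk_aut_norm_identity[of "-x" y] norm_minus_commute[of y x] by simp
  moreover have "0 \<le> (1 - (cmod x)\<^sup>2) * (1 - (cmod y)\<^sup>2)"
    using assms by (intro mult_nonneg_nonneg) (auto simp: power_le_one)
  ultimately have "(cmod (x - y))\<^sup>2 \<le> (cmod (1 - cnj x * y))\<^sup>2"
    by linarith
  then have "cmod (x - y) \<le> cmod (1 - cnj x * y)"
    by (rule power2_le_imp_le) simp
  then show ?thesis
    unfolding phyp_def by simp
qed

section \<open>Chains: bounds, contraction and dependence on the parameters\<close>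

lemma mob_chain_norm_le:
  assumes "cmod z \<le> 1" "\<And>a. a \<in> set as \<Longrightarrow> cmod a < 1" "cmod s \<le> 1"
  shows "cmod (mob_chain z as s) \<le> 1"
  using assms
  by (induction as) (auto simp: norm_mult disk_aut_norm_le intro!: mult_le_one)

text \<open>The outermost factor \<open>z\<close> keeps the value away from the unit circle when |z|
  < 1; this provides the radius \<open>r < 1\<close> for \<open>disk_aut_lipschitz\<close>.\<close>

lemma mob_chain_norm_le_z:
  assumes "cmod z \<le> 1" "\<And>a. a \<in> set as \<Longrightarrow> cmod a < 1" "cmod s \<le> cmod z"
  shows "cmod (mob_chain z as s) \<le> cmod z"
  using assms
proof (cases as)
  case (Cons a bs)
  have "cmod (disk_aut a (mob_chain z bs s)) \<le> 1"
    using assms by (intro disk_aut_norm_le mob_chain_norm_le) (auto simp: Cons)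
  then show ?thesis
    using mult_left_mono[of "cmod (disk_aut a (mob_chain z bs s))" 1 "cmod z"]
    by (simp add: Cons norm_mult)
qed simp

lemma phyp_mob_chain:
  assumes "cmod z \<le> 1" "\<And>a. a \<in> set as \<Longrightarrow> cmod a < 1" "cmod s \<le> 1" "cmod s' \<le> 1" "phyp t s s'" "0 \<le> t"
  shows "phyp (t * (2 * cmod z / (1 + (cmod z)\<^sup>2)) ^ length as) (mob_chain z as s) (mob_chain z as s')"
  using assms(2)
proof (induction as)
  case Nil
  then show ?case using assms by simp
next
  case (Cons a as)
  have "phyp (t * (2 * cmod z / (1 + (cmod z)\<^sup>2)) ^ length as * (2 * cmod z / (1 + (cmod z)\<^sup>2)))
      (z * disk_aut a (mob_chain z as s)) (z * disk_aut a (mob_chain z as s'))"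
    using Cons assms
    by (intro phyp_mult phyp_disk_aut Cons.IH disk_aut_norm_le mob_chain_norm_le)
       (auto intro!: mult_nonneg_nonneg)
  then show ?case by (simp add: mult_ac)
qed

lemma kappa_less_1:
  assumes "cmod z < 1"
  shows "2 * cmod z / (1 + (cmod z)\<^sup>2) < 1"
proof -
  have "0 < (1 - cmod z)\<^sup>2" using assms by simp
  then have "2 * cmod z < 1 + (cmod z)\<^sup>2" by (simp add: power2_eq_square algebra_simps)
  moreover have "0 < 1 + (cmod z)\<^sup>2" by (simp add: add_pos_nonneg)
  ultimately show ?thesis by (simp add: divide_less_eq)
qed

text \<open>A chain forgets its inner end at a geometric rate that does not depend on the
  parameters. The convergence of the Schur algorithm and the dominance of the nearest coefficients
  both rest on this.\<close>

lemma mob_chain_contraction: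
  assumes "cmod z \<le> 1" "\<And>a. a \<in> set as \<Longrightarrow> cmod a < 1" "cmod s \<le> 1" "cmod s' \<le> 1"
  shows "cmod (mob_chain z as s - mob_chain z as s') \<le> 2 * (2 * cmod z / (1 + (cmod z)\<^sup>2)) ^ length as"
proof -
  have "phyp (1 * (2 * cmod z / (1 + (cmod z)\<^sup>2)) ^ length as) (mob_chain z as s) (mob_chain z as s')"
    using assms by (intro phyp_mob_chain phyp_1) auto
  then have "cmod (mob_chain z as s - mob_chain z as s') \<le> 2 * (1 * (2 * cmod z / (1 + (cmod z)\<^sup>2)) ^ length as)"
    using assms by (intro phyp_imp_dist mob_chain_norm_le) auto
  then show ?thesis by simp
qed

lemma mob_chain_measurable [measurable]:
  assumes [measurable]: "f \<in> borel_measurable M" "g \<in> borel_measurable M"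
  shows "(\<lambda>z. mob_chain (f z) as (g z)) \<in> borel_measurable M"
  by (induction as) (simp_all add: disk_aut_def)

lemma disk_aut_measurable [measurable]:
  assumes [measurable]: "g \<in> borel_measurable M"
  shows "(\<lambda>z. disk_aut a (g z)) \<in> borel_measurable M"
  by (simp add: disk_aut_def)

lemma disk_aut_holomorphic:
  assumes "cmod a < 1" "g holomorphic_on A" "\<And>z. z \<in> A \<Longrightarrow> cmod (g z) \<le> 1"
  shows "(\<lambda>z. disk_aut a (g z)) holomorphic_on A"
  unfolding disk_aut_def using assms by (intro holomorphic_intros disk_aut_denom_ne) auto

lemma mob_chain_holomorphic:
  assumes "\<And>a. a \<in> set as \<Longrightarrow> cmod a < 1" "cmod s \<le> 1"
  shows "(\<lambda>z. mob_chain z as s) holomorphic_on ball 0 1"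
  using assms
proof (induction as)
  case (Cons a as)
  then have "(\<lambda>z. disk_aut a (mob_chain z as s)) holomorphic_on ball 0 1"
    by (intro disk_aut_holomorphic mob_chain_norm_le) auto
  then show ?case by (auto intro!: holomorphic_intros)
qed simp

lemma mob_chain_continuous_on:
  assumes "\<And>a. a \<in> set as \<Longrightarrow> cmod a < 1" "cmod s \<le> 1"
  shows "continuous_on (cball 0 1) (\<lambda>z. mob_chain z as s)"
  using assms
proof (induction as)
  case (Cons a as)
  then have "continuous_on (cball 0 1) (\<lambda>z. z * disk_aut a (mob_chain z as s))"
    unfolding disk_aut_def
    by (intro continuous_intros Cons.IH ballI disk_aut_denom_ne mob_chain_norm_le) auto
  then show ?case by simp
qed simp

text \<open>The parameters may approach the unit circle, so the denominators are bounded below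
  through \<open>x\<close> and \<open>y\<close> alone and the constant involves only
  \<open>r\<close>.\<close>

lemma disk_aut_lipschitz:
  assumes "cmod a < 1" "cmod b < 1" "cmod x \<le> r" "cmod y \<le> r" "r < 1"
  shows "cmod (disk_aut a x - disk_aut b y) \<le> (2 * cmod (x - y) + 4 * cmod (a - b)) / (1 - r)\<^sup>2"
proof -
  have x: "cmod x \<le> 1" and y: "cmod y \<le> 1" using assms by auto
  have n: "1 + cnj a * x \<noteq> 0" "1 + cnj b * y \<noteq> 0"
    using disk_aut_denom_ne[of a x] disk_aut_denom_ne[of b y] assms by auto
  have eq: "disk_aut a x - disk_aut b y =
    ((x + a) * (1 + cnj b * y) - (y + b) * (1 + cnj a * x)) / ((1 + cnj a * x) * (1 + cnj b * y))"
    using n by (simp add: disk_aut_def diff_frac_eq)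
  \<comment> \<open>Two of the six terms carry \<open>x - y\<close> and four carry
    \<open>a - b\<close> or its conjugate, each times a factor of modulus at most 1; hence the
    constants 2 and 4.\<close>
  have num: "(x + a) * (1 + cnj b * y) - (y + b) * (1 + cnj a * x) =
     (x - y) + (a - b) - cnj (a - b) * (x * y) - (a * cnj b) * (x - y) + (a - b) * (cnj b * x) - cnj (a - b) * (b * x)"
    by (simp add: algebra_simps)
  have le: "cmod (u * v) \<le> cmod u" if "cmod v \<le> 1" for u v
    using that by (simp add: norm_mult mult_left_le)
  have v: "cmod (x * y) \<le> 1" "cmod (a * cnj b) \<le> 1" "cmod (cnj b * x) \<le> 1" "cmod (b * x) \<le> 1"
    using x y assms by (auto simp: norm_mult intro!: mult_le_one)
  have bounds: "cmod (cnj (a - b) * (x * y)) \<le> cmod (a - b)" "cmod ((a * cnj b) * (x - y)) \<le> cmod (x - y)"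
    "cmod ((a - b) * (cnj b * x)) \<le> cmod (a - b)" "cmod (cnj (a - b) * (b * x)) \<le> cmod (a - b)"
    using le[OF v(1), of "cnj (a - b)"] le[OF v(2), of "x - y"] le[OF v(3), of "a - b"] le[OF v(4), of "cnj (a - b)"]
    unfolding complex_mod_cnj by (simp_all only: mult.commute)
  have tri: "cmod (p + q - s - t + u - w) \<le> cmod p + cmod q + cmod s + cmod t + cmod u + cmod w" for p q s t u w
    by (smt (verit) norm_triangle_ineq norm_triangle_ineq4)
  have "cmod ((x + a) * (1 + cnj b * y) - (y + b) * (1 + cnj a * x)) \<le> 2 * cmod (x - y) + 4 * cmod (a - b)"
    unfolding num by (rule order_trans[OF tri]) (use bounds in linarith)
  moreover have "(1 - r) * (1 - r) \<le> cmod (1 + cnj a * x) * cmod (1 + cnj b * y)"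
    using assms by (intro mult_mono disk_aut_denom_ge) auto
  moreover have "0 < (1 - r) * (1 - r)" using assms by simp
  ultimately show ?thesis
    unfolding eq norm_divide norm_mult power2_eq_square by (intro frac_le) auto
qed

text \<open>Only the differences of the parameters converge; the parameters themselves may oscillate
  or approach the circle. Induction on the length peels off the outermost parameter, and the inner
  chains stay in the disc of radius |z|.\<close>

lemma mob_chain_param_tendsto:
  assumes "cmod z < 1" "\<And>j i. cmod (a j i) < 1" "\<And>j i. cmod (b j i) < 1"
    "\<And>i. i < L \<Longrightarrow> (\<lambda>j. a j i - b j i) \<longlonglongrightarrow> 0"
  shows "(\<lambda>j. mob_chain z (map (a j) [0..<L]) 0 - mob_chain z (map (b j) [0..<L]) 0) \<longlonglongrightarrow> 0"
  using assms(2-)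
proof (induction L arbitrary: a b)
  case (Suc L)
  define x where "x = (\<lambda>j. mob_chain z (map (\<lambda>i. a j (Suc i)) [0..<L]) 0)"
  define y where "y = (\<lambda>j. mob_chain z (map (\<lambda>i. b j (Suc i)) [0..<L]) 0)"
  have xy: "(\<lambda>j. x j - y j) \<longlonglongrightarrow> 0"
    unfolding x_def y_def using Suc.prems by (intro Suc.IH) auto
  have le: "cmod (x j) \<le> cmod z" "cmod (y j) \<le> cmod z" for j
    unfolding x_def y_def using assms(1) Suc.prems by (auto intro!: mob_chain_norm_le_z)
  have "(\<lambda>j. (2 * cmod (x j - y j) + 4 * cmod (a j 0 - b j 0)) / (1 - cmod z)\<^sup>2) \<longlonglongrightarrow> (2 * 0 + 4 * 0) / (1 - cmod z)\<^sup>2"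
    using assms(1) Suc.prems(3)[of 0] xy by (intro tendsto_intros tendsto_norm_zero) auto
  then have lim: "(\<lambda>j. (2 * cmod (x j - y j) + 4 * cmod (a j 0 - b j 0)) / (1 - cmod z)\<^sup>2) \<longlonglongrightarrow> 0"
    by simp
  have "(\<lambda>j. disk_aut (a j 0) (x j) - disk_aut (b j 0) (y j)) \<longlonglongrightarrow> 0"
    by (rule Lim_null_comparison[OF always_eventually lim]) (intro allI disk_aut_lipschitz Suc.prems le assms(1))
  then have "(\<lambda>j. z * (disk_aut (a j 0) (x j) - disk_aut (b j 0) (y j))) \<longlonglongrightarrow> z * 0"
    by (intro tendsto_intros)
  then show ?case
    by (simp add: map_upt_Suc x_def y_def algebra_simps del: upt_Suc)
qed simp

section \<open>Schur functions as limits of finite chains\<close>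

definition schur_chain :: "(nat \<Rightarrow> complex) \<Rightarrow> nat \<Rightarrow> nat \<Rightarrow> complex \<Rightarrow> complex" where
  "schur_chain \<alpha> n N z = mob_chain z (map \<alpha> [n..<n + N]) 0"

text \<open>The chains converge to z f, so one more automorphism without the factor \<open>z\<close>
  produces f itself and no division at 0 occurs. Convergence is established in the open disc; values
  on the circle are introduced separately through radial limits. Being a pointwise
  \<open>lim\<close> of measurable functions, it is measurable on the whole plane.\<close>

definition schur_fun :: "(nat \<Rightarrow> complex) \<Rightarrow> nat \<Rightarrow> complex \<Rightarrow> complex" where
  "schur_fun \<alpha> n z = lim (\<lambda>N. disk_aut (\<alpha> n) (schur_chain \<alpha> (Suc n) N z))"

lemma schur_fun_measurable [measurable]: "schur_fun \<alpha> n \<in> borel_measurable borel"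
  unfolding schur_fun_def schur_chain_def by measurable

lemma kappa_mono:
  assumes "0 \<le> s" "s \<le> t" "t \<le> (1::real)"
  shows "2 * s / (1 + s\<^sup>2) \<le> 2 * t / (1 + t\<^sup>2)"
proof -
  have "s * t \<le> 1" using assms by (intro mult_le_one) auto
  then have "0 \<le> (t - s) * (1 - s * t)" using assms by simp
  then have "2 * s * (1 + t\<^sup>2) \<le> 2 * t * (1 + s\<^sup>2)"
    by (simp add: power2_eq_square algebra_simps)
  moreover have "0 < 1 + s\<^sup>2" "0 < 1 + t\<^sup>2" by (simp_all add: add_pos_nonneg)
  ultimately show ?thesis by (simp add: pos_divide_le_eq pos_le_divide_eq)
qed

context
  fixes \<alpha> :: "nat \<Rightarrow> complex"
  assumes \<alpha>: "\<And>n. cmod (\<alpha> n) < 1"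
begin

lemma schur_chain_norm_le: "cmod z \<le> 1 \<Longrightarrow> cmod (schur_chain \<alpha> n N z) \<le> cmod z"
  unfolding schur_chain_def using \<alpha> by (intro mob_chain_norm_le_z) auto

lemma schur_chain_Suc: "schur_chain \<alpha> n (Suc N) z = z * disk_aut (\<alpha> n) (schur_chain \<alpha> (Suc n) N z)"
  by (simp add: schur_chain_def upt_conv_Cons del: upt_Suc)

lemma schur_chain_diff:
  assumes "cmod z < 1" "N \<le> M"
  shows "cmod (schur_chain \<alpha> n N z - schur_chain \<alpha> n M z) \<le> 2 * (2 * cmod z / (1 + (cmod z)\<^sup>2)) ^ N"
proof -
  obtain K where K: "M = N + K" using assms(2) le_Suc_ex by blast
  have "[n..<n + M] = [n..<n + N] @ [n + N..<n + N + K]"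
    unfolding K using upt_add_eq_append[of n "n + N" K] by (simp add: add.assoc)
  then have "schur_chain \<alpha> n M z = mob_chain z (map \<alpha> [n..<n + N]) (schur_chain \<alpha> (n + N) K z)"
    by (simp add: schur_chain_def del: upt_Suc)
  then show ?thesis
    using mob_chain_contraction[of z "map \<alpha> [n..<n + N]" 0 "schur_chain \<alpha> (n + N) K z"] assms \<alpha>
      schur_chain_norm_le[of z "n + N" K] by (auto simp: schur_chain_def[of _ n N])
qed

lemma schur_chain_uniform_Cauchy:
  assumes "r < 1"
  shows "uniformly_Cauchy_on (cball 0 r) (schur_chain \<alpha> n)"
proof (rule uniformly_Cauchy_onI)
  fix e :: real assume e: "0 < e"
  show "\<exists>M. \<forall>z\<in>cball 0 r. \<forall>m\<ge>M. \<forall>k\<ge>M. dist (schur_chain \<alpha> n m z) (schur_chain \<alpha> n k z) < e"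
  proof (cases "r < 0")
    case True
    then show ?thesis by auto
  next
    case False
    define k where "k = 2 * r / (1 + r\<^sup>2)"
    have k: "0 \<le> k" "k < 1"
      using kappa_less_1[of "of_real r"] False assms by (auto simp: k_def)
    \<comment> \<open>Both chains are compared with the chain of length \<open>M\<close>, at a cost
      of \<open>2 * k ^ M\<close> each.\<close>
    then have "(\<lambda>N. 4 * k ^ N) \<longlonglongrightarrow> 0"
      by (intro tendsto_mult_right_zero LIMSEQ_power_zero) auto
    then have "eventually (\<lambda>N. 4 * k ^ N < e) sequentially"
      using e by (rule order_tendstoD)
    then obtain M where M: "4 * k ^ M < e" by (auto simp: eventually_sequentially)
    have "dist (schur_chain \<alpha> n m z) (schur_chain \<alpha> n l z) < e" if "cmod z \<le> r" "m \<ge> M" "l \<ge> M" for z m l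
    proof -
      have "2 * cmod z / (1 + (cmod z)\<^sup>2) \<le> k"
        unfolding k_def using that assms by (intro kappa_mono) auto
      then have "(2 * cmod z / (1 + (cmod z)\<^sup>2)) ^ M \<le> k ^ M" by (intro power_mono) auto
      moreover have "cmod (schur_chain \<alpha> n M z - schur_chain \<alpha> n m z) \<le> 2 * (2 * cmod z / (1 + (cmod z)\<^sup>2)) ^ M"
        "cmod (schur_chain \<alpha> n M z - schur_chain \<alpha> n l z) \<le> 2 * (2 * cmod z / (1 + (cmod z)\<^sup>2)) ^ M"
        using that assms by (intro schur_chain_diff; simp)+
      ultimately show ?thesis
        using M dist_triangle[of "schur_chain \<alpha> n m z" "schur_chain \<alpha> n l z" "schur_chain \<alpha> n M z"]
        by (simp add: dist_norm norm_minus_commute)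
    qed
    then show ?thesis by (intro exI[of _ M]) auto
  qed
qed

lemma schur_chain_convergent:
  assumes "cmod z < 1"
  shows "convergent (\<lambda>N. schur_chain \<alpha> n N z)"
proof -
  have "Cauchy (\<lambda>N. schur_chain \<alpha> n N z)"
    using schur_chain_uniform_Cauchy[OF assms, of n] by (rule uniformly_Cauchy_imp_Cauchy) simp
  then show ?thesis by (simp add: Cauchy_convergent)
qed

lemma schur_fun_tendsto:
  assumes "cmod z < 1"
  shows "(\<lambda>N. disk_aut (\<alpha> n) (schur_chain \<alpha> (Suc n) N z)) \<longlonglongrightarrow> schur_fun \<alpha> n z"
proof -
  obtain y where y: "(\<lambda>N. schur_chain \<alpha> (Suc n) N z) \<longlonglongrightarrow> y"
    using schur_chain_convergent[OF assms, of "Suc n"] by (auto simp: convergent_def)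
  have "cmod y \<le> 1"
    by (rule tendsto_upperbound[OF tendsto_norm[OF y]])
       (use assms in \<open>auto intro!: always_eventually order_trans[OF schur_chain_norm_le]\<close>)
  then have "(\<lambda>N. disk_aut (\<alpha> n) (schur_chain \<alpha> (Suc n) N z)) \<longlonglongrightarrow> disk_aut (\<alpha> n) y"
    unfolding disk_aut_def using disk_aut_denom_ne[OF \<alpha>] y by (intro tendsto_intros) auto
  then show ?thesis
    unfolding schur_fun_def by (simp add: limI)
qed

lemma schur_chain_tendsto:
  assumes "cmod z < 1"
  shows "(\<lambda>N. schur_chain \<alpha> n N z) \<longlonglongrightarrow> z * schur_fun \<alpha> n z"
proof -
  have "(\<lambda>N. schur_chain \<alpha> n (Suc N) z) \<longlonglongrightarrow> z * schur_fun \<alpha> n z"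
    unfolding schur_chain_Suc by (intro tendsto_intros schur_fun_tendsto assms)
  then show ?thesis by (rule LIMSEQ_imp_Suc)
qed

lemma schur_fun_norm_le:
  assumes "cmod z < 1"
  shows "cmod (schur_fun \<alpha> n z) \<le> 1"
  by (rule tendsto_upperbound[OF tendsto_norm[OF schur_fun_tendsto[OF assms]]])
     (use assms in \<open>auto intro!: always_eventually disk_aut_norm_le \<alpha> order_trans[OF schur_chain_norm_le]\<close>)

lemma schur_fun_step:
  assumes "cmod z < 1"
  shows "schur_fun \<alpha> n z = disk_aut (\<alpha> n) (z * schur_fun \<alpha> (Suc n) z)"
proof -
  have "cmod (z * schur_fun \<alpha> (Suc n) z) \<le> 1"
    using schur_fun_norm_le[OF assms] assms by (simp add: norm_mult mult_le_one)
  then have "(\<lambda>N. disk_aut (\<alpha> n) (schur_chain \<alpha> (Suc n) N z)) \<longlonglongrightarrow> disk_aut (\<alpha> n) (z * schur_fun \<alpha> (Suc n) z)"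
    unfolding disk_aut_def using disk_aut_denom_ne[OF \<alpha>]
    by (intro tendsto_intros schur_chain_tendsto assms) auto
  then show ?thesis
    using schur_fun_tendsto[OF assms] LIMSEQ_unique by blast
qed

lemma schur_fun_0: "schur_fun \<alpha> n 0 = \<alpha> n"
  using schur_fun_step[of 0 n] by (simp add: disk_aut_def)

text \<open>Unrolling the recursion \<open>N\<close> times and contracting shows that a bounded
  solution at the single point \<open>z\<close> is determined by the parameters. The ratios of
  resolvent entries can therefore be identified without knowing how they depend on
  \<open>z\<close>.\<close>

lemma schur_fun_unique:
  assumes z: "cmod z < 1" and s: "\<And>n. cmod (s n) \<le> 1"
    "\<And>n. s n = z * disk_aut (\<alpha> n) (s (Suc n))"
  shows "s n = z * schur_fun \<alpha> n z"
proof -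
  have eq: "s n = mob_chain z (map \<alpha> [n..<n + N]) (s (n + N))" for N
    by (induction N) (use s(2)[of "n + N" for N] in \<open>auto simp: upt_Suc_append\<close>)
  have "(\<lambda>N. schur_chain \<alpha> n N z - s n) \<longlonglongrightarrow> 0"
  proof (rule tendsto_0_le[where K = 1])
    show "(\<lambda>N. 2 * (2 * cmod z / (1 + (cmod z)\<^sup>2)) ^ N) \<longlonglongrightarrow> 0"
      using kappa_less_1[OF z] by (intro tendsto_mult_right_zero LIMSEQ_power_zero) auto
    show "eventually (\<lambda>N. norm (schur_chain \<alpha> n N z - s n) \<le> norm (2 * (2 * cmod z / (1 + (cmod z)\<^sup>2)) ^ N) * 1) sequentially"
    proof (rule always_eventually, rule allI)
      fix N
      show "norm (schur_chain \<alpha> n N z - s n) \<le> norm (2 * (2 * cmod z / (1 + (cmod z)\<^sup>2)) ^ N) * 1"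
        using mob_chain_contraction[of z "map \<alpha> [n..<n + N]" 0 "s (n + N)"] z \<alpha> s(1)
        by (subst eq[of N]) (auto simp: norm_power schur_chain_def)
    qed
  qed
  then have "(\<lambda>N. schur_chain \<alpha> n N z) \<longlonglongrightarrow> s n" by (simp add: LIM_zero_iff)
  then show ?thesis
    using schur_chain_tendsto[OF z] LIMSEQ_unique by blast
qed

text \<open>Chains converge locally uniformly to z times the next Schur function; applying the
  automorphism with parameter \<open>\<alpha> n\<close> to this limit avoids a division by
  z.\<close>

lemma schur_fun_holomorphic: "schur_fun \<alpha> n holomorphic_on ball 0 1"
proof -
  have lim: "(\<lambda>z. z * schur_fun \<alpha> (Suc n) z) holomorphic_on ball 0 1"
  proof (rule holomorphic_uniform_sequence)
    show "schur_chain \<alpha> (Suc n) N holomorphic_on ball 0 1" for N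
      unfolding schur_chain_def using \<alpha> by (intro mob_chain_holomorphic) auto
    show "\<exists>d>0. cball x d \<subseteq> ball 0 1 \<and>
        uniform_limit (cball x d) (schur_chain \<alpha> (Suc n)) (\<lambda>z. z * schur_fun \<alpha> (Suc n) z) sequentially"
      if "x \<in> ball 0 1" for x
    proof -
      define d where "d = (1 - cmod x) / 2"
      have d: "d > 0" "cmod x + d < 1" using that by (auto simp: d_def field_simps)
      have sub: "cball x d \<subseteq> cball 0 (cmod x + d)"
      proof
        fix y assume "y \<in> cball x d"
        then show "y \<in> cball 0 (cmod x + d)"
          using norm_triangle_ineq[of x "y - x"] by (simp add: dist_norm norm_minus_commute)
      qed
      then have "uniformly_Cauchy_on (cball x d) (schur_chain \<alpha> (Suc n))"
        using schur_chain_uniform_Cauchy[OF d(2), of "Suc n"] unfolding uniformly_Cauchy_on_def by blast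
      then obtain l where l: "uniform_limit (cball x d) (schur_chain \<alpha> (Suc n)) l sequentially"
        using Cauchy_uniformly_convergent uniformly_convergent_on_def by blast
      have "l z = z * schur_fun \<alpha> (Suc n) z" if "z \<in> cball x d" for z
      proof -
        have "cmod z < 1" using sub that d by auto
        then show ?thesis
          using tendsto_uniform_limitI[OF l that] schur_chain_tendsto LIMSEQ_unique by blast
      qed
      then have "uniform_limit (cball x d) (schur_chain \<alpha> (Suc n)) (\<lambda>z. z * schur_fun \<alpha> (Suc n) z) sequentially"
        by (rule uniform_limit_cong'[THEN iffD1, OF refl _ l])
      moreover have "cball x d \<subseteq> ball 0 1" using sub d by auto
      ultimately show ?thesis using d by auto
    qed
  qed simp
  have "(\<lambda>z. disk_aut (\<alpha> n) (z * schur_fun \<alpha> (Suc n) z)) holomorphic_on ball 0 1"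
    using lim by (rule disk_aut_holomorphic[OF \<alpha>]) (auto simp: norm_mult intro!: mult_le_one schur_fun_norm_le)
  then show ?thesis
    by (rule holomorphic_transform) (simp add: schur_fun_step[symmetric])
qed

lemma schur_fun_next:
  assumes "cmod z < 1" "z \<noteq> 0"
  shows "schur_fun \<alpha> (Suc n) z = disk_aut (- \<alpha> n) (schur_fun \<alpha> n z) / z"
proof -
  have "cmod (z * schur_fun \<alpha> (Suc n) z) \<le> 1"
    using schur_fun_norm_le[OF assms(1)] assms(1) by (simp add: norm_mult mult_le_one)
  then show ?thesis
    using disk_aut_inverse[OF \<alpha>, of "z * schur_fun \<alpha> (Suc n) z" n] assms schur_fun_step[OF assms(1), of n]
    by simp
qed

end

section \<open>The spectral measure of a CMV matrix\<close>

lemma ell2_comb: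
  assumes "f \<in> ell2" "g \<in> ell2"
  shows "(\<lambda>n. a * f n + b * g n) \<in> ell2"
proof -
  have "(cmod (a * f n + b * g n))\<^sup>2 \<le> 2 * (cmod a)\<^sup>2 * (cmod (f n))\<^sup>2 + 2 * (cmod b)\<^sup>2 * (cmod (g n))\<^sup>2" for n
  proof -
    have "(cmod (a * f n + b * g n))\<^sup>2 \<le> (cmod (a * f n) + cmod (b * g n))\<^sup>2"
      by (intro power_mono norm_triangle_ineq) simp
    also have "\<dots> \<le> 2 * (cmod (a * f n))\<^sup>2 + 2 * (cmod (b * g n))\<^sup>2"
      using sum_squares_bound[of "cmod (a * f n)" "cmod (b * g n)"] by (simp add: power2_sum)
    finally show ?thesis by (simp add: norm_mult power_mult_distrib)
  qed
  moreover have "summable (\<lambda>n. 2 * (cmod a)\<^sup>2 * (cmod (f n))\<^sup>2 + 2 * (cmod b)\<^sup>2 * (cmod (g n))\<^sup>2)"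
    using assms unfolding ell2_def by (intro summable_add summable_mult) auto
  ultimately show ?thesis
    unfolding ell2_def by (auto intro: summable_comparison_test')
qed

lemma ell2_delta: "(\<lambda>n. if n = 0 then 1 else 0) \<in> ell2"
proof -
  have "summable (\<lambda>n::nat. (cmod (if n = 0 then 1 else 0))\<^sup>2)"
    by (rule summable_finite[of "{0}"]) auto
  then show ?thesis by (simp add: ell2_def)
qed

lemma ell2_tendsto_0:
  assumes "f \<in> ell2"
  shows "(\<lambda>n. (cmod (f n))\<^sup>2) \<longlonglongrightarrow> 0"
  using assms unfolding ell2_def mem_Collect_eq by (rule summable_LIMSEQ_zero)

text \<open>This suits operators built from 2 by 2 blocks, where an entry is controlled by two
  neighbouring ones. At \<open>n = 0\<close> truncated subtraction lets \<open>n - 1\<close> repeat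
  coordinate 0, which is harmless.\<close>

lemma ell2_local:
  assumes "f \<in> ell2" "\<And>n. \<exists>i\<in>{n - 1, n, n + 1}. \<exists>j\<in>{n - 1, n, n + 1}. cmod (F n) \<le> cmod (f i) + cmod (f j)"
  shows "F \<in> ell2"
proof -
  let ?q = "\<lambda>n. (cmod (f n))\<^sup>2"
  have s: "summable ?q" using assms(1) by (simp add: ell2_def)
  have s1: "summable (\<lambda>n. ?q (n - 1))" by (subst summable_Suc_iff[symmetric]) (simp add: s)
  have s2: "summable (\<lambda>n. ?q (n + 1))" using s by (subst summable_iff_shift)
  \<comment> \<open>The constant is 2 from squaring a sum of two terms, times 2 because each of them
    is bounded by the whole three-term sum.\<close>
  have "summable (\<lambda>n. 4 * (?q (n - 1) + ?q n + ?q (n + 1)))"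
    using s s1 s2 by (intro summable_mult summable_add)
  moreover have "(cmod (F n))\<^sup>2 \<le> 4 * (?q (n - 1) + ?q n + ?q (n + 1))" for n
  proof -
    obtain i j where ij: "i \<in> {n - 1, n, n + 1}" "j \<in> {n - 1, n, n + 1}" "cmod (F n) \<le> cmod (f i) + cmod (f j)"
      using assms(2)[of n] by blast
    have "(cmod (F n))\<^sup>2 \<le> (cmod (f i) + cmod (f j))\<^sup>2" using ij(3) by (intro power_mono) auto
    also have "\<dots> \<le> 2 * ?q i + 2 * ?q j"
      using sum_squares_bound[of "cmod (f i)" "cmod (f j)"] by (simp add: power2_sum)
    finally have "(cmod (F n))\<^sup>2 \<le> 2 * ?q i + 2 * ?q j" .
    moreover have "?q i \<le> ?q (n - 1) + ?q n + ?q (n + 1)" "?q j \<le> ?q (n - 1) + ?q n + ?q (n + 1)"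
      using ij(1,2) by auto
    moreover define S where "S = ?q (n - 1) + ?q n + ?q (n + 1)"
    ultimately show ?thesis unfolding S_def[symmetric] by linarith
  qed
  ultimately show ?thesis
    unfolding ell2_def by (auto intro: summable_comparison_test')
qed

section \<open>The blocks of the CMV matrix, its resolvent and the Poisson integral of the spectral
  measure\<close>

context
  fixes \<alpha> :: "nat \<Rightarrow> complex"
  assumes \<alpha>: "\<And>n. cmod (\<alpha> n) < 1"
begin

lemma rho_pos: "0 < rho \<alpha> k"
  using \<alpha>[of k] by (simp add: rho_def power_less_one_iff)

lemma rho_sq: "(rho \<alpha> k)\<^sup>2 = 1 - (cmod (\<alpha> k))\<^sup>2"
  using \<alpha>[of k] by (simp add: rho_def power_le_one)

lemma Theta_le:
  "cmod (fst (Theta \<alpha> k (x, y))) \<le> cmod x + cmod y"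
  "cmod (snd (Theta \<alpha> k (x, y))) \<le> cmod x + cmod y"
proof -
  have "rho \<alpha> k \<le> 1" by (simp add: rho_def)
  then have b: "cmod (of_real (rho \<alpha> k) * w) \<le> cmod w" "cmod (\<alpha> k * w) \<le> cmod w" "cmod (cnj (\<alpha> k) * w) \<le> cmod w" for w
    using rho_pos[of k] \<alpha>[of k] by (auto simp: norm_mult intro!: mult_left_le_one_le)
  show "cmod (fst (Theta \<alpha> k (x, y))) \<le> cmod x + cmod y"
    using norm_triangle_mono[OF b(3)[of x] b(1)[of y]] by (simp add: Theta_def)
  show "cmod (snd (Theta \<alpha> k (x, y))) \<le> cmod x + cmod y"
    using order_trans[OF norm_triangle_ineq4 add_mono[OF b(1)[of x] b(2)[of y]]] by (simp add: Theta_def)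
qed

lemma cmv_L_ell2: "f \<in> ell2 \<Longrightarrow> cmv_L \<alpha> f \<in> ell2"
  by (rule ell2_local[of f]) (auto simp: cmv_L_def intro!: Theta_le)

lemma cmv_M_ell2: "f \<in> ell2 \<Longrightarrow> cmv_M \<alpha> f \<in> ell2"
  by (rule ell2_local[of f]) (auto simp: cmv_M_def intro!: Theta_le)

text \<open>Unitarity of a block, rearranged as a conservation law: what the first coordinate gains,
  the second loses. In this form the quantity can be passed on from block to block.\<close>

lemma Theta_energy:
  assumes "Y1 = cnj (\<alpha> k) * X1 + of_real (rho \<alpha> k) * X2" "Y2 = of_real (rho \<alpha> k) * X1 - \<alpha> k * X2"
  shows "(cmod Y1)\<^sup>2 - (cmod X1)\<^sup>2 = (cmod X2)\<^sup>2 - (cmod Y2)\<^sup>2"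
proof -
  have "(rho \<alpha> k)\<^sup>2 = 1 - (Re (\<alpha> k))\<^sup>2 - (Im (\<alpha> k))\<^sup>2"
    using rho_sq[of k] by (simp add: cmod_power2)
  then show ?thesis
    unfolding assms cmod_power2 by simp algebra
qed

text \<open>Viewed projectively, a block is a disc automorphism: both numerator and denominator
  acquire the same factor \<open>rho\<close>, which cancels. This is the link between the CMV
  factorisation and the Schur algorithm.\<close>

lemma Theta_ratio:
  assumes "Y1 = cnj (\<alpha> k) * X1 + of_real (rho \<alpha> k) * X2" "Y2 = of_real (rho \<alpha> k) * X1 - \<alpha> k * X2"
    and "X2 \<noteq> 0" "Y1 \<noteq> 0"
  shows "X1 / Y1 = disk_aut (\<alpha> k) (Y2 / X2)"
proof -
  define r where "r = complex_of_real (rho \<alpha> k)"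
  have r: "r \<noteq> 0" using rho_pos[of k] by (simp add: r_def)
  have "r * r = of_real ((rho \<alpha> k)\<^sup>2)" by (simp add: r_def power2_eq_square)
  also have "\<dots> = 1 - \<alpha> k * cnj (\<alpha> k)"
    unfolding rho_sq by (simp only: of_real_diff of_real_power complex_norm_square[symmetric]) simp
  finally have rr: "r * r = 1 - \<alpha> k * cnj (\<alpha> k)" .
  have Y2: "Y2 = r * X1 - \<alpha> k * X2" and Y1: "Y1 = cnj (\<alpha> k) * X1 + r * X2"
    using assms by (simp_all add: r_def)
  have "Y2 / X2 + \<alpha> k = r * X1 / X2"
    using assms(3) by (simp add: Y2 field_simps)
  moreover have "1 + cnj (\<alpha> k) * (Y2 / X2) = r * Y1 / X2"
  proof -
    have "X2 + cnj (\<alpha> k) * Y2 = r * Y1"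
      unfolding Y1 Y2 using rr by algebra
    then show ?thesis using assms(3) by (simp add: field_simps)
  qed
  ultimately show ?thesis
    using r assms(3,4) by (simp add: disk_aut_def)
qed

text \<open>For \<open>g\<close> in \<open>ell2\<close> with \<open>(C - z) g = e\<^sub>0\<close>, the ratios of entries of \<open>g\<close> and \<open>M g\<close> run through
  the Schur iterates: the blocks of \<open>M\<close> and \<open>L\<close> act on them as steps of the Schur algorithm, and
  the decay of \<open>g\<close> keeps them in the unit disc.\<close>

lemma cmv_resolvent_schur:
  assumes z: "cmod z < 1" "z \<noteq> 0" and g: "g \<in> ell2"
    and eq: "\<And>n. cmv \<alpha> g n = z * g n + (if n = 0 then 1 else 0)"
  shows "1 + z * g 0 \<noteq> 0" "z * schur_fun \<alpha> 0 z = z * g 0 / (1 + z * g 0)"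
proof -
  define h where "h = cmv_M \<alpha> g"
  have h: "h \<in> ell2" unfolding h_def by (rule cmv_M_ell2[OF g])
  \<comment> \<open>Block \<open>k\<close> sends the pair \<open>x k\<close>, \<open>X k\<close> to
    \<open>y k\<close>, \<open>Y k\<close>. For odd \<open>k\<close> it is a block of M acting on
    \<open>g\<close>; for even \<open>k\<close> it is a block of L acting on \<open>h\<close>, whose
    output is z g + e_0.\<close>
  define x where "x = (\<lambda>k. if odd k then g k else h k)"
  define y where "y = (\<lambda>k. if odd k then h k else z * g k + (if k = 0 then 1 else 0))"
  define X where "X = (\<lambda>k. if odd k then g (Suc k) else h (Suc k))"
  define Y where "Y = (\<lambda>k. if odd k then h (Suc k) else z * g (Suc k))"
  have h0: "h 0 = g 0" by (simp add: h_def cmv_M_def)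
  have Lh: "cmv_L \<alpha> h n = z * g n + (if n = 0 then 1 else 0)" for n
    using eq[of n] by (simp add: cmv_def h_def)
  have blk: "y k = cnj (\<alpha> k) * x k + of_real (rho \<alpha> k) * X k"
    "Y k = of_real (rho \<alpha> k) * x k - \<alpha> k * X k" for k
  proof -
    have "odd k \<Longrightarrow> y k = cnj (\<alpha> k) * x k + of_real (rho \<alpha> k) * X k \<and> Y k = of_real (rho \<alpha> k) * x k - \<alpha> k * X k"
      by (auto simp: y_def x_def X_def Y_def h_def cmv_M_def Theta_def odd_pos)
    moreover have "even k \<Longrightarrow> y k = cnj (\<alpha> k) * x k + of_real (rho \<alpha> k) * X k \<and> Y k = of_real (rho \<alpha> k) * x k - \<alpha> k * X k"
      using Lh[of k] Lh[of "Suc k"] by (auto simp: y_def x_def X_def Y_def cmv_L_def Theta_def)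
    ultimately show "y k = cnj (\<alpha> k) * x k + of_real (rho \<alpha> k) * X k"
      "Y k = of_real (rho \<alpha> k) * x k - \<alpha> k * X k" by blast+
  qed
  \<comment> \<open>The flux \<open>E\<close> is conserved across a block and can only drop between
    blocks, where a factor \<open>z\<close> appears on one side. It tends to 0 by square
    summability, so it is nonnegative, and this gives |x k| <= |y k|.\<close>
  define E where "E = (\<lambda>k. (cmod (y k))\<^sup>2 - (cmod (x k))\<^sup>2)"
  have zle: "(cmod (z * w))\<^sup>2 \<le> (cmod w)\<^sup>2" for w
    using z by (intro power_mono) (auto simp: norm_mult mult_left_le_one_le)
  have mono: "E (Suc k) \<le> E k" for k
  proof -
    have "E k = (cmod (X k))\<^sup>2 - (cmod (Y k))\<^sup>2"
      unfolding E_def by (rule Theta_energy[OF blk])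
    then show ?thesis
      using zle[of "g (Suc k)"] by (auto simp: E_def X_def Y_def x_def y_def)
  qed
  have Elim: "E \<longlonglongrightarrow> 0"
  \<comment> \<open>The comparison starts at 1 because \<open>y 0\<close> contains the source term
    1.\<close>
  proof (rule Lim_null_comparison[OF eventually_sequentiallyI[of 1]])
    show "norm (E k) \<le> (cmod (g k))\<^sup>2 + (cmod (h k))\<^sup>2" if "1 \<le> k" for k
    proof -
      have "norm (E k) \<le> (cmod (y k))\<^sup>2 + (cmod (x k))\<^sup>2" by (simp add: E_def abs_le_iff)
      moreover have "(cmod (y k))\<^sup>2 + (cmod (x k))\<^sup>2 \<le> (cmod (g k))\<^sup>2 + (cmod (h k))\<^sup>2"
        using zle[of "g k"] that unfolding x_def y_def by (cases "odd k") (simp_all del: power_mono_iff)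
      ultimately show ?thesis by linarith
    qed
    show "(\<lambda>k. (cmod (g k))\<^sup>2 + (cmod (h k))\<^sup>2) \<longlonglongrightarrow> 0"
      using tendsto_add[OF ell2_tendsto_0[OF g] ell2_tendsto_0[OF h]] by simp
  qed
  have E0: "0 \<le> E k" for k
    using decseq_ge[OF decseq_SucI Elim] mono by blast
  have xy: "cmod (x k) \<le> cmod (y k)" for k
    using E0[of k] by (simp add: E_def power2_le_iff_abs_le)
  \<comment> \<open>A zero of \<open>y\<close> makes both outputs and inputs of the preceding block
    vanish, since \<open>rho\<close> is positive. It thus propagates down to \<open>k = 0\<close>,
    where \<open>x 0 = g 0\<close> and \<open>y 0 = z * g 0 + 1\<close> cannot both vanish.\<close>
  have step: "X k = 0 \<and> Y k = 0" if "y (Suc k) = 0" for k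
    using that xy[of "Suc k"] z by (auto simp: X_def Y_def x_def y_def split: if_splits)
  have y: "y k \<noteq> 0" for k
  proof (induction k)
    case 0
    show ?case
    proof
      assume "y 0 = 0"
      then have "x 0 = 0" using xy[of 0] by simp
      with \<open>y 0 = 0\<close> show False by (simp add: x_def y_def h0)
    qed
  next
    case (Suc k)
    show ?case
    proof
      assume "y (Suc k) = 0"
      then have "X k = 0" "Y k = 0" using step by auto
      with blk[of k] rho_pos[of k] have "x k = 0" by simp
      with \<open>X k = 0\<close> blk[of k] Suc show False by simp
    qed
  qed
  have Xn: "X k \<noteq> 0" for k
    using y[of "Suc k"] by (auto simp: X_def y_def)
  define s where "s = (\<lambda>k. z * (x k / y k))"
  have "s 0 = z * schur_fun \<alpha> 0 z"
  proof (rule schur_fun_unique[OF \<alpha> z(1)])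
    show "cmod (s n) \<le> 1" for n
    proof -
      have "cmod (x n / y n) \<le> 1" using xy[of n] y[of n] by (simp add: norm_divide)
      then show ?thesis unfolding s_def norm_mult using z by (intro mult_le_one) auto
    qed
    show "s n = z * disk_aut (\<alpha> n) (s (Suc n))" for n
    proof -
      have "s (Suc n) = Y n / X n" using z by (auto simp: s_def x_def y_def X_def Y_def)
      then show ?thesis using Theta_ratio[OF blk Xn y, of n] by (simp add: s_def del: times_divide_eq_right)
    qed
  qed
  then show "z * schur_fun \<alpha> 0 z = z * g 0 / (1 + z * g 0)"
    by (simp add: s_def x_def y_def h0 add.commute)
  show "1 + z * g 0 \<noteq> 0" using y[of 0] by (simp add: y_def add.commute)
qed

text \<open>The right-hand side is the real part of the Caratheodory function (1 + z f) / (1 - z f).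
  The resolvent vector is found on the side of L2, as a preimage of the bounded function 1 / (e - z)
  under \<open>V\<close>. The integral is stated in the extended nonnegative form because it is
  later compared with integrals against a smaller measure.\<close>

lemma spectral_measure_poisson:
  assumes sp: "is_spectral_measure (cmv \<alpha>) \<mu>" and z: "cmod z < 1" "z \<noteq> 0"
  shows "(\<integral>\<^sup>+e. ennreal ((1 - (cmod z)\<^sup>2) / (cmod (e - z))\<^sup>2) \<partial>\<mu>) =
    ennreal ((1 - (cmod (z * schur_fun \<alpha> 0 z))\<^sup>2) / (cmod (1 - z * schur_fun \<alpha> 0 z))\<^sup>2)"
proof -
  obtain V where [measurable_cong]: "sets \<mu> = sets borel" and "prob_space \<mu>" and sph: "AE e in \<mu>. e \<in> sphere 0 1"
    and V: "unitary_to_L2 V \<mu>" and V0: "AE e in \<mu>. V (\<lambda>n. if n = 0 then 1 else 0) e = 1"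
    and VU: "\<And>f. f \<in> ell2 \<Longrightarrow> AE e in \<mu>. V (cmv \<alpha> f) e = e * V f e"
    using sp unfolding is_spectral_measure_def by blast
  interpret prob_space \<mu> by fact
  have circ: "AE e in \<mu>. cmod e = 1" using sph by simp
  have lin: "AE e in \<mu>. V (\<lambda>n. a * f n + b * g n) e = a * V f e + b * V g e"
    if "f \<in> ell2" "g \<in> ell2" for f g a b using V that unfolding unitary_to_L2_def by blast
  have iso: "(\<integral>e. (cmod (V f e))\<^sup>2 \<partial>\<mu>) = (\<Sum>n. (cmod (f n))\<^sup>2)" if "f \<in> ell2" for f
    using V that unfolding unitary_to_L2_def by blast
  have meas: "V f \<in> borel_measurable \<mu>" if "f \<in> ell2" for f
    using V that unfolding unitary_to_L2_def L2_def by blast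
  have onto: "\<exists>f\<in>ell2. AE e in \<mu>. V f e = h e" if "h \<in> L2 \<mu>" for h
    using V that unfolding unitary_to_L2_def by blast
  have low: "1 - cmod z \<le> cmod (e - z)" if "cmod e = 1" for e
    using norm_triangle_ineq2[of e z] that by simp
  have intK: "integrable \<mu> (\<lambda>e. (cmod (1 / (e - z)))\<^sup>2)"
  proof (rule integrable_const_bound[of _ "(1 / (1 - cmod z))\<^sup>2"])
    show "AE e in \<mu>. norm ((cmod (1 / (e - z)))\<^sup>2) \<le> (1 / (1 - cmod z))\<^sup>2"
      using circ
    proof eventually_elim
      case (elim e)
      then have "cmod (1 / (e - z)) \<le> 1 / (1 - cmod z)"
        using low[OF elim] z by (simp add: norm_divide frac_le)
      then show ?case by (simp add: power_mono)
    qed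
  qed measurable
  have "(\<lambda>e. 1 / (e - z)) \<in> L2 \<mu>" unfolding L2_def using intK by auto
  then obtain g where g: "g \<in> ell2" and Vg: "AE e in \<mu>. V g e = 1 / (e - z)" using onto by blast
  define d where "d = (\<lambda>n::nat. if n = 0 then 1 else 0 :: complex)"
  have d: "d \<in> ell2" using ell2_delta by (simp add: d_def)
  have Ug: "cmv \<alpha> g \<in> ell2" unfolding cmv_def comp_def by (intro cmv_L_ell2 cmv_M_ell2 g)
  define k where "k = (\<lambda>n. 1 * cmv \<alpha> g n + (- z) * g n)"
  have k: "k \<in> ell2" unfolding k_def by (rule ell2_comb[OF Ug g])
  \<comment> \<open>\<open>l\<close> is the defect (C - z) g - e_0. Its image under \<open>V\<close>
    vanishes almost everywhere, and the isometry of \<open>V\<close> then gives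
    \<open>l = 0\<close>.\<close>
  define l where "l = (\<lambda>n. 1 * k n + (- 1) * d n)"
  have l: "l \<in> ell2" unfolding l_def by (rule ell2_comb[OF k d])
  have "AE e in \<mu>. V l e = 0"
    using lin[OF Ug g, of 1 "-z"] lin[OF k d, of 1 "-1"] VU[OF g] Vg V0 circ
    unfolding k_def[symmetric] l_def[symmetric] d_def[symmetric]
  proof eventually_elim
    case (elim e)
    have "e - z \<noteq> 0" using low[OF elim(6)] z by auto
    then have "e * (1 / (e - z)) - z * (1 / (e - z)) = 1" by (simp add: diff_divide_distrib[symmetric])
    then show ?case using elim by (simp only:) (simp add: algebra_simps)
  qed
  then have "(\<integral>e. (cmod (V l e))\<^sup>2 \<partial>\<mu>) = 0"
    by (intro integral_eq_zero_AE) auto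
  then have "(\<Sum>n. (cmod (l n))\<^sup>2) = 0" using iso[OF l] by simp
  then have "\<And>n. l n = 0"
    using l unfolding ell2_def by (subst (asm) suminf_eq_zero_iff) auto
  then have eq: "cmv \<alpha> g n = z * g n + (if n = 0 then 1 else 0)" for n
    by (simp add: l_def k_def d_def algebra_simps)
  have nU: "(\<Sum>n. (cmod (cmv \<alpha> g n))\<^sup>2) = (\<Sum>n. (cmod (g n))\<^sup>2)"
    unfolding iso[OF Ug, symmetric] iso[OF g, symmetric]
  proof (rule integral_cong_AE)
    show "AE e in \<mu>. (cmod (V (cmv \<alpha> g) e))\<^sup>2 = (cmod (V g e))\<^sup>2"
      using VU[OF g] circ by eventually_elim (simp add: norm_mult)
  qed (use meas[OF g] meas[OF Ug] in measurable)
  have sg: "summable (\<lambda>n. (cmod (g n))\<^sup>2)" and sU: "summable (\<lambda>n. (cmod (cmv \<alpha> g n))\<^sup>2)"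
    using g Ug by (auto simp: ell2_def)
  \<comment> \<open>The resolvent equation makes all terms but the one at \<open>n = 0\<close>
    cancel, so the squared norm of \<open>g\<close> is determined by the single entry
    \<open>g 0\<close>.\<close>
  have "(\<lambda>n. (cmod (cmv \<alpha> g n))\<^sup>2 - (cmod z)\<^sup>2 * (cmod (g n))\<^sup>2) sums
      ((\<Sum>n. (cmod (g n))\<^sup>2) - (cmod z)\<^sup>2 * (\<Sum>n. (cmod (g n))\<^sup>2))"
    using sums_diff[OF summable_sums[OF sU] sums_mult[OF summable_sums[OF sg]]] by (simp add: nU)
  moreover have "(\<lambda>n. (cmod (cmv \<alpha> g n))\<^sup>2 - (cmod z)\<^sup>2 * (cmod (g n))\<^sup>2) =
      (\<lambda>n. if n = 0 then 1 + 2 * Re (z * g 0) else 0)"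
  proof
    fix n
    have "(cmod (z * g 0 + 1))\<^sup>2 = (cmod (z * g 0))\<^sup>2 + (1 + 2 * Re (z * g 0))"
      by (simp only: cmod_power2 plus_complex.simps one_complex.simps) (simp add: power2_eq_square algebra_simps)
    then show "(cmod (cmv \<alpha> g n))\<^sup>2 - (cmod z)\<^sup>2 * (cmod (g n))\<^sup>2 = (if n = 0 then 1 + 2 * Re (z * g 0) else 0)"
      by (cases "n = 0") (simp_all add: eq norm_mult power_mult_distrib)
  qed
  moreover have "(\<lambda>n::nat. if n = 0 then 1 + 2 * Re (z * g 0) else 0) sums (1 + 2 * Re (z * g 0))"
    using sums_single[of 0 "\<lambda>_. 1 + 2 * Re (z * g 0)"] by simp
  ultimately have "(1 - (cmod z)\<^sup>2) * (\<Sum>n. (cmod (g n))\<^sup>2) = 1 + 2 * Re (z * g 0)"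
    by (simp add: sums_iff algebra_simps)
  moreover have "(\<Sum>n. (cmod (g n))\<^sup>2) = (\<integral>e. (cmod (1 / (e - z)))\<^sup>2 \<partial>\<mu>)"
    unfolding iso[OF g, symmetric]
  proof (rule integral_cong_AE)
    show "AE e in \<mu>. (cmod (V g e))\<^sup>2 = (cmod (1 / (e - z)))\<^sup>2" using Vg by eventually_elim simp
  qed (use meas[OF g] in measurable)
  ultimately have int: "(1 - (cmod z)\<^sup>2) * (\<integral>e. (cmod (1 / (e - z)))\<^sup>2 \<partial>\<mu>) = 1 + 2 * Re (z * g 0)"
    by simp
  \<comment> \<open>Here w = z f / (1 - z f), and 1 + 2 Re w is the real part of (1 + z f) / (1 - z
    f).\<close>
  define w where "w = z * g 0"
  note res = cmv_resolvent_schur[OF z g eq, folded w_def]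
  have "1 - w / (1 + w) = 1 / (1 + w)" using res(1) by (simp add: field_simps)
  then have "(1 - (cmod (w / (1 + w)))\<^sup>2) / (cmod (1 - w / (1 + w)))\<^sup>2 = (cmod (1 + w))\<^sup>2 - (cmod w)\<^sup>2"
    using res(1) by (simp add: norm_divide power_divide field_simps)
  also have "\<dots> = 1 + 2 * Re w"
    by (simp only: cmod_power2 plus_complex.simps one_complex.simps) (simp add: power2_eq_square algebra_simps)
  finally have "(1 - (cmod (z * schur_fun \<alpha> 0 z))\<^sup>2) / (cmod (1 - z * schur_fun \<alpha> 0 z))\<^sup>2 =
      (1 - (cmod z)\<^sup>2) * (\<integral>e. (cmod (1 / (e - z)))\<^sup>2 \<partial>\<mu>)"
    using int res(2) by (simp add: w_def)
  also have "ennreal \<dots> = (\<integral>\<^sup>+e. ennreal ((1 - (cmod z)\<^sup>2) * (cmod (1 / (e - z)))\<^sup>2) \<partial>\<mu>)"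
    using intK z by (subst nn_integral_eq_integral) (auto simp: power_le_one)
  finally show ?thesis by (simp add: norm_divide power_divide)
qed

end

section \<open>Boundary values of analytic functions on the disc\<close>

definition taylor_coeff :: "(complex \<Rightarrow> complex) \<Rightarrow> nat \<Rightarrow> complex" where
  "taylor_coeff H n = (deriv ^^ n) H 0 / fact n"

lemma taylor_sums:
  assumes "H holomorphic_on ball 0 R" "cmod w < R"
  shows "(\<lambda>n. taylor_coeff H n * w ^ n) sums H w"
  using holomorphic_power_series[OF assms(1), of w] assms(2) by (simp add: taylor_coeff_def)

lemma taylor_summable_norm:
  assumes "H holomorphic_on ball 0 R" "0 \<le> r" "r < R"
  shows "summable (\<lambda>n. cmod (taylor_coeff H n) * r ^ n)"
proof -
  obtain s where s: "r < s" "s < R" using dense assms(3) by blast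
  have "summable (\<lambda>n. taylor_coeff H n * (of_real s) ^ n)"
    using taylor_sums[OF assms(1), of "of_real s"] s assms(2) by (simp add: sums_iff)
  then have "summable (\<lambda>n. cmod (taylor_coeff H n * (of_real r) ^ n))"
    by (rule powser_insidea) (use s assms(2) in simp)
  then show ?thesis using assms(2) by (simp add: norm_mult norm_power)
qed

lemma cnj_measurable [measurable]:
  assumes "f \<in> borel_measurable M"
  shows "(\<lambda>x. cnj (f x)) \<in> borel_measurable M"
  using assms by (rule measurable_compose) (intro borel_measurable_continuous_onI continuous_intros)

section \<open>The Poisson kernel and integration over the circle\<close>

definition poisson :: "complex \<Rightarrow> complex \<Rightarrow> real" where
  "poisson e a = (1 - (cmod a)\<^sup>2) / (cmod (e - a))\<^sup>2"

lemma poisson_nonneg: "cmod a < 1 \<Longrightarrow> 0 \<le> poisson e a"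
  by (simp add: poisson_def power_le_one)

lemma poisson_measurable [measurable]:
  assumes [measurable]: "f \<in> borel_measurable M" "g \<in> borel_measurable M"
  shows "(\<lambda>x. poisson (f x) (g x)) \<in> borel_measurable M"
  unfolding poisson_def by measurable

lemma poisson_le:
  assumes "cmod e = 1" "cmod a < 1"
  shows "poisson e a \<le> 1 / (1 - cmod a)\<^sup>2"
proof -
  have "1 - cmod a \<le> cmod (e - a)" using norm_triangle_ineq2[of e a] assms by simp
  then show ?thesis
    unfolding poisson_def using assms by (intro frac_le) (auto simp: power_mono)
qed

text \<open>The symmetry allows the kernel to be integrated in the other variable after an
  application of Fubini, again with total mass 1.\<close>

lemma poisson_swap:
  assumes "cmod e = 1" "cmod x = 1" "0 \<le> r"
  shows "poisson e (of_real r * x) = poisson x (of_real r * e)"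
proof -
  have "(cmod (e - of_real r * x))\<^sup>2 = (cmod e)\<^sup>2 + r\<^sup>2 * (cmod x)\<^sup>2 - 2 * r * (Re e * Re x + Im e * Im x)" for e x
    unfolding cmod_power2 by (simp add: power2_eq_square algebra_simps)
  from this[of e x] this[of x e] show ?thesis
    using assms by (simp add: poisson_def norm_mult mult.commute)
qed

text \<open>The kernel splits into geometric series in \<open>a * cnj e\<close> and in
  \<open>cnj a * e\<close>, that is, into an antiholomorphic and a holomorphic part whose integrals
  are accessible through mean values.\<close>

lemma poisson_eq:
  assumes e: "cmod e = 1" and a: "cmod a < 1"
  shows "of_real (poisson e a) = 1 / (1 - a * cnj e) + cnj a * e / (1 - cnj a * e)"
proof -
  define t where "t = a * cnj e"
  have ee: "e * cnj e = 1" using complex_norm_square[of e] e by simp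
  have t1: "cmod t < 1" using e a by (simp add: t_def norm_mult)
  then have ne: "1 - t \<noteq> 0" "1 - cnj t \<noteq> 0"
    using complex_mod_cnj[of t] by (auto simp: right_minus_eq norm_one dest: arg_cong[where f = cmod])
  have et: "e * (1 - t) = e - a" using ee by (simp add: t_def algebra_simps)
  have "cmod (1 - t) = cmod (e - a)"
    using arg_cong[OF et, of cmod] e by (simp add: norm_mult)
  moreover have "cmod t = cmod a" using e by (simp add: t_def norm_mult)
  ultimately have "of_real (poisson e a) = complex_of_real ((1 - (cmod t)\<^sup>2) / (cmod (1 - t))\<^sup>2)"
    by (simp add: poisson_def)
  also have "\<dots> = (1 - t * cnj t) / ((1 - t) * cnj (1 - t))"
    unfolding of_real_divide of_real_diff by (simp only: complex_norm_square[symmetric]) simp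
  also have "\<dots> = 1 / (1 - t) + cnj t / (1 - cnj t)"
    using ne by (simp add: field_simps)
  finally show ?thesis by (simp add: t_def)
qed

lemma entire_measurable:
  assumes "H holomorphic_on UNIV"
  shows "H \<in> borel_measurable borel"
  using assms by (intro borel_measurable_continuous_onI holomorphic_on_imp_continuous_on)

lemma continuous_disc_bounded:
  fixes L :: "complex \<Rightarrow> complex"
  assumes "continuous_on (cball 0 1) L"
  obtains B where "\<And>z. cmod z \<le> 1 \<Longrightarrow> cmod (L z) \<le> B"
proof -
  have "bounded (L ` cball 0 1)"
    using assms by (intro compact_imp_bounded compact_continuous_image) auto
  then obtain B where "\<forall>x\<in>L ` cball 0 1. cmod x \<le> B" unfolding bounded_iff by blast
  then show ?thesis using that[of B] by simp
qed

lemma entire_circle_bounded: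
  assumes "H holomorphic_on UNIV"
  obtains B where "\<And>z. cmod z \<le> 1 \<Longrightarrow> cmod (H z) \<le> B"
proof -
  have "continuous_on (cball 0 1) H"
    using assms holomorphic_on_imp_continuous_on continuous_on_subset by blast
  then show ?thesis using continuous_disc_bounded that by blast
qed

lemma entire_radial_tendsto:
  assumes "H holomorphic_on UNIV" "r \<longlonglongrightarrow> 1"
  shows "(\<lambda>k. H (of_real (r k) * z)) \<longlonglongrightarrow> H z"
proof -
  have "(\<lambda>k. of_real (r k) * z) \<longlonglongrightarrow> of_real 1 * z" by (intro tendsto_intros assms(2))
  then show ?thesis
    using continuous_on_tendsto_compose[OF holomorphic_on_imp_continuous_on[OF assms(1)], of "\<lambda>k. of_real (r k) * z" z sequentially] by simp
qed

lemma poly_measurable [measurable]: "poly (P :: complex poly) \<in> borel_measurable borel"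
  by (intro borel_measurable_continuous_onI continuous_intros)

text \<open>Normalised Lebesgue measure is described by its moments; the negative ones follow by
  conjugation. Everything up to the theorem about two coefficient sequences is derived from these
  axioms, without a parametrisation of the circle.\<close>

locale circle_prob = prob_space M for M :: "complex measure" +
  assumes sets_eq [measurable_cong]: "sets M = sets borel"
    and AE_norm: "AE z in M. cmod z = 1"
    and moment: "\<And>n. 0 < n \<Longrightarrow> (\<integral>z. z ^ n \<partial>M) = 0"
begin

lemma integrable_bounded:
  fixes f :: "complex \<Rightarrow> 'b :: {banach, second_countable_topology}"
  assumes [measurable]: "f \<in> borel_measurable borel" and "\<And>z. cmod z = 1 \<Longrightarrow> norm (f z) \<le> B"
  shows "integrable M f"
proof (rule integrable_const_bound)
  show "AE z in M. norm (f z) \<le> B" using AE_norm by eventually_elim (rule assms(2))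
qed measurable

lemma integral_mono_circle:
  fixes f g :: "complex \<Rightarrow> real"
  assumes "integrable M f" "integrable M g" "\<And>z. cmod z = 1 \<Longrightarrow> f z \<le> g z"
  shows "(\<integral>z. f z \<partial>M) \<le> (\<integral>z. g z \<partial>M)"
proof (rule integral_mono_AE)
  show "AE z in M. f z \<le> g z" using AE_norm by eventually_elim (rule assms(3))
qed fact+

lemma dominated_convergence_circle:
  fixes s :: "nat \<Rightarrow> complex \<Rightarrow> 'b :: {banach, second_countable_topology}"
  assumes [measurable]: "\<And>j. s j \<in> borel_measurable borel" "f \<in> borel_measurable borel"
    and "AE z in M. (\<lambda>j. s j z) \<longlonglongrightarrow> f z" "\<And>j z. cmod z = 1 \<Longrightarrow> norm (s j z) \<le> B"
  shows "(\<lambda>j. \<integral>z. s j z \<partial>M) \<longlonglongrightarrow> (\<integral>z. f z \<partial>M)"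
proof (rule integral_dominated_convergence[where w = "\<lambda>_. B"])
  show "AE z in M. norm (s j z) \<le> B" for j using AE_norm by eventually_elim (rule assms(4))
qed (use assms(3) in auto)

lemma integral_bounded:
  fixes f :: "complex \<Rightarrow> 'b :: {banach, second_countable_topology}"
  assumes "\<And>z. cmod z = 1 \<Longrightarrow> norm (f z) \<le> B" "0 \<le> B"
  shows "norm (\<integral>z. f z \<partial>M) \<le> B"
proof (cases "integrable M f")
  case True
  have "norm (\<integral>z. f z \<partial>M) \<le> (\<integral>z. norm (f z) \<partial>M)" by simp
  also have "\<dots> \<le> (\<integral>z. B \<partial>M)"
    using True assms(1) by (intro integral_mono_circle) auto
  finally show ?thesis by (simp add: prob_space)
qed (use assms in \<open>simp add: not_integrable_integral_eq\<close>)

lemma integral_cong_circle: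
  fixes f :: "complex \<Rightarrow> 'b :: {banach, second_countable_topology}"
  assumes [measurable]: "f \<in> borel_measurable borel" "g \<in> borel_measurable borel"
    and "\<And>z. cmod z = 1 \<Longrightarrow> f z = g z"
  shows "(\<integral>z. f z \<partial>M) = (\<integral>z. g z \<partial>M)"
proof (rule integral_cong_AE)
  show "AE z in M. f z = g z" using AE_norm by eventually_elim (rule assms(3))
qed measurable

lemma cnj_moment:
  shows "(\<integral>z. z ^ m * cnj z ^ n \<partial>M) = (if m = n then 1 else 0)"
proof -
  have red: "z ^ m * cnj z ^ n = (if m = n then 1 else if n < m then z ^ (m - n) else cnj (z ^ (n - m)))"
    if "cmod z = 1" for z
  proof -
    have zz: "z * cnj z = 1" using complex_norm_square[of z] that by simp
    have p: "z ^ k * cnj z ^ k = 1" for k by (simp add: power_mult_distrib[symmetric] zz)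
    show ?thesis
    proof (cases m n rule: linorder_cases)
      case less
      then obtain d where "n = m + d" using less_imp_add_positive by blast
      then show ?thesis using p[of m] by (auto simp: power_add mult.assoc[symmetric])
    next
      case greater
      then obtain d where d: "m = n + d" using less_imp_add_positive by blast
      have "z ^ m * cnj z ^ n = z ^ d * (z ^ n * cnj z ^ n)" by (simp add: d power_add mult_ac)
      then show ?thesis using greater p[of n] by (simp add: d)
    qed (simp add: p)
  qed
  have "(\<integral>z. z ^ m * cnj z ^ n \<partial>M) =
      (\<integral>z. (if m = n then 1 else if n < m then z ^ (m - n) else cnj (z ^ (n - m))) \<partial>M)"
    by (rule integral_cong_circle) (auto simp: red)
  also have "\<dots> = (if m = n then 1 else 0)"
    using moment[of "m - n"] moment[of "n - m"] Bochner_Integration.integral_cnj[of M "\<lambda>z. z ^ (n - m)"]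
    by (cases m n rule: linorder_cases) (auto simp: prob_space)
  finally show ?thesis .
qed

text \<open>One exchange of sum and integral serves several purposes: \<open>v = 1\<close> gives
  mean values, powers of \<open>cnj z\<close> give Taylor coefficients, \<open>cnj (H (s z))\<close>
  gives Parseval, and the Poisson kernel gives its reproducing property.\<close>

lemma termwise:
  assumes H: "H holomorphic_on ball 0 R" and [measurable]: "H \<in> borel_measurable borel"
    and r: "0 \<le> r" "r < R"
    and [measurable]: "v \<in> borel_measurable borel" and v: "\<And>z. cmod z = 1 \<Longrightarrow> cmod (v z) \<le> B"
  shows "(\<lambda>n. taylor_coeff H n * of_real r ^ n * (\<integral>z. z ^ n * v z \<partial>M)) sums (\<integral>z. H (of_real r * z) * v z \<partial>M)"
proof -
  let ?f = "\<lambda>n z. taylor_coeff H n * of_real r ^ n * (z ^ n * v z)"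
  have B: "0 \<le> B" using order_trans[OF norm_ge_zero v[of 1]] by simp
  have le: "cmod (?f n z) \<le> cmod (taylor_coeff H n) * r ^ n * B" if "cmod z = 1" for n z
    using that v[OF that] r by (simp add: norm_mult norm_power mult_left_mono)
  have S: "summable (\<lambda>n. cmod (taylor_coeff H n) * r ^ n * B)"
    using taylor_summable_norm[OF H r] by (rule summable_mult2)
  have "(\<lambda>n. \<integral>z. ?f n z \<partial>M) sums (\<integral>z. (\<Sum>n. ?f n z) \<partial>M)"
  proof (rule sums_integral)
    show "integrable M (?f n)" for n by (rule integrable_bounded[OF _ le]) measurable
    show "AE z in M. summable (\<lambda>n. norm (?f n z))"
      using AE_norm
    proof eventually_elim
      case (elim z)
      show ?case by (rule summable_comparison_test'[OF S]) (use le[OF elim] in auto)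
    qed
    show "summable (\<lambda>n. \<integral>z. norm (?f n z) \<partial>M)"
    proof (rule summable_comparison_test'[OF S])
      show "norm (\<integral>z. norm (?f n z) \<partial>M) \<le> cmod (taylor_coeff H n) * r ^ n * B" for n
        using le r B by (intro integral_bounded) auto
    qed
  qed
  moreover have "(\<integral>z. (\<Sum>n. ?f n z) \<partial>M) = (\<integral>z. H (of_real r * z) * v z \<partial>M)"
  proof (rule integral_cong_circle)
    fix z assume z: "cmod z = 1"
    have "(\<lambda>n. taylor_coeff H n * (of_real r * z) ^ n * v z) sums (H (of_real r * z) * v z)"
      using r z by (intro sums_mult2 taylor_sums[OF H]) (simp add: norm_mult)
    then show "(\<Sum>n. ?f n z) = H (of_real r * z) * v z"
      by (simp add: sums_iff power_mult_distrib mult_ac)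
  qed measurable
  ultimately show ?thesis by simp
qed

lemma mean_value:
  assumes H: "H holomorphic_on ball 0 R" and [measurable]: "H \<in> borel_measurable borel" and r: "0 \<le> r" "r < R"
  shows "(\<integral>z. H (of_real r * z) \<partial>M) = H 0"
proof -
  have "(\<lambda>n. taylor_coeff H n * of_real r ^ n * (\<integral>z. z ^ n * 1 \<partial>M)) sums (\<integral>z. H (of_real r * z) * 1 \<partial>M)"
    by (rule termwise[OF assms, where B = 1]) auto
  moreover have "taylor_coeff H n * of_real r ^ n * (\<integral>z. z ^ n * 1 \<partial>M) = (if n = 0 then taylor_coeff H n else 0)" for n
    using moment[of n] by (simp add: prob_space)
  moreover have "(\<lambda>n. if n = 0 then taylor_coeff H n else 0) sums taylor_coeff H 0"
    by (rule sums_single)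
  ultimately show ?thesis by (auto simp: taylor_coeff_def dest: sums_unique2)
qed

lemma coeff_integral:
  assumes H: "H holomorphic_on ball 0 R" and [measurable]: "H \<in> borel_measurable borel" and r: "0 \<le> r" "r < R"
  shows "(\<integral>z. H (of_real r * z) * cnj z ^ m \<partial>M) = taylor_coeff H m * of_real r ^ m"
proof -
  have "(\<lambda>n. taylor_coeff H n * of_real r ^ n * (\<integral>z. z ^ n * cnj z ^ m \<partial>M)) sums (\<integral>z. H (of_real r * z) * cnj z ^ m \<partial>M)"
    by (rule termwise[OF assms, where B = 1]) (auto simp: norm_power)
  moreover have "taylor_coeff H n * of_real r ^ n * (\<integral>z. z ^ n * cnj z ^ m \<partial>M) =
      (if n = m then taylor_coeff H n * of_real r ^ n else 0)" for n
    by (simp add: cnj_moment)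
  moreover have "(\<lambda>n. if n = m then taylor_coeff H n * of_real r ^ n else 0) sums (taylor_coeff H m * of_real r ^ m)"
    by (rule sums_single)
  ultimately show ?thesis by (auto dest: sums_unique2)
qed

lemma poisson_moment:
  assumes a: "cmod a < 1"
  shows "(\<integral>e. e ^ n * of_real (poisson e a) \<partial>M) = a ^ n"
proof -
  \<comment> \<open>This radius satisfies \<open>1 < R\<close> and
    \<open>cmod a * R \<le> 1\<close>, so 1 - cnj a * \<zeta> has no zero in the disc of radius
    \<open>R\<close> and mean values can be taken at radius 1.\<close>
  define R where "R = 2 / (1 + cmod a)"
  have p: "0 < 1 + cmod a" by (simp add: add_pos_nonneg)
  have R1: "1 < R" using a p by (simp add: R_def less_divide_eq)
  have aR: "cmod a * R \<le> 1" using a p by (simp add: R_def divide_le_eq)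
  have ne: "1 - cnj a * \<zeta> \<noteq> 0" if "cmod \<zeta> < R" for \<zeta>
  proof -
    have "cmod (cnj a * \<zeta>) < 1"
    proof (cases "a = 0")
      case False
      then have "cmod a * cmod \<zeta> < cmod a * R" using that by simp
      then show ?thesis using aR by (simp add: norm_mult)
    qed simp
    then show ?thesis by (auto simp: right_minus_eq norm_one dest: arg_cong[where f = cmod])
  qed
  have hol: "(\<lambda>\<zeta>. \<zeta> ^ n * (cnj a * \<zeta>) / (1 - cnj a * \<zeta>)) holomorphic_on ball 0 R"
    "(\<lambda>\<zeta>. 1 / (1 - cnj a * \<zeta>)) holomorphic_on ball 0 R"
    using ne by (auto intro!: holomorphic_intros)
  have I1: "(\<integral>e. e ^ n * (cnj a * e) / (1 - cnj a * e) \<partial>M) = 0"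
    using mean_value[OF hol(1) _, of 1] R1 by simp
  have "(\<integral>e. 1 / (1 - cnj a * e) \<partial>M) = 1"
    using mean_value[OF hol(2) _, of 1] R1 by simp
  then have I2: "(\<integral>e. 1 / (1 - a * cnj e) \<partial>M) = 1"
    using Bochner_Integration.integral_cnj[of M "\<lambda>e. 1 / (1 - cnj a * e)"] by simp
  have low: "1 - cmod a \<le> cmod (1 - a * cnj e)" "1 - cmod a \<le> cmod (1 - cnj a * e)" if "cmod e = 1" for e
    using norm_triangle_ineq2[of 1 "a * cnj e"] norm_triangle_ineq2[of 1 "cnj a * e"] that by (auto simp: norm_mult)
  have bd: "cmod (1 / (1 - a * cnj e)) \<le> 1 / (1 - cmod a)" "cmod (1 / (1 - cnj a * e)) \<le> 1 / (1 - cmod a)" if "cmod e = 1" for e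
    using low[OF that] a by (auto simp: norm_divide intro!: frac_le)
  have int2: "integrable M (\<lambda>e. 1 / (1 - a * cnj e))"
    by (rule integrable_bounded[OF _ bd(1)]) measurable
  have int1: "integrable M (\<lambda>e. e ^ n * (cnj a * e) / (1 - cnj a * e))"
  proof (rule integrable_bounded)
    fix e :: complex assume e: "cmod e = 1"
    have "cmod (cnj a) * cmod (1 / (1 - cnj a * e)) \<le> 1 * (1 / (1 - cmod a))"
      using bd(2)[OF e] a by (intro mult_mono) auto
    then show "norm (e ^ n * (cnj a * e) / (1 - cnj a * e)) \<le> 1 / (1 - cmod a)"
      using e by (simp add: norm_divide norm_mult norm_power)
  qed measurable
  \<comment> \<open>\<open>?s\<close> is the part of e^n / (1 - a * cnj e) with positive
    frequencies, hence of mean 0; what remains is a^n / (1 - a * cnj e), of mean a^n.\<close>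
  let ?s = "\<lambda>e. \<Sum>i<n. a ^ (n - Suc i) * e ^ (Suc i)"
  have ints: "integrable M (\<lambda>e. a ^ (n - Suc i) * e ^ (Suc i))" for i
    by (rule integrable_bounded[where B = "cmod (a ^ (n - Suc i))"]) (auto simp: norm_mult norm_power)
  have I3: "(\<integral>e. ?s e \<partial>M) = 0"
  proof -
    have "(\<integral>e. a ^ (n - Suc i) * e ^ (Suc i) \<partial>M) = 0" for i
      using moment[of "Suc i"] by simp
    then show ?thesis using ints by (simp only: Bochner_Integration.integral_sum sum.neutral_const)
  qed
  have "(\<integral>e. e ^ n * of_real (poisson e a) \<partial>M) =
      (\<integral>e. (?s e + a ^ n * (1 / (1 - a * cnj e))) + e ^ n * (cnj a * e) / (1 - cnj a * e) \<partial>M)"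
  proof (rule integral_cong_circle)
    fix e :: complex assume e: "cmod e = 1"
    have ee: "e * cnj e = 1" using complex_norm_square[of e] e by simp
    have ne1: "1 - a * cnj e \<noteq> 0" using low(1)[OF e] a by auto
    have "e * (1 - a * cnj e) = e - a" using ee by (simp add: algebra_simps)
    moreover have "?s e = e * (\<Sum>i<n. a ^ (n - Suc i) * e ^ i)" by (simp add: sum_distrib_left mult_ac)
    ultimately have "?s e * (1 - a * cnj e) = (e - a) * (\<Sum>i<n. a ^ (n - Suc i) * e ^ i)"
      by (metis mult.assoc mult.commute)
    then have "?s e * (1 - a * cnj e) = e ^ n - a ^ n" by (simp add: power_diff_sumr2)
    then have "?s e = (e ^ n - a ^ n) / (1 - a * cnj e)" using ne1 by (simp add: eq_divide_eq)
    then have "?s e + a ^ n * (1 / (1 - a * cnj e)) = e ^ n * (1 / (1 - a * cnj e))"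
      by (simp add: diff_divide_distrib)
    then show "e ^ n * of_real (poisson e a) = (?s e + a ^ n * (1 / (1 - a * cnj e))) + e ^ n * (cnj a * e) / (1 - cnj a * e)"
      unfolding poisson_eq[OF e a] by (simp add: distrib_left)
  qed measurable
  also have "\<dots> = (\<integral>e. ?s e \<partial>M) + (\<integral>e. a ^ n * (1 / (1 - a * cnj e)) \<partial>M)
      + (\<integral>e. e ^ n * (cnj a * e) / (1 - cnj a * e) \<partial>M)"
    using ints by (simp only: Bochner_Integration.integral_add Bochner_Integration.integrable_add
      Bochner_Integration.integrable_sum integrable_mult_right int1 int2)
  also have "(\<integral>e. a ^ n * (1 / (1 - a * cnj e)) \<partial>M) = a ^ n"
    by (simp only: integral_mult_right_zero I2) simp
  also have "(\<integral>e. ?s e \<partial>M) + a ^ n + (\<integral>e. e ^ n * (cnj a * e) / (1 - cnj a * e) \<partial>M) = a ^ n"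
    by (simp only: I1 I3) simp
  finally show ?thesis .
qed

lemma poisson_mult_integrable:
  fixes g :: "complex \<Rightarrow> real"
  assumes [measurable]: "g \<in> borel_measurable borel" and g: "\<And>e. cmod e = 1 \<Longrightarrow> \<bar>g e\<bar> \<le> B" and a: "cmod a < 1"
  shows "integrable M (\<lambda>e. poisson e a * g e)"
proof (rule integrable_bounded)
  show "norm (poisson e a * g e) \<le> 1 / (1 - cmod a)\<^sup>2 * B" if "cmod e = 1" for e
    unfolding real_norm_def abs_mult using poisson_le[OF that a] poisson_nonneg[OF a, of e] g[OF that]
    by (intro mult_mono) auto
qed measurable

lemma entire_integrable: "H holomorphic_on UNIV \<Longrightarrow> integrable M H"
  using entire_circle_bounded[of H] by (metis entire_measurable integrable_bounded order_refl)

lemma poisson_entire: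
  assumes H: "H holomorphic_on UNIV" and a: "cmod a < 1"
  shows "(\<integral>e. Re (H e) * poisson e a \<partial>M) = Re (H a)"
proof -
  note [measurable] = entire_measurable[OF H]
  have H2: "H holomorphic_on ball 0 2" using H holomorphic_on_subset by blast
  have bd: "cmod (of_real (poisson e a)) \<le> 1 / (1 - cmod a)\<^sup>2" if "cmod e = 1" for e
    using poisson_le[OF that a] poisson_nonneg[OF a] by simp
  have "(\<lambda>n. taylor_coeff H n * of_real 1 ^ n * (\<integral>e. e ^ n * of_real (poisson e a) \<partial>M)) sums
      (\<integral>e. H (of_real 1 * e) * of_real (poisson e a) \<partial>M)"
    by (rule termwise[OF H2 _ _ _ _ bd]) auto
  then have "(\<lambda>n. taylor_coeff H n * a ^ n) sums (\<integral>e. H e * of_real (poisson e a) \<partial>M)"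
    by (simp add: poisson_moment[OF a])
  moreover have "(\<lambda>n. taylor_coeff H n * a ^ n) sums H a"
    using taylor_sums[OF H2, of a] a by simp
  ultimately have eq: "(\<integral>e. H e * of_real (poisson e a) \<partial>M) = H a" by (rule sums_unique2)
  obtain B where B: "\<And>z. cmod z \<le> 1 \<Longrightarrow> cmod (H z) \<le> B" using entire_circle_bounded[OF H] by blast
  have "integrable M (\<lambda>e. H e * of_real (poisson e a))"
  proof (rule integrable_bounded)
    show "norm (H z * of_real (poisson z a)) \<le> B * (1 / (1 - cmod a)\<^sup>2)" if "cmod z = 1" for z
      unfolding norm_mult using B[of z] bd[OF that] that order_trans[OF norm_ge_zero B[of 0]]
      by (intro mult_mono) auto
  qed measurable
  then show ?thesis
    using integral_Re[of M "\<lambda>e. H e * of_real (poisson e a)"] eq by simp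
qed

lemma poisson_mass:
  assumes a: "cmod a < 1"
  shows "(\<integral>e. poisson e a \<partial>M) = 1"
  using poisson_entire[of "\<lambda>_. 1", OF _ a] by simp

text \<open>By Parseval, the \<open>L\<^sup>2\<close> norm of \<open>H(r z)\<close> increases with \<open>r\<close> to a finite limit, which makes these
  functions an \<open>L\<^sup>2\<close> Cauchy family; no appeal to Fatou's theorem on radial limits is needed.\<close>

lemma ex_boundary_values:
  assumes H: "H holomorphic_on ball 0 1" and [measurable]: "H \<in> borel_measurable borel"
    and H1: "\<And>z. cmod z < 1 \<Longrightarrow> cmod (H z) \<le> 1"
  shows "\<exists>r::nat \<Rightarrow> real. (\<forall>k. 0 < r k \<and> r k < 1) \<and> r \<longlonglongrightarrow> 1 \<and> (AE z in M. convergent (\<lambda>k. H (of_real (r k) * z)))"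
proof -
  define b where "b = (\<lambda>n. (cmod (taylor_coeff H n))\<^sup>2)"
  define T where "T = (\<lambda>r s. \<integral>z. H (of_real r * z) * cnj (H (of_real s * z)) \<partial>M)"
  define A where "A = (\<lambda>t. \<Sum>n. b n * t ^ n)"
  have Hle: "cmod (H (of_real r * z)) \<le> 1" if "0 \<le> r" "r < 1" "cmod z = 1" for r z
    using that by (intro H1) (simp add: norm_mult)
  have Tsums: "(\<lambda>n. complex_of_real (b n * (r * s) ^ n)) sums T r s" if r: "0 \<le> r" "r < 1" and s: "0 \<le> s" "s < 1" for r s
  proof -
    have "(\<lambda>n. taylor_coeff H n * of_real r ^ n * (\<integral>z. z ^ n * cnj (H (of_real s * z)) \<partial>M)) sums T r s"
      unfolding T_def by (rule termwise[OF H _ r, where B = 1]) (use Hle[OF s] in auto)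
    moreover have "(\<integral>z. z ^ n * cnj (H (of_real s * z)) \<partial>M) = cnj (taylor_coeff H n * of_real s ^ n)" for n
      using coeff_integral[OF H _ s, of n] Bochner_Integration.integral_cnj[of M "\<lambda>z. H (of_real s * z) * cnj z ^ n"]
      by (simp add: mult.commute)
    moreover have "taylor_coeff H n * of_real r ^ n * cnj (taylor_coeff H n * of_real s ^ n) = complex_of_real (b n * (r * s) ^ n)" for n
      using complex_norm_square[of "taylor_coeff H n"] by (simp add: b_def power_mult_distrib mult_ac)
    ultimately show ?thesis by simp
  qed
  have Asum: "summable (\<lambda>n. b n * t ^ n)" if "0 \<le> t" "t < 1" for t
  proof -
    have "sqrt t < 1" using that by simp
    then have "summable (\<lambda>n. complex_of_real (b n * t ^ n))"
      using Tsums[of "sqrt t" "sqrt t"] that by (simp add: sums_iff)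
    then show ?thesis by (simp only: summable_complex_of_real)
  qed
  have TA: "T r s = of_real (A (r * s))" if r: "0 \<le> r" "r < 1" and s: "0 \<le> s" "s < 1" for r s
  proof -
    have "r * s < 1" using mult_strict_mono'[of r 1 s 1] r s by simp
    then have "(\<lambda>n. complex_of_real (b n * (r * s) ^ n)) sums of_real (A (r * s))"
      unfolding A_def using r s by (intro sums_of_real summable_sums Asum) auto
    then show ?thesis using Tsums[OF r s] by (rule sums_unique2[symmetric])
  qed
  have Amono: "A s \<le> A t" if "0 \<le> s" "s \<le> t" "t < 1" for s t
    unfolding A_def using that by (intro suminf_le Asum mult_left_mono power_mono) (auto simp: b_def)
  have A1: "A (r * r) \<le> 1" if "0 \<le> r" "r < 1" for r
  proof -
    have "cmod (T r r) \<le> 1"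
      unfolding T_def using Hle[OF that] by (intro integral_bounded) (auto simp: norm_mult mult_le_one)
    then show ?thesis unfolding TA[OF that that] by simp
  qed
  have intH: "integrable M (\<lambda>z. H (of_real r * z) * cnj (H (of_real s * z)))" if r: "0 \<le> r" "r < 1" and s: "0 \<le> s" "s < 1" for r s
    by (rule integrable_bounded[where B = 1]) (use Hle[OF r] Hle[OF s] in \<open>auto simp: norm_mult mult_le_one\<close>)
  \<comment> \<open>Expanding the square gives A(r^2) - 2 A(r s) + A(s^2), and s^2 <= r s together
    with the monotonicity of \<open>A\<close> removes the mixed term.\<close>
  have D: "(\<integral>z. (cmod (H (of_real r * z) - H (of_real s * z)))\<^sup>2 \<partial>M) \<le> A (r * r) - A (s * s)"
    if r: "0 \<le> r" "r < 1" and s: "0 \<le> s" "s \<le> r" for r s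
  proof -
    have s1: "s < 1" using r s by simp
    have "complex_of_real (\<integral>z. (cmod (H (of_real r * z) - H (of_real s * z)))\<^sup>2 \<partial>M) =
        (\<integral>z. complex_of_real ((cmod (H (of_real r * z) - H (of_real s * z)))\<^sup>2) \<partial>M)"
      by (rule integral_complex_of_real[symmetric])
    also have "\<dots> = (\<integral>z. H (of_real r * z) * cnj (H (of_real r * z)) - H (of_real r * z) * cnj (H (of_real s * z))
        - H (of_real s * z) * cnj (H (of_real r * z)) + H (of_real s * z) * cnj (H (of_real s * z)) \<partial>M)"
    proof (rule Bochner_Integration.integral_cong)
      have "complex_of_real ((cmod (p - q))\<^sup>2) = p * cnj p - p * cnj q - q * cnj p + q * cnj q" for p q
        unfolding complex_norm_square by (simp add: algebra_simps)
      then show "complex_of_real ((cmod (H (of_real r * z) - H (of_real s * z)))\<^sup>2) =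
          H (of_real r * z) * cnj (H (of_real r * z)) - H (of_real r * z) * cnj (H (of_real s * z))
          - H (of_real s * z) * cnj (H (of_real r * z)) + H (of_real s * z) * cnj (H (of_real s * z))" for z .
    qed simp
    also have "\<dots> = T r r - T r s - T s r + T s s"
      unfolding T_def using intH r s s1 by simp
    also have "\<dots> = complex_of_real (A (r * r) - 2 * A (r * s) + A (s * s))"
      using r s s1 by (simp add: TA mult.commute)
    finally have "(\<integral>z. (cmod (H (of_real r * z) - H (of_real s * z)))\<^sup>2 \<partial>M) = A (r * r) - 2 * A (r * s) + A (s * s)"
      by (simp only: of_real_eq_iff)
    moreover have "A (s * s) \<le> A (r * s)"
    proof (rule Amono)
      show "r * s < 1" using mult_strict_mono'[of r 1 s 1] r s s1 by simp
    qed (use r s in \<open>auto intro: mult_right_mono\<close>)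
    ultimately show ?thesis by simp
  qed
  \<comment> \<open>The shift by 2 makes all radii positive as well as less than 1; positivity is
    used later, when the Schur step is divided by the radius.\<close>
  define \<rho> where "\<rho> = (\<lambda>k::nat. 1 - 1 / (real k + 2))"
  have \<rho>: "0 < \<rho> k" "\<rho> k < 1" for k by (simp_all add: \<rho>_def field_simps)
  have \<rho>_mono: "\<rho> k \<le> \<rho> l" if "k \<le> l" for k l using that by (simp add: \<rho>_def frac_le)
  define u where "u = (\<lambda>k. A (\<rho> k * \<rho> k))"
  have "\<rho> k * \<rho> k < 1" for k using mult_strict_mono'[of "\<rho> k" 1 "\<rho> k" 1] \<rho>[of k] by simp
  then have "incseq u"
    unfolding u_def incseq_def using \<rho> \<rho>_mono
    by (intro allI impI Amono mult_mono) (auto simp: less_imp_le)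
  moreover have "\<forall>k. u k \<le> 1" unfolding u_def using \<rho> by (intro allI A1) (auto simp: less_imp_le)
  ultimately obtain l where "u \<longlonglongrightarrow> l" by (rule incseq_convergent)
  then have "convergent u" by (auto simp: convergent_def)
  then have Cu: "Cauchy u" by (rule convergent_Cauchy)
  have "\<exists>N. \<forall>m\<ge>N. \<forall>n\<ge>N. \<bar>u m - u n\<bar> < (1/4) ^ k" for k
    using Cu[unfolded Cauchy_def, rule_format, of "(1/4) ^ k"] by (simp add: dist_real_def)
  then obtain N where N: "\<And>k m n. m \<ge> N k \<Longrightarrow> n \<ge> N k \<Longrightarrow> \<bar>u m - u n\<bar> < (1/4) ^ k" by metis
  \<comment> \<open>Partial sums make \<open>\<sigma>\<close> monotone and at least
    \<open>N k\<close>; the summand \<open>k\<close> makes it tend to infinity.\<close>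
  define \<sigma> where "\<sigma> = (\<lambda>k::nat. k + (\<Sum>i\<le>k. N i))"
  have \<sigma>N: "\<sigma> k \<ge> N k" for k unfolding \<sigma>_def by (auto intro: trans_le_add2 member_le_sum)
  have \<sigma>_Suc: "\<sigma> k \<le> \<sigma> (Suc k)" for k by (simp add: \<sigma>_def)
  define r where "r = (\<lambda>k. \<rho> (\<sigma> k))"
  have r: "0 < r k" "r k < 1" for k using \<rho> by (simp_all add: r_def)
  define h where "h = (\<lambda>k z. H (of_real (r (Suc k)) * z) - H (of_real (r k) * z))"
  have [measurable]: "h k \<in> borel_measurable borel" for k unfolding h_def by measurable
  have hle: "cmod (h k z) \<le> 2" if "cmod z = 1" for k z
    using norm_triangle_ineq4[of "H (of_real (r (Suc k)) * z)" "H (of_real (r k) * z)"]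
      Hle[of "r (Suc k)" z] Hle[of "r k" z] r that by (auto simp: h_def less_imp_le)
  have ih: "integrable M (\<lambda>z. cmod (h k z))" for k
    by (rule integrable_bounded[where B = 2]) (use hle in auto)
  have ih2: "integrable M (\<lambda>z. (cmod (h k z))\<^sup>2)" for k
    by (rule integrable_bounded[where B = "2\<^sup>2"]) (use power_mono[OF hle norm_ge_zero, where n = 2] in simp_all)
  have h2: "(\<integral>z. (cmod (h k z))\<^sup>2 \<partial>M) \<le> (1/4) ^ k" for k
  proof -
    have "(\<integral>z. (cmod (h k z))\<^sup>2 \<partial>M) \<le> u (\<sigma> (Suc k)) - u (\<sigma> k)"
      unfolding h_def u_def r_def using \<rho> \<rho>_mono[OF \<sigma>_Suc] by (intro D) (auto simp: less_imp_le)
    also have "\<dots> \<le> (1/4) ^ k" using N[of k "\<sigma> (Suc k)" "\<sigma> k"] \<sigma>N[of k] \<sigma>_Suc[of k] by simp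
    finally show ?thesis .
  qed
  have h1: "(\<integral>z. cmod (h k z) \<partial>M) \<le> (1/2) ^ k" for k
  proof -
    \<comment> \<open>A weighted arithmetic-geometric mean inequality: with the weight 2^k an L2
      bound of order 4^-k becomes an L1 bound of order 2^-k.\<close>
    have am: "x \<le> ((1/2) ^ k + 2 ^ k * x\<^sup>2) / 2" for x :: real
    proof -
      have "0 \<le> 2 ^ k * (x - (1/2) ^ k)\<^sup>2" by simp
      also have "\<dots> = 2 ^ k * x\<^sup>2 - 2 * x + (1/2) ^ k"
        by (simp add: power2_eq_square field_simps power_mult_distrib[symmetric])
      finally show ?thesis by simp
    qed
    have "(\<integral>z. cmod (h k z) \<partial>M) \<le> (\<integral>z. ((1/2) ^ k + 2 ^ k * (cmod (h k z))\<^sup>2) / 2 \<partial>M)"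
      using ih ih2 am by (intro integral_mono) auto
    also have "\<dots> = ((1/2) ^ k + 2 ^ k * (\<integral>z. (cmod (h k z))\<^sup>2 \<partial>M)) / 2"
      using ih2 by (simp add: prob_space)
    also have "\<dots> \<le> ((1/2) ^ k + 2 ^ k * (1/4) ^ k) / 2"
      using h2[of k] by (intro divide_right_mono add_left_mono mult_left_mono) auto
    also have "\<dots> = (1/2) ^ k" by (simp add: power_mult_distrib[symmetric])
    finally show ?thesis .
  qed
  \<comment> \<open>The L1 norms of the increments are summable, so almost everywhere the increments
    are absolutely summable and the telescoping sequence converges.\<close>
  have "(\<integral>\<^sup>+z. (\<Sum>k. ennreal (cmod (h k z))) \<partial>M) = (\<Sum>k. \<integral>\<^sup>+z. ennreal (cmod (h k z)) \<partial>M)"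
    by (rule nn_integral_suminf) measurable
  also have "\<dots> = (\<Sum>k. ennreal (\<integral>z. cmod (h k z) \<partial>M))"
    using ih by (simp add: nn_integral_eq_integral)
  also have "\<dots> \<noteq> top"
    using h1 by (intro ennreal_suminf_neq_top summable_comparison_test'[OF summable_geometric[of "1/2 :: real"]]) auto
  finally have "AE z in M. (\<Sum>k. ennreal (cmod (h k z))) \<noteq> \<infinity>"
    by (intro nn_integral_PInf_AE) auto
  then have "AE z in M. convergent (\<lambda>k. H (of_real (r k) * z))"
  proof eventually_elim
    case (elim z)
    then have "summable (\<lambda>k. cmod (h k z))" by (intro summable_suminf_not_top) auto
    then have "summable (\<lambda>k. h k z)" by (rule summable_norm_cancel)
    then have "convergent (\<lambda>n. \<Sum>k<n. h k z)" by (simp add: summable_iff_convergent)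
    then have "convergent (\<lambda>n. H (of_real (r n) * z) - H (of_real (r 0) * z))"
      unfolding h_def by (simp add: sum_lessThan_telescope[where f = "\<lambda>k. H (of_real (r k) * z)"])
    then have "convergent (\<lambda>n. (H (of_real (r n) * z) - H (of_real (r 0) * z)) + H (of_real (r 0) * z))"
      by (rule convergent_add) (rule convergent_const)
    then show ?case by simp
  qed
  moreover have "r \<longlonglongrightarrow> 1"
  proof -
    have "(\<lambda>k. 1 / (real k + 2)) \<longlonglongrightarrow> 0"
      using LIMSEQ_ignore_initial_segment[OF lim_1_over_n[where 'a = real], of 2] by (simp add: add.commute)
    then have "\<rho> \<longlonglongrightarrow> 1 - 0"
      unfolding \<rho>_def by (intro tendsto_diff tendsto_const)
    moreover have "filterlim \<sigma> at_top sequentially"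
      by (rule filterlim_at_top_mono[OF filterlim_ident]) (auto simp: \<sigma>_def)
    ultimately show ?thesis unfolding r_def by (auto intro: filterlim_compose)
  qed
  ultimately show ?thesis using r by blast
qed

end

section \<open>Approximation on the circle\<close>

text \<open>On the circle cnj z is 1 / z, so these are the Laurent polynomials, written without
  division and constrained only on the circle.\<close>

definition is_laurent :: "(complex \<Rightarrow> complex) \<Rightarrow> bool" where
  "is_laurent f \<longleftrightarrow> (\<exists>N P. \<forall>z. cmod z = 1 \<longrightarrow> f z = cnj z ^ N * poly P z)"

lemma is_laurentI: "(\<And>z. cmod z = 1 \<Longrightarrow> f z = cnj z ^ N * poly P z) \<Longrightarrow> is_laurent f"
  unfolding is_laurent_def by blast

lemma circle_cnj_power: "cmod z = 1 \<Longrightarrow> cnj z ^ n * z ^ n = 1"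
  using complex_norm_square[of z] by (simp add: power_mult_distrib[symmetric] mult.commute)

lemma is_laurent_add:
  assumes "is_laurent f" "is_laurent g"
  shows "is_laurent (\<lambda>z. f z + g z)"
proof -
  obtain N P L Q where f: "\<And>z. cmod z = 1 \<Longrightarrow> f z = cnj z ^ N * poly P z"
    and g: "\<And>z. cmod z = 1 \<Longrightarrow> g z = cnj z ^ L * poly Q z"
    using assms unfolding is_laurent_def by metis
  show ?thesis
  proof (rule is_laurentI[where N = "N + L" and P = "monom 1 L * P + monom 1 N * Q"])
    fix z :: complex assume z: "cmod z = 1"
    have "cnj z ^ (N + L) * poly (monom 1 L * P + monom 1 N * Q) z =
       (cnj z ^ L * z ^ L) * (cnj z ^ N * poly P z) + (cnj z ^ N * z ^ N) * (cnj z ^ L * poly Q z)"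
      by (simp add: poly_monom power_add algebra_simps)
    then show "f z + g z = cnj z ^ (N + L) * poly (monom 1 L * P + monom 1 N * Q) z"
      using f g z circle_cnj_power[OF z] by simp
  qed
qed

lemma is_laurent_mult:
  assumes "is_laurent f" "is_laurent g"
  shows "is_laurent (\<lambda>z. f z * g z)"
proof -
  obtain N P L Q where f: "\<And>z. cmod z = 1 \<Longrightarrow> f z = cnj z ^ N * poly P z"
    and g: "\<And>z. cmod z = 1 \<Longrightarrow> g z = cnj z ^ L * poly Q z"
    using assms unfolding is_laurent_def by metis
  show ?thesis
    by (rule is_laurentI[where N = "N + L" and P = "P * Q"]) (simp add: f g power_add mult_ac)
qed

lemma is_laurent_const: "is_laurent (\<lambda>_. c)"
  by (rule is_laurentI[where N = 0 and P = "[:c:]"]) simp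

text \<open>Real polynomial functions are generated by real-linear functionals, and on the complex
  plane such a functional has the form a z + b cnj z.\<close>

lemma is_laurent_linear:
  fixes f :: "complex \<Rightarrow> real"
  assumes "bounded_linear f"
  shows "is_laurent (\<lambda>z. of_real (f z))"
proof -
  interpret bounded_linear f by fact
  define a where "a = (of_real (f 1) - \<i> * of_real (f \<i>)) / 2"
  define b where "b = (of_real (f 1) + \<i> * of_real (f \<i>)) / 2"
  have "of_real (f z) = a * z + b * cnj z" for z
  proof -
    have "z = Re z *\<^sub>R 1 + Im z *\<^sub>R \<i>" by (simp add: complex_eq_iff)
    then have "f z = Re z * f 1 + Im z * f \<i>"
      by (metis add scaleR real_scaleR_def)
    then show ?thesis by (simp add: a_def b_def complex_eq_iff field_simps)
  qed
  moreover have "is_laurent (\<lambda>z. a * z)" by (rule is_laurentI[where N = 0 and P = "[:0, a:]"]) simp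
  moreover have "is_laurent (\<lambda>z. b * cnj z)" by (rule is_laurentI[where N = 1 and P = "[:b:]"]) simp
  ultimately show ?thesis using is_laurent_add by presburger
qed

lemma real_polynomial_function_laurent:
  fixes q :: "complex \<Rightarrow> real"
  assumes "real_polynomial_function q"
  shows "is_laurent (\<lambda>z. of_real (q z))"
  using assms
  by induction (simp_all add: is_laurent_linear is_laurent_const is_laurent_add is_laurent_mult)

lemma real_polynomial_function_measurable:
  fixes q :: "complex \<Rightarrow> real"
  assumes "real_polynomial_function q"
  shows "q \<in> borel_measurable borel"
  using assms continuous_on_polymonial_function[of q UNIV]
  by (intro borel_measurable_continuous_onI) (simp add: real_polynomial_function_eq)

text \<open>On the circle \<open>Re (c z\<^sup>-\<^sup>m) = Re (cnj c z\<^sup>m)\<close>, so the negative frequencies can be reflected.\<close>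

lemma is_laurent_Re_entire:
  assumes "is_laurent f"
  obtains H where "H holomorphic_on UNIV" "\<And>z. cmod z = 1 \<Longrightarrow> Re (f z) = Re (H z)"
proof -
  obtain N P where f: "\<And>z. cmod z = 1 \<Longrightarrow> f z = cnj z ^ N * poly P z"
    using assms unfolding is_laurent_def by blast
  define H where "H = (\<lambda>z. \<Sum>k\<le>degree P. if N \<le> k then coeff P k * z ^ (k - N) else cnj (coeff P k) * z ^ (N - k))"
  have "H holomorphic_on UNIV" unfolding H_def
  proof (rule holomorphic_on_sum)
    show "(\<lambda>z. if N \<le> k then coeff P k * z ^ (k - N) else cnj (coeff P k) * z ^ (N - k)) holomorphic_on UNIV" for k
      by (cases "N \<le> k") (auto intro!: holomorphic_intros)
  qed
  moreover have "Re (f z) = Re (H z)" if z: "cmod z = 1" for z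
  proof -
    have "Re (cnj z ^ N * (c * z ^ k)) = Re (if N \<le> k then c * z ^ (k - N) else cnj c * z ^ (N - k))" for c k
    proof (cases "N \<le> k")
      case True
      then have "z ^ k = z ^ N * z ^ (k - N)" by (simp add: power_add[symmetric])
      then have "cnj z ^ N * (c * z ^ k) = (cnj z ^ N * z ^ N) * (c * z ^ (k - N))" by simp
      then have "cnj z ^ N * (c * z ^ k) = c * z ^ (k - N)" using circle_cnj_power[OF z, of N] by simp
      then show ?thesis using True by (simp only: if_True)
    next
      case False
      then have "cnj z ^ N = cnj z ^ k * cnj z ^ (N - k)" by (simp add: power_add[symmetric])
      then have "cnj z ^ N * (c * z ^ k) = (cnj z ^ k * z ^ k) * (c * cnj z ^ (N - k))" by simp
      then have "cnj z ^ N * (c * z ^ k) = cnj (cnj c * z ^ (N - k))"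
        using circle_cnj_power[OF z] by simp
      then show ?thesis using False by (simp only: if_False cnj.simps)
    qed
    then show ?thesis
      unfolding f[OF z] H_def poly_altdef sum_distrib_left Re_sum by (intro sum.cong) auto
  qed
  ultimately show ?thesis using that by blast
qed

section \<open>Density in L1 and functions concentrated on a set\<close>

context circle_prob
begin

lemma space_UNIV [simp]: "space M = UNIV"
  using sets_eq_imp_space_eq[OF sets_eq] by simp

lemma prob_UNIV [simp]: "measure M UNIV = 1"
  using prob_space by simp

lemma inner_compact:
  assumes A: "A \<in> sets borel" and e: "0 < e"
  obtains K where "compact K" "K \<subseteq> A" "measure M A - e < measure M K"
proof -
  have "\<exists>K. compact K \<and> K \<subseteq> A \<and> measure M A - e < measure M K"
  proof (rule ccontr)
    assume "\<not> ?thesis"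
    then have n: "measure M K \<le> measure M A - e" if "compact K" "K \<subseteq> A" for K
      using that by (meson not_less)
    have pos: "0 \<le> measure M A - e" using n[of "{}"] by simp
    have "emeasure M A = (SUP K\<in>{K. K \<subseteq> A \<and> compact K}. emeasure M K)"
      by (rule inner_regular[OF sets_eq _ A]) (simp add: emeasure_eq_measure)
    also have "\<dots> \<le> ennreal (measure M A - e)"
      using n by (intro SUP_least) (auto simp: emeasure_eq_measure intro!: ennreal_leI)
    finally have "measure M A \<le> measure M A - e"
      using pos by (simp add: emeasure_eq_measure)
    then show False using e by simp
  qed
  then show ?thesis using that by blast
qed

text \<open>Compact sets inside \<open>A\<close> and its complement are separated by a Urysohn
  function, which Stone-Weierstrass approximates. The pointwise bounds accompany the L1 estimate
  because the approximant will be exponentiated.\<close>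

lemma indicator_approx:
  assumes A [measurable]: "A \<in> sets borel" and e: "0 < e"
  obtains q :: "complex \<Rightarrow> real" where "real_polynomial_function q"
    "\<And>z. cmod z = 1 \<Longrightarrow> - e \<le> q z \<and> q z \<le> 1 + e"
    "(\<integral>z. \<bar>indicator A z - q z\<bar> \<partial>M) \<le> e"
proof -
  \<comment> \<open>The error consists of \<open>2 * d\<close> for the part missed by the two
    compact sets and \<open>d\<close> for the uniform approximation, which stays below
    \<open>4 * d = e\<close>.\<close>
  define d where "d = e / 4"
  have d: "0 < d" "4 * d = e" using e by (simp_all add: d_def)
  obtain K where K: "compact K" "K \<subseteq> A" "measure M A - d < measure M K"
    using inner_compact[OF A d(1)] by blast
  obtain L where L: "compact L" "L \<subseteq> - A" "measure M (- A) - d < measure M L"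
    using inner_compact[of "- A", OF _ d(1)] A by auto
  have [measurable]: "K \<in> sets borel" "L \<in> sets borel" using K L by (auto intro: borel_compact)
  have "measure M A + measure M (- A) = 1"
    using prob_compl[of A] by (simp add: Compl_eq_Diff_UNIV)
  moreover have "K \<inter> L = {}" using K L by auto
  moreover have "measure M (K \<union> L) = measure M K + measure M L"
    using \<open>K \<inter> L = {}\<close> by (intro finite_measure_Union) auto
  moreover have "measure M (- (K \<union> L)) = 1 - measure M (K \<union> L)"
    using prob_compl[of "K \<union> L"] by (simp add: Compl_eq_Diff_UNIV)
  ultimately have small: "measure M (- (K \<union> L)) \<le> 2 * d" using K L by simp
  obtain \<psi> :: "complex \<Rightarrow> real" where \<psi>: "continuous_on UNIV \<psi>" "\<And>x. \<psi> x \<in> closed_segment 0 1"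
      "\<And>x. x \<in> L \<Longrightarrow> \<psi> x = 0" "\<And>x. x \<in> K \<Longrightarrow> \<psi> x = 1"
    using Urysohn[of L K 0 1] K L by (metis \<open>K \<inter> L = {}\<close> compact_imp_closed inf_commute)
  have \<psi>01: "0 \<le> \<psi> x" "\<psi> x \<le> 1" for x using \<psi>(2)[of x] by (auto simp: closed_segment_eq_real_ivl)
  obtain q where q: "real_polynomial_function q" "\<And>x. x \<in> sphere 0 1 \<Longrightarrow> \<bar>\<psi> x - q x\<bar> < d"
    using Stone_Weierstrass_real_polynomial_function[of "sphere 0 1" \<psi> d] \<psi>(1) d(1)
    by (metis compact_sphere continuous_on_subset top_greatest)
  note [measurable] = real_polynomial_function_measurable[OF q(1)]
  have qd: "\<bar>\<psi> z - q z\<bar> < d" if "cmod z = 1" for z using q(2)[of z] that by simp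
  show ?thesis
  proof (rule that[OF q(1)])
    show "- e \<le> q z \<and> q z \<le> 1 + e" if "cmod z = 1" for z
      using qd[OF that] \<psi>01[of z] d by linarith
    have pt: "\<bar>indicator A z - q z\<bar> \<le> indicator (- (K \<union> L)) z + d" if "cmod z = 1" for z
    proof (cases "z \<in> K \<union> L")
      case True
      then have "\<psi> z = indicator A z" using \<psi>(3,4) K L by (auto simp: indicator_def)
      then show ?thesis using True qd[OF that] by simp
    next
      case False
      then show ?thesis using qd[OF that] \<psi>01[of z] by (auto simp: indicator_def)
    qed
    have "(\<integral>z. \<bar>indicator A z - q z\<bar> \<partial>M) \<le> (\<integral>z. indicator (- (K \<union> L)) z + d \<partial>M)"
    proof (rule integral_mono_circle)
      show "integrable M (\<lambda>z. \<bar>indicator A z - q z\<bar>)"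
      proof (rule integrable_bounded[where B = "1 + d"])
        show "norm \<bar>indicator A z - q z\<bar> \<le> 1 + d" if "cmod z = 1" for z
          using pt[OF that] indicator_le_1[of "- (K \<union> L)" z, where 'a = real] by (simp del: indicator_le_1)
      qed measurable
      show "integrable M (\<lambda>z. indicator (- (K \<union> L)) z + d)"
        by (rule integrable_bounded[where B = "1 + d"]) (use d in \<open>auto simp: indicator_def\<close>)
    qed (rule pt)
    also have "\<dots> = measure M (- (K \<union> L)) + d"
      using prob_space by (subst Bochner_Integration.integral_add) (auto simp: emeasure_eq_measure)
    also have "\<dots> \<le> e" using small d by linarith
    finally show "(\<integral>z. \<bar>indicator A z - q z\<bar> \<partial>M) \<le> e" .
  qed
qed

lemma laurent_integrable: "integrable M (\<lambda>z. cnj z ^ N * poly P z)"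
proof -
  have "continuous_on (cball 0 1) (\<lambda>z. cnj z ^ N * poly P z)" by (intro continuous_intros)
  then obtain B where "\<And>z. cmod z \<le> 1 \<Longrightarrow> cmod (cnj z ^ N * poly P z) \<le> B"
    using continuous_disc_bounded by blast
  then show ?thesis by (intro integrable_bounded[where B = B]) auto
qed

lemma laurent_dense:
  fixes v :: "complex \<Rightarrow> complex"
  assumes "integrable M v" "0 < e"
  shows "\<exists>N P. (\<integral>z. cmod (v z - cnj z ^ N * poly P z) \<partial>M) \<le> e"
  using assms
proof (induction arbitrary: e)
  case (base A c)
  have [measurable]: "A \<in> sets borel" using base sets_eq by simp
  \<comment> \<open>The summand 1 also covers \<open>c = 0\<close>.\<close>
  define d where "d = e / (cmod c + 1)"
  have d: "0 < d" "cmod c * d \<le> e"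
    using base(3) by (auto simp: d_def field_simps add_pos_nonneg)
  obtain q where q: "real_polynomial_function q" "(\<integral>z. \<bar>indicator A z - q z\<bar> \<partial>M) \<le> d"
    by (rule indicator_approx[of A d]) (use d in auto)
  have "is_laurent (\<lambda>z. c * of_real (q z))"
    by (intro is_laurent_mult is_laurent_const real_polynomial_function_laurent q)
  then obtain N P where NP: "\<And>z. cmod z = 1 \<Longrightarrow> c * of_real (q z) = cnj z ^ N * poly P z"
    unfolding is_laurent_def by blast
  note [measurable] = real_polynomial_function_measurable[OF q(1)]
  have "(\<integral>z. cmod (indicator A z *\<^sub>R c - cnj z ^ N * poly P z) \<partial>M) = (\<integral>z. cmod c * \<bar>indicator A z - q z\<bar> \<partial>M)"
  proof (rule integral_cong_circle)
    fix z :: complex assume "cmod z = 1"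
    then have "indicator A z *\<^sub>R c - cnj z ^ N * poly P z = c * of_real (indicator A z - q z)"
      by (simp only: NP[symmetric]) (simp add: scaleR_conv_of_real algebra_simps)
    then show "cmod (indicator A z *\<^sub>R c - cnj z ^ N * poly P z) = cmod c * \<bar>indicator A z - q z\<bar>"
      by (simp only: norm_mult norm_of_real)
  qed measurable
  also have "\<dots> \<le> cmod c * d" using q(2) by (simp add: mult_left_mono)
  finally show ?case using d(2) by (intro exI[of _ N] exI[of _ P]) simp
next
  case (add f g)
  obtain N P where f: "(\<integral>z. cmod (f z - cnj z ^ N * poly P z) \<partial>M) \<le> e / 2"
    using add(3)[of "e / 2"] add(5) by auto
  obtain L Q where g: "(\<integral>z. cmod (g z - cnj z ^ L * poly Q z) \<partial>M) \<le> e / 2"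
    using add(4)[of "e / 2"] add(5) by auto
  have "is_laurent (\<lambda>z. cnj z ^ N * poly P z + cnj z ^ L * poly Q z)"
    by (intro is_laurent_add) (auto simp: is_laurent_def)
  then obtain K R where KR: "\<And>z. cmod z = 1 \<Longrightarrow> cnj z ^ N * poly P z + cnj z ^ L * poly Q z = cnj z ^ K * poly R z"
    unfolding is_laurent_def by blast
  have "(\<integral>z. cmod (f z + g z - cnj z ^ K * poly R z) \<partial>M) \<le>
      (\<integral>z. cmod (f z - cnj z ^ N * poly P z) + cmod (g z - cnj z ^ L * poly Q z) \<partial>M)"
  proof (rule integral_mono_circle)
    fix z :: complex assume "cmod z = 1"
    then have "f z + g z - cnj z ^ K * poly R z = (f z - cnj z ^ N * poly P z) + (g z - cnj z ^ L * poly Q z)"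
      by (simp add: KR[symmetric])
    then show "cmod (f z + g z - cnj z ^ K * poly R z) \<le>
        cmod (f z - cnj z ^ N * poly P z) + cmod (g z - cnj z ^ L * poly Q z)"
      by (metis norm_triangle_ineq)
  qed (use add laurent_integrable in auto)
  also have "\<dots> = (\<integral>z. cmod (f z - cnj z ^ N * poly P z) \<partial>M) + (\<integral>z. cmod (g z - cnj z ^ L * poly Q z) \<partial>M)"
    using add laurent_integrable by (intro Bochner_Integration.integral_add) auto
  also have "\<dots> \<le> e" using f g by simp
  finally show ?case by blast
next
  case (lim f s)
  have [measurable]: "f \<in> borel_measurable M" "s i \<in> borel_measurable M" for i
    using lim by auto
  have "(\<lambda>i. \<integral>z. cmod (s i z - f z) \<partial>M) \<longlonglongrightarrow> (\<integral>z. 0 \<partial>M)"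
  proof (rule integral_dominated_convergence)
    \<comment> \<open>The approximants satisfy |s i| <= 2 |f|, so the difference is at most 3
      |f|.\<close>
    show "integrable M (\<lambda>z. 3 * cmod (f z))" using lim by auto
    show "AE z in M. (\<lambda>i. cmod (s i z - f z)) \<longlonglongrightarrow> 0"
      using lim by (auto intro!: tendsto_norm_zero LIM_zero)
    show "AE z in M. norm (cmod (s i z - f z)) \<le> 3 * cmod (f z)" for i
    proof (rule AE_I2)
      fix z assume "z \<in> space M"
      then show "norm (cmod (s i z - f z)) \<le> 3 * cmod (f z)"
        using lim(3)[of z i] norm_triangle_ineq4[of "s i z" "f z"] by simp
    qed
  qed auto
  then have "eventually (\<lambda>i. (\<integral>z. cmod (s i z - f z) \<partial>M) < e / 2) sequentially"
    using lim(6) by (intro order_tendstoD(2)) auto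
  then obtain i where i: "(\<integral>z. cmod (s i z - f z) \<partial>M) < e / 2"
    by (auto simp: eventually_sequentially)
  obtain N P where NP: "(\<integral>z. cmod (s i z - cnj z ^ N * poly P z) \<partial>M) \<le> e / 2"
    using lim(5)[of "e / 2" i] lim(6) by auto
  have "(\<integral>z. cmod (f z - cnj z ^ N * poly P z) \<partial>M) \<le>
      (\<integral>z. cmod (s i z - f z) + cmod (s i z - cnj z ^ N * poly P z) \<partial>M)"
  proof (rule integral_mono)
    fix z
    show "cmod (f z - cnj z ^ N * poly P z) \<le> cmod (s i z - f z) + cmod (s i z - cnj z ^ N * poly P z)"
      by (smt (verit) norm_minus_commute norm_triangle_ineq add_diff_cancel diff_add_cancel add_diff_eq)
  qed (use lim laurent_integrable in auto)
  also have "\<dots> = (\<integral>z. cmod (s i z - f z) \<partial>M) + (\<integral>z. cmod (s i z - cnj z ^ N * poly P z) \<partial>M)"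
    using lim laurent_integrable by (intro Bochner_Integration.integral_add) auto
  also have "\<dots> \<le> e" using i NP by simp
  finally show ?case by blast
qed

text \<open>For a real function only the real part of the Laurent approximant counts, and this is
  the real part of an entire function, whose Poisson integrals are known exactly.\<close>

lemma entire_Re_dense:
  fixes w :: "complex \<Rightarrow> real"
  assumes "integrable M w" "0 < e"
  obtains H where "H holomorphic_on UNIV" "(\<integral>z. \<bar>w z - Re (H z)\<bar> \<partial>M) \<le> e"
proof -
  obtain N P where NP: "(\<integral>z. cmod (of_real (w z) - cnj z ^ N * poly P z) \<partial>M) \<le> e"
    using laurent_dense[of "\<lambda>z. of_real (w z)" e] assms by auto
  obtain H where H: "H holomorphic_on UNIV" "\<And>z. cmod z = 1 \<Longrightarrow> Re (cnj z ^ N * poly P z) = Re (H z)"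
    using is_laurent_Re_entire[of "\<lambda>z. cnj z ^ N * poly P z"] unfolding is_laurent_def by blast
  have intH: "integrable M (\<lambda>z. Re (H z))" using entire_integrable[OF H(1)] by simp
  have "(\<integral>z. \<bar>w z - Re (H z)\<bar> \<partial>M) \<le> (\<integral>z. cmod (of_real (w z) - cnj z ^ N * poly P z) \<partial>M)"
  proof (rule integral_mono_circle)
    show "\<bar>w z - Re (H z)\<bar> \<le> cmod (of_real (w z) - cnj z ^ N * poly P z)" if "cmod z = 1" for z
      using abs_Re_le_cmod[of "of_real (w z) - cnj z ^ N * poly P z"] H(2)[OF that] by simp
    show "integrable M (\<lambda>z. cmod (of_real (w z) - cnj z ^ N * poly P z))"
      using assms(1) laurent_integrable by auto
  qed (use assms(1) intH in auto)
  also note NP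
  finally show ?thesis using that[OF H(1)] by blast
qed

text \<open>\<open>G = exp (t (H - H 0))\<close> with \<open>Re H\<close> close to the indicator function of \<open>A\<close>: on the
  complement of \<open>A\<close> its modulus is about \<open>exp (- t \<mu>(A))\<close>.\<close>

lemma concentrating_function:
  assumes A [measurable]: "A \<in> sets borel" and pos: "0 < measure M A" and e: "0 < e"
  obtains G where "G holomorphic_on UNIV" "G 0 = 1" "(\<integral>z. indicator (- A) z * cmod (G z) \<partial>M) \<le> e"
proof -
  define a where "a = measure M A"
  \<comment> \<open>Chosen to make exp (- t a / 2) at most e / 2; the absolute value keeps
    \<open>t\<close> nonnegative when \<open>e\<close> is large.\<close>
  define t where "t = 2 / a * \<bar>ln (e / 2)\<bar>"
  have a: "0 < a" using pos by (simp add: a_def)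
  have t: "0 \<le> t" using a by (simp add: t_def)
  have "exp (- (t * a / 2)) = exp (- \<bar>ln (e / 2)\<bar>)" using a by (simp add: t_def)
  also have "\<dots> \<le> exp (ln (e / 2))" by simp
  also have "\<dots> = e / 2" using e by simp
  finally have et: "exp (- (t * a / 2)) \<le> e / 2" .
  \<comment> \<open>The bound a / 2 forces Re (H 0) >= a / 2, the bound 1 gives q <= 2, and the
    third bound limits the correction t exp (2 t) d to 1.\<close>
  define d where "d = min (min (a / 2) 1) (1 / (t * exp (2 * t) + 1))"
  have tp: "0 < t * exp (2 * t) + 1" using t by (simp add: add_nonneg_pos)
  have d: "0 < d" "d \<le> a / 2" "d \<le> 1" "d \<le> 1 / (t * exp (2 * t) + 1)"
    using a tp by (auto simp: d_def)
  have dt: "t * exp (2 * t) * d \<le> 1"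
  proof -
    have "t * exp (2 * t) * d \<le> t * exp (2 * t) * (1 / (t * exp (2 * t) + 1))"
      using d(4) t by (intro mult_left_mono) auto
    also have "\<dots> \<le> 1" using tp by (simp add: divide_le_eq)
    finally show ?thesis .
  qed
  obtain q where q: "real_polynomial_function q" "\<And>z. cmod z = 1 \<Longrightarrow> - d \<le> q z \<and> q z \<le> 1 + d"
    "(\<integral>z. \<bar>indicator A z - q z\<bar> \<partial>M) \<le> d"
    using indicator_approx[OF A d(1)] by metis
  note [measurable] = real_polynomial_function_measurable[OF q(1)]
  obtain H where H: "H holomorphic_on UNIV" "\<And>z. cmod z = 1 \<Longrightarrow> Re (of_real (q z)) = Re (H z)"
    using is_laurent_Re_entire[OF real_polynomial_function_laurent[OF q(1)]] by blast
  note [measurable] = entire_measurable[OF H(1)] and intH = entire_integrable[OF H(1)]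
  have iq: "integrable M q"
  proof (rule integrable_bounded[where B = 2])
    show "norm (q z) \<le> 2" if "cmod z = 1" for z using q(2)[OF that] d by auto
  qed measurable
  have iA: "integrable M (indicator A :: complex \<Rightarrow> real)" by (rule integrable_bounded[where B = 1]) auto
  have iAq: "integrable M (\<lambda>z. \<bar>indicator A z - q z\<bar>)" using iq iA by auto
  have "(\<integral>z. H (of_real 1 * z) \<partial>M) = H 0"
    by (rule mean_value[where R = 2]) (use H(1) holomorphic_on_subset in auto)
  then have "Re (H 0) = (\<integral>z. Re (H z) \<partial>M)" using intH by simp
  also have "\<dots> = (\<integral>z. q z \<partial>M)" using H(2) by (intro integral_cong_circle) auto
  finally have H0: "Re (H 0) = (\<integral>z. q z \<partial>M)" .
  have "a - (\<integral>z. q z \<partial>M) = (\<integral>z. indicator A z - q z \<partial>M)"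
    using iA iq by (simp add: a_def)
  also have "\<dots> \<le> (\<integral>z. \<bar>indicator A z - q z\<bar> \<partial>M)"
    using iA iq by (intro integral_mono) auto
  also have "\<dots> \<le> d" by fact
  finally have H0a: "a / 2 \<le> Re (H 0)" using d H0 by simp
  define G where "G = (\<lambda>z. exp (of_real t * (H z - H 0)))"
  have G: "G holomorphic_on UNIV" unfolding G_def by (intro holomorphic_intros H)
  have [measurable]: "G \<in> borel_measurable borel" by (rule entire_measurable[OF G])
  have pt: "indicator (- A) z * cmod (G z) \<le> exp (- (t * a / 2)) * (1 + t * exp (2 * t) * \<bar>indicator A z - q z\<bar>)"
    if z: "cmod z = 1" for z
  proof (cases "z \<in> A")
    case True
    then show ?thesis using t by simp
  next
    case False
    \<comment> \<open>The exponential is linearised because \<open>q\<close> is small off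
      \<open>A\<close> only in the mean: off \<open>A\<close> one has |q| = |indicator A - q|, whose
      integral is at most \<open>d\<close>.\<close>
    have expb: "exp x \<le> 1 + exp (2 * t) * \<bar>x\<bar>" if "x \<le> 2 * t" for x
    proof (cases "0 \<le> x")
      case True
      have "exp x * (1 - x) \<le> exp x * exp (- x)" using exp_ge_add_one_self[of "- x"] by (intro mult_left_mono) auto
      then have "exp x \<le> 1 + x * exp x" by (simp add: exp_minus algebra_simps)
      also have "\<dots> \<le> 1 + x * exp (2 * t)" using True that by (intro add_left_mono mult_left_mono) auto
      finally show ?thesis using True by (simp add: mult.commute)
    next
      case False
      then have "exp x \<le> 1" by simp
      moreover have "0 \<le> exp (2 * t) * \<bar>x\<bar>" by simp
      ultimately show ?thesis by linarith
    qed
    have "cmod (G z) = exp (t * q z - t * Re (H 0))"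
      using H(2)[OF z] by (simp add: G_def algebra_simps)
    also have "\<dots> \<le> exp (t * q z + - (t * a / 2))"
      using H0a t mult_left_mono[OF H0a t] by simp
    also have "\<dots> = exp (- (t * a / 2)) * exp (t * q z)" by (simp only: exp_add mult.commute)
    also have "\<dots> \<le> exp (- (t * a / 2)) * (1 + exp (2 * t) * \<bar>t * q z\<bar>)"
    proof (intro mult_left_mono expb)
      have "q z \<le> 2" using q(2)[OF z] d by linarith
      then show "t * q z \<le> 2 * t" using t mult_left_mono[of "q z" 2 t] by simp
    qed auto
    also have "\<bar>t * q z\<bar> = t * \<bar>indicator A z - q z\<bar>" using False t by (simp add: abs_mult)
    finally show ?thesis using False by (simp add: mult_ac)
  qed
  have G0: "G 0 = 1" by (simp add: G_def)
  have "(\<integral>z. indicator (- A) z * cmod (G z) \<partial>M) \<le>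
      (\<integral>z. exp (- (t * a / 2)) * (1 + t * exp (2 * t) * \<bar>indicator A z - q z\<bar>) \<partial>M)"
  proof (rule integral_mono_circle)
    show "integrable M (\<lambda>z. indicator (- A) z * cmod (G z))"
      using integrable_mult_indicator[of "- A" M "\<lambda>z. cmod (G z)"] entire_integrable[OF G] by (simp add: sets_eq)
  qed (use iAq pt in auto)
  also have "\<dots> = exp (- (t * a / 2)) * (1 + t * exp (2 * t) * (\<integral>z. \<bar>indicator A z - q z\<bar> \<partial>M))"
    using iAq by (simp add: prob_space)
  also have "\<dots> \<le> (e / 2) * (1 + 1)"
  proof (intro mult_mono add_left_mono et)
    have "t * exp (2 * t) * (\<integral>z. \<bar>indicator A z - q z\<bar> \<partial>M) \<le> t * exp (2 * t) * d"
      using q(3) t by (intro mult_left_mono) auto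
    then show "t * exp (2 * t) * (\<integral>z. \<bar>indicator A z - q z\<bar> \<partial>M) \<le> 1" using dt by linarith
    show "0 \<le> 1 + t * exp (2 * t) * (\<integral>z. \<bar>indicator A z - q z\<bar> \<partial>M)" using t by simp
  qed (use e in auto)
  finally show ?thesis using that[OF G G0] by simp
qed

end

text \<open>The common last step of the approximation arguments: the comparison sequence may depend
  on \<open>e\<close>, as long as it tends to 0.\<close>

lemma tendsto_zero_approx:
  fixes X :: "nat \<Rightarrow> 'a :: real_normed_vector"
  assumes "\<And>e. 0 < e \<Longrightarrow> \<exists>Y. Y \<longlonglongrightarrow> 0 \<and> (\<forall>\<^sub>F j in sequentially. norm (X j) \<le> norm (Y j :: 'b :: real_normed_vector) + e)"
  shows "X \<longlonglongrightarrow> 0"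
proof (rule tendstoI)
  fix e :: real assume e: "0 < e"
  obtain Y :: "nat \<Rightarrow> 'b" where Y: "Y \<longlonglongrightarrow> 0" and ev: "\<forall>\<^sub>F j in sequentially. norm (X j) \<le> norm (Y j) + e / 2"
    using assms[of "e / 2"] e by auto
  have "\<forall>\<^sub>F j in sequentially. dist (Y j) 0 < e / 2" using Y e by (intro tendstoD) auto
  then show "\<forall>\<^sub>F j in sequentially. dist (X j) 0 < e"
    using ev by eventually_elim simp
qed

section \<open>Weak convergence and Poisson integrals on the circle\<close>

context circle_prob
begin

text \<open>Both sides express the Taylor coefficient of order \<open>N\<close>. A boundary integral
  is thereby moved to radius 1/2, where pointwise convergence inside the disc can be used.\<close>

lemma boundary_coeff:
  assumes L: "L holomorphic_on ball 0 1" "continuous_on (cball 0 1) L" and [measurable]: "L \<in> borel_measurable borel"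
  shows "(\<integral>z. L z * cnj z ^ N \<partial>M) = 2 ^ N * (\<integral>z. L (z / 2) * cnj z ^ N \<partial>M)"
proof -
  define r where "r = (\<lambda>k::nat. 1 - 1 / (real k + 2))"
  have r: "0 \<le> r k" "r k < 1" for k by (simp_all add: r_def field_simps)
  have "(\<lambda>k. 1 / (real k + 2)) \<longlonglongrightarrow> 0"
    using LIMSEQ_ignore_initial_segment[OF lim_1_over_n[where 'a = real], of 2] by (simp add: add.commute)
  then have "r \<longlonglongrightarrow> 1 - 0" unfolding r_def by (intro tendsto_diff tendsto_const)
  then have rlim: "(\<lambda>k. complex_of_real (r k)) \<longlonglongrightarrow> 1"
    using tendsto_of_real[of r 1] by simp
  obtain B where B: "\<And>z. cmod z \<le> 1 \<Longrightarrow> cmod (L z) \<le> B" using continuous_disc_bounded[OF L(2)] by blast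
  have in_disc: "cmod (of_real (r k) * z) \<le> 1" if "cmod z = 1" for k z
    using r[of k] that by (simp add: norm_mult)
  have "(\<lambda>k. \<integral>z. L (of_real (r k) * z) * cnj z ^ N \<partial>M) \<longlonglongrightarrow> (\<integral>z. L z * cnj z ^ N \<partial>M)"
  proof (rule dominated_convergence_circle)
    show "AE z in M. (\<lambda>k. L (of_real (r k) * z) * cnj z ^ N) \<longlonglongrightarrow> L z * cnj z ^ N"
      using AE_norm
    proof eventually_elim
      case (elim z)
      have "(\<lambda>k. of_real (r k) * z) \<longlonglongrightarrow> 1 * z" by (intro tendsto_intros rlim)
      then have "(\<lambda>k. L (of_real (r k) * z)) \<longlonglongrightarrow> L z"
        using continuous_on_tendsto_compose[OF L(2), of "\<lambda>k. of_real (r k) * z" z sequentially] in_disc elim by simp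
      then show ?case by (intro tendsto_intros)
    qed
    show "norm (L (of_real (r k) * z) * cnj z ^ N) \<le> B" if "cmod z = 1" for k z
      using B in_disc that by (simp add: norm_mult norm_power)
  qed measurable
  moreover have "(\<integral>z. L (of_real (r k) * z) * cnj z ^ N \<partial>M) = taylor_coeff L N * of_real (r k) ^ N" for k
    by (rule coeff_integral[OF L(1) _ r]) measurable
  moreover have "(\<lambda>k. taylor_coeff L N * of_real (r k) ^ N) \<longlonglongrightarrow> taylor_coeff L N * 1 ^ N"
    by (intro tendsto_intros rlim)
  ultimately have "(\<integral>z. L z * cnj z ^ N \<partial>M) = taylor_coeff L N"
    using LIMSEQ_unique by fastforce
  moreover have "(\<integral>z. L (of_real (1/2) * z) * cnj z ^ N \<partial>M) = taylor_coeff L N * of_real (1/2) ^ N"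
    by (rule coeff_integral[OF L(1)]) auto
  ultimately show ?thesis by (simp add: power_divide)
qed

text \<open>Against a Laurent polynomial the integral is a Fourier coefficient and moves to radius
  1/2, where dominated convergence applies. The uniform bound extends this to integrable
  \<open>v\<close> by density; pointwise convergence on the circle is not assumed.\<close>

lemma weak_null:
  assumes K: "\<And>j. K j holomorphic_on ball 0 1" "\<And>j. continuous_on (cball 0 1) (K j)"
    and [measurable]: "\<And>j. K j \<in> borel_measurable borel"
    and K2: "\<And>j z. cmod z \<le> 1 \<Longrightarrow> cmod (K j z) \<le> 2"
    and lim: "\<And>z. cmod z < 1 \<Longrightarrow> (\<lambda>j. K j z) \<longlonglongrightarrow> 0"
    and v: "integrable M v"
  shows "(\<lambda>j. \<integral>z. K j z * v z \<partial>M) \<longlonglongrightarrow> (0 :: complex)"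
proof (rule tendsto_zero_approx)
  fix e :: real assume e: "0 < e"
  obtain N P where NP: "(\<integral>z. cmod (v z - cnj z ^ N * poly P z) \<partial>M) \<le> e / 2"
    using laurent_dense[OF v, of "e / 2"] e by auto
  have "poly P holomorphic_on UNIV" by (intro holomorphic_intros)
  then obtain B where B: "\<And>z. cmod z \<le> 1 \<Longrightarrow> cmod (poly P z) \<le> B"
    using entire_circle_bounded by blast
  have [measurable]: "v \<in> borel_measurable M" using v by auto
  define Y where "Y = (\<lambda>j. \<integral>z. K j z * (cnj z ^ N * poly P z) \<partial>M)"
  have Y_eq: "Y j = 2 ^ N * (\<integral>z. K j (z / 2) * poly P (z / 2) * cnj z ^ N \<partial>M)" for j
  proof -
    have "(\<integral>z. (K j z * poly P z) * cnj z ^ N \<partial>M) = 2 ^ N * (\<integral>z. (K j (z / 2) * poly P (z / 2)) * cnj z ^ N \<partial>M)"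
    proof (rule boundary_coeff)
      have [measurable]: "K j \<in> borel_measurable borel" by fact
      show "(\<lambda>z. K j z * poly P z) \<in> borel_measurable borel" by measurable
    qed (intro holomorphic_intros continuous_intros K)+
    then show ?thesis by (simp add: Y_def mult_ac)
  qed
  have "(\<lambda>j. 2 ^ N * (\<integral>z. K j (z / 2) * poly P (z / 2) * cnj z ^ N \<partial>M)) \<longlonglongrightarrow> 2 ^ N * (\<integral>z. 0 \<partial>M)"
  proof (intro tendsto_mult tendsto_const dominated_convergence_circle)
    show "AE z in M. (\<lambda>j. K j (z / 2) * poly P (z / 2) * cnj z ^ N) \<longlonglongrightarrow> 0"
      using AE_norm
    proof eventually_elim
      case (elim z)
      have "(\<lambda>j. K j (z / 2) * poly P (z / 2) * cnj z ^ N) \<longlonglongrightarrow> 0 * poly P (z / 2) * cnj z ^ N"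
        by (intro tendsto_intros lim) (simp add: norm_divide elim)
      then show ?case by simp
    qed
    show "norm (K j (z / 2) * poly P (z / 2) * cnj z ^ N) \<le> 2 * B" if z: "cmod z = 1" for j z
    proof -
      have "cmod (K j (z / 2)) * cmod (poly P (z / 2)) \<le> 2 * B"
        using z by (intro mult_mono K2 B) (auto simp: norm_divide)
      then show ?thesis using z by (simp add: norm_mult norm_power)
    qed
  qed measurable
  then have "Y \<longlonglongrightarrow> 0" unfolding Y_eq[symmetric] by simp
  moreover have "cmod (\<integral>z. K j z * v z \<partial>M) \<le> cmod (Y j) + e" for j
  proof -
    have i1: "integrable M (\<lambda>z. K j z * g z)" if g: "integrable M g" for g
    proof (rule Bochner_Integration.integrable_bound)
      show "integrable M (\<lambda>z. 2 * cmod (g z))" using g by auto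
      show "(\<lambda>z. K j z * g z) \<in> borel_measurable M" using g by measurable
      show "AE z in M. norm (K j z * g z) \<le> norm (2 * cmod (g z))"
        using AE_norm by eventually_elim (use K2 in \<open>auto simp: norm_mult intro!: mult_right_mono\<close>)
    qed
    have iL: "integrable M (\<lambda>z. v z - cnj z ^ N * poly P z)" using v laurent_integrable by auto
    have "(\<integral>z. K j z * v z \<partial>M) - Y j = (\<integral>z. K j z * (v z - cnj z ^ N * poly P z) \<partial>M)"
      unfolding Y_def using i1[OF v] i1[OF laurent_integrable] by (simp add: right_diff_distrib)
    also have "cmod \<dots> \<le> (\<integral>z. 2 * cmod (v z - cnj z ^ N * poly P z) \<partial>M)"
    proof (rule order_trans[OF integral_norm_bound integral_mono_circle])
      show "cmod (K j z * (v z - cnj z ^ N * poly P z)) \<le> 2 * cmod (v z - cnj z ^ N * poly P z)" if "cmod z = 1" for z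
        using K2[of z j] that by (simp add: norm_mult mult_right_mono)
    qed (use i1[OF iL] iL in auto)
    also have "\<dots> \<le> e" using NP by simp
    finally show ?thesis
      using norm_triangle_sub[of "\<integral>z. K j z * v z \<partial>M" "Y j"] by linarith
  qed
  ultimately show "\<exists>Y. Y \<longlonglongrightarrow> 0 \<and> (\<forall>\<^sub>F j in sequentially. cmod (\<integral>z. K j z * v z \<partial>M) \<le> cmod (Y j :: complex) + e)"
    by (intro exI[of _ Y]) auto
qed

lemma poisson_integral_measurable [measurable]:
  assumes [measurable]: "w \<in> borel_measurable borel"
  shows "(\<lambda>x. \<integral>e. poisson e (of_real r * x) * w e \<partial>M) \<in> borel_measurable borel"
  by measurable

text \<open>After Fubini and \<open>poisson_swap\<close> the kernel is integrated in its first
  argument, where it has mass 1.\<close>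

lemma poisson_L1_contraction:
  fixes d :: "complex \<Rightarrow> real"
  assumes [measurable]: "d \<in> borel_measurable borel" and d: "\<And>e. cmod e = 1 \<Longrightarrow> \<bar>d e\<bar> \<le> B" and r: "0 \<le> r" "r < 1"
  shows "(\<integral>\<^sup>+x. ennreal \<bar>\<integral>e. poisson e (of_real r * x) * d e \<partial>M\<bar> \<partial>M) \<le> ennreal (\<integral>e. \<bar>d e\<bar> \<partial>M)"
proof -
  interpret pair_sigma_finite M M by unfold_locales
  have intd: "integrable M d" by (rule integrable_bounded[where B = B]) (use d in auto)
  have rx: "cmod (of_real r * x) < 1" if "cmod x = 1" for x using r that by (simp add: norm_mult)
  have "(\<integral>\<^sup>+x. ennreal \<bar>\<integral>e. poisson e (of_real r * x) * d e \<partial>M\<bar> \<partial>M) \<le>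
      (\<integral>\<^sup>+x. \<integral>\<^sup>+e. ennreal (poisson e (of_real r * x) * \<bar>d e\<bar>) \<partial>M \<partial>M)"
  proof (rule nn_integral_mono_AE)
    show "AE x in M. ennreal \<bar>\<integral>e. poisson e (of_real r * x) * d e \<partial>M\<bar> \<le> (\<integral>\<^sup>+e. ennreal (poisson e (of_real r * x) * \<bar>d e\<bar>) \<partial>M)"
      using AE_norm
    proof eventually_elim
      case (elim x)
      have "integrable M (\<lambda>e. poisson e (of_real r * x) * d e)"
        by (rule poisson_mult_integrable[OF _ d rx[OF elim]]) measurable
      then have "ennreal \<bar>\<integral>e. poisson e (of_real r * x) * d e \<partial>M\<bar> \<le> (\<integral>\<^sup>+e. ennreal (norm (poisson e (of_real r * x) * d e)) \<partial>M)"
        using integral_norm_bound_ennreal by fastforce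
      then show ?case using poisson_nonneg[OF rx[OF elim]] by (simp add: abs_mult)
    qed
  qed
  also have "\<dots> = (\<integral>\<^sup>+e. \<integral>\<^sup>+x. ennreal (poisson e (of_real r * x) * \<bar>d e\<bar>) \<partial>M \<partial>M)"
    by (rule Fubini') measurable
  also have "\<dots> = (\<integral>\<^sup>+e. ennreal \<bar>d e\<bar> \<partial>M)"
  proof (rule nn_integral_cong_AE)
    show "AE e in M. (\<integral>\<^sup>+x. ennreal (poisson e (of_real r * x) * \<bar>d e\<bar>) \<partial>M) = ennreal \<bar>d e\<bar>"
      using AE_norm
    proof eventually_elim
      case (elim e)
      have "(\<integral>\<^sup>+x. ennreal (poisson e (of_real r * x) * \<bar>d e\<bar>) \<partial>M) =
          (\<integral>\<^sup>+x. ennreal (poisson x (of_real r * e)) * ennreal \<bar>d e\<bar> \<partial>M)"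
      proof (rule nn_integral_cong_AE)
        show "AE x in M. ennreal (poisson e (of_real r * x) * \<bar>d e\<bar>) = ennreal (poisson x (of_real r * e)) * ennreal \<bar>d e\<bar>"
          using AE_norm
        proof eventually_elim
          case x: (elim x)
          show ?case
            using poisson_swap[OF elim x r(1)] poisson_nonneg[OF rx[OF elim], of x] by (simp add: ennreal_mult)
        qed
      qed
      also have "\<dots> = (\<integral>\<^sup>+x. ennreal (poisson x (of_real r * e)) \<partial>M) * ennreal \<bar>d e\<bar>"
        by (rule nn_integral_multc) measurable
      also have "(\<integral>\<^sup>+x. ennreal (poisson x (of_real r * e)) \<partial>M) = ennreal (\<integral>x. poisson x (of_real r * e) \<partial>M)"
      proof (rule nn_integral_eq_integral)
        show "integrable M (\<lambda>x. poisson x (of_real r * e))"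
          using poisson_mult_integrable[of "\<lambda>_. 1" 1, OF _ _ rx[OF elim]] by simp
      qed (use poisson_nonneg[OF rx[OF elim]] in auto)
      finally show ?case by (simp add: poisson_mass[OF rx[OF elim]])
    qed
  qed
  also have "\<dots> = ennreal (\<integral>e. \<bar>d e\<bar> \<partial>M)" using intd by (intro nn_integral_eq_integral) auto
  finally show ?thesis .
qed

text \<open>A limit known to be 0 on \<open>E\<close> is transferred to the function itself. Replace
  \<open>w\<close> by the real part of an entire \<open>H\<close> up to a small L1 error: for
  \<open>H\<close> the radial limit is its boundary value, and the Poisson integral of the error
  remains small in L1.\<close>

lemma poisson_limit_zero:
  fixes w :: "complex \<Rightarrow> real"
  assumes [measurable]: "w \<in> borel_measurable borel" and w: "\<And>z. 0 \<le> w z" "\<And>z. w z \<le> 1"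
    and r: "\<And>k. 0 < r k" "\<And>k. r k < 1" "r \<longlonglongrightarrow> 1"
    and [measurable]: "E \<in> sets borel"
    and lim: "AE x in M. x \<in> E \<longrightarrow> (\<lambda>k. \<integral>e. poisson e (of_real (r k) * x) * w e \<partial>M) \<longlonglongrightarrow> 0"
  shows "AE x in M. x \<in> E \<longrightarrow> w x = 0"
proof -
  define Q where "Q = (\<lambda>k x. \<integral>e. poisson e (of_real (r k) * x) * w e \<partial>M)"
  have [measurable]: "Q k \<in> borel_measurable borel" for k unfolding Q_def by measurable
  have rx: "cmod (of_real (r k) * x) < 1" if "cmod x = 1" for k x
    using r(1,2)[of k] that by (simp add: norm_mult)
  have Q01: "0 \<le> Q k x" "Q k x \<le> 1" if x: "cmod x = 1" for k x
  proof -
    show "0 \<le> Q k x" unfolding Q_def using w poisson_nonneg[OF rx[OF x]] by (intro integral_nonneg_AE) auto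
    have "Q k x \<le> (\<integral>e. poisson e (of_real (r k) * x) * 1 \<partial>M)"
      unfolding Q_def using w poisson_nonneg[OF rx[OF x, of k]] x
      by (intro integral_mono poisson_mult_integrable[of _ 1] mult_left_mono rx) auto
    then show "Q k x \<le> 1" by (simp add: poisson_mass[OF rx[OF x]])
  qed
  have intw: "integrable M (\<lambda>x. indicator E x * w x)"
    by (rule integrable_bounded[where B = 1]) (use w in \<open>auto simp: indicator_def\<close>)
  have "(\<integral>x. indicator E x * w x \<partial>M) \<le> e" if e: "0 < e" for e
  proof -
    have iw: "integrable M w" by (rule integrable_bounded[where B = 1]) (use w in auto)
    obtain H where H: "H holomorphic_on UNIV" and He: "(\<integral>z. \<bar>w z - Re (H z)\<bar> \<partial>M) \<le> e / 2"
      using entire_Re_dense[OF iw, of "e / 2"] e by auto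
    have [measurable]: "H \<in> borel_measurable borel" by (rule entire_measurable[OF H])
    obtain B where B: "\<And>z. cmod z \<le> 1 \<Longrightarrow> cmod (H z) \<le> B" using entire_circle_bounded[OF H] by blast
    have ReB: "\<bar>Re (H z)\<bar> \<le> B" if "cmod z \<le> 1" for z using abs_Re_le_cmod[of "H z"] B[OF that] by simp
    define d where "d = (\<lambda>z. w z - Re (H z))"
    have [measurable]: "d \<in> borel_measurable borel" unfolding d_def by measurable
    have dB: "\<bar>d z\<bar> \<le> 1 + B" if "cmod z = 1" for z using ReB[of z] w[of z] that by (simp add: d_def)
    have intd: "integrable M d" by (rule integrable_bounded[where B = "1 + B"]) (use dB in auto)
    define R where "R = (\<lambda>k x. \<integral>e. poisson e (of_real (r k) * x) * d e \<partial>M)"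
    have [measurable]: "R k \<in> borel_measurable borel" for k unfolding R_def by measurable
    have QR: "Q k x = Re (H (of_real (r k) * x)) + R k x" if x: "cmod x = 1" for k x
    proof -
      have iH: "integrable M (\<lambda>e. poisson e (of_real (r k) * x) * Re (H e))"
        using ReB x by (intro poisson_mult_integrable[of _ B] rx) auto
      have id: "integrable M (\<lambda>e. poisson e (of_real (r k) * x) * d e)"
        using dB x by (intro poisson_mult_integrable[of _ "1 + B"] rx) auto
      have "Q k x = (\<integral>e. poisson e (of_real (r k) * x) * Re (H e) + poisson e (of_real (r k) * x) * d e \<partial>M)"
        unfolding Q_def by (simp add: d_def algebra_simps)
      also have "\<dots> = (\<integral>e. Re (H e) * poisson e (of_real (r k) * x) \<partial>M) + R k x"
        unfolding R_def by (subst Bochner_Integration.integral_add[OF iH id]) (simp add: mult.commute)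
      finally show ?thesis by (simp add: poisson_entire[OF H rx[OF x]])
    qed
    have RB: "\<bar>R k x\<bar> \<le> 1 + B" if x: "cmod x = 1" for k x
      using QR[OF x, of k] Q01[OF x, of k] ReB[of "of_real (r k) * x"] rx[OF x, of k] by (simp add: less_imp_le)
    have intR: "integrable M (\<lambda>x. \<bar>R k x\<bar>)" for k
      by (rule integrable_bounded[where B = "1 + B"]) (use RB in auto)
    have Re2: "(\<integral>x. \<bar>R k x\<bar> \<partial>M) \<le> e / 2" for k
    proof -
      have "ennreal (\<integral>x. \<bar>R k x\<bar> \<partial>M) = (\<integral>\<^sup>+x. ennreal \<bar>R k x\<bar> \<partial>M)"
        using intR by (intro nn_integral_eq_integral[symmetric]) auto
      also have "\<dots> \<le> ennreal (\<integral>z. \<bar>d z\<bar> \<partial>M)"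
        unfolding R_def using r(1,2)[of k] dB by (intro poisson_L1_contraction[of _ "1 + B"]) (auto simp: less_imp_le)
      finally have "(\<integral>x. \<bar>R k x\<bar> \<partial>M) \<le> (\<integral>z. \<bar>d z\<bar> \<partial>M)" by (simp add: ennreal_le_iff)
      then show ?thesis using He by (simp add: d_def)
    qed
    \<comment> \<open>On \<open>E\<close> one has w = d + (Re H(x) - Re H(r x)) + Q - R. The terms
      \<open>d\<close> and \<open>R\<close> are small in L1, uniformly in \<open>k\<close>;
      \<open>S\<close> collects the other two and tends to 0 boundedly.\<close>
    define S where "S = (\<lambda>k x. indicator E x * (\<bar>Re (H x) - Re (H (of_real (r k) * x))\<bar> + Q k x))"
    have [measurable]: "S k \<in> borel_measurable borel" for k unfolding S_def by measurable
    have SB: "\<bar>S k x\<bar> \<le> 2 * B + 1" if x: "cmod x = 1" for k x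
      using ReB[of x] ReB[of "of_real (r k) * x"] rx[OF x, of k] Q01[OF x, of k] x by (auto simp: S_def indicator_def)
    have intS: "integrable M (S k)" for k by (rule integrable_bounded[where B = "2 * B + 1"]) (use SB in auto)
    have S0: "(\<lambda>k. \<integral>x. S k x \<partial>M) \<longlonglongrightarrow> (\<integral>x. 0 \<partial>M)"
    proof (rule dominated_convergence_circle)
      show "AE x in M. (\<lambda>k. S k x) \<longlonglongrightarrow> 0"
        using AE_norm lim
      proof eventually_elim
        case (elim x)
        show ?case
        proof (cases "x \<in> E")
          case True
          have "(\<lambda>k. \<bar>Re (H x) - Re (H (of_real (r k) * x))\<bar> + Q k x) \<longlonglongrightarrow> \<bar>Re (H x) - Re (H x)\<bar> + 0"
            unfolding Q_def using elim True by (intro tendsto_intros entire_radial_tendsto[OF H r(3)]) auto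
          then show ?thesis using True by (simp add: S_def)
        qed (simp add: S_def)
      qed
      show "norm (S k x) \<le> 2 * B + 1" if "cmod x = 1" for k x using SB[OF that] by simp
    qed measurable
    have le: "(\<integral>x. indicator E x * w x \<partial>M) \<le> e + (\<integral>x. S k x \<partial>M)" for k
    proof -
      have "(\<integral>x. indicator E x * w x \<partial>M) \<le> (\<integral>x. (\<bar>d x\<bar> + \<bar>R k x\<bar>) + S k x \<partial>M)"
      proof (rule integral_mono_circle)
        show "indicator E x * w x \<le> (\<bar>d x\<bar> + \<bar>R k x\<bar>) + S k x" if "cmod x = 1" for x
          using QR[OF that, of k] by (auto simp: S_def d_def indicator_def)
      qed (use intw intd intR intS in auto)
      also have "\<dots> = (\<integral>x. \<bar>d x\<bar> \<partial>M) + (\<integral>x. \<bar>R k x\<bar> \<partial>M) + (\<integral>x. S k x \<partial>M)"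
        using intd intR intS by simp
      also have "\<dots> \<le> e + (\<integral>x. S k x \<partial>M)" using He Re2[of k] by (simp add: d_def)
      finally show ?thesis .
    qed
    have "(\<lambda>k. e + (\<integral>x. S k x \<partial>M)) \<longlonglongrightarrow> e + (\<integral>x. 0 \<partial>M)" by (intro tendsto_intros S0)
    then show ?thesis
      by (intro LIMSEQ_le_const[where X = "\<lambda>k. e + (\<integral>x. S k x \<partial>M)"]) (use le in auto)
  qed
  then have "(\<integral>x. indicator E x * w x \<partial>M) \<le> 0" by (rule field_le_epsilon) simp
  moreover have "0 \<le> (\<integral>x. indicator E x * w x \<partial>M)" using w by (intro integral_nonneg_AE) auto
  ultimately have "(\<integral>x. indicator E x * w x \<partial>M) = 0" by simp
  then have "AE x in M. indicator E x * w x = 0"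
    using integral_nonneg_eq_0_iff_AE[OF intw] w by auto
  then show ?thesis by eventually_elim (auto simp: indicator_def split: if_splits)
qed

end

section \<open>Asymptotics of the Schur iterates on the boundary\<close>

text \<open>On the circle, the Schur iterates satisfy \<open>cnj (f\<^sub>n z) = rev_chain \<alpha> n z (cnj (f\<^sub>0 z))\<close>.\<close>

definition rev_chain :: "(nat \<Rightarrow> complex) \<Rightarrow> nat \<Rightarrow> complex \<Rightarrow> complex \<Rightarrow> complex" where
  "rev_chain \<alpha> n z s = mob_chain z (rev (map (\<lambda>k. - cnj (\<alpha> k)) [0..<n])) s"

lemma rev_chain_0: "rev_chain \<alpha> 0 z s = s"
  by (simp add: rev_chain_def)

lemma rev_chain_Suc: "rev_chain \<alpha> (Suc n) z s = z * disk_aut (- cnj (\<alpha> n)) (rev_chain \<alpha> n z s)"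
  by (simp add: rev_chain_def)

lemma rev_chain_measurable [measurable]:
  assumes [measurable]: "f \<in> borel_measurable M" "g \<in> borel_measurable M"
  shows "(\<lambda>z. rev_chain \<alpha> n (f z) (g z)) \<in> borel_measurable M"
  unfolding rev_chain_def by measurable

lemma rev_chain_norm_le:
  assumes "\<And>n. cmod (\<alpha> n) < 1" "cmod z \<le> 1" "cmod s \<le> 1"
  shows "cmod (rev_chain \<alpha> n z s) \<le> 1"
  unfolding rev_chain_def using assms by (intro mob_chain_norm_le) auto

text \<open>Reversal puts the latest coefficient outermost, so inside the disc the start
  \<open>s\<close> and all coefficients before index n - L contribute only the contraction
  error.\<close>

lemma rev_chain_head:
  assumes \<alpha>: "\<And>n. cmod (\<alpha> n) < 1" and z: "cmod z < 1" and s: "cmod s \<le> 1" and L: "L \<le> n"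
  shows "cmod (rev_chain \<alpha> n z s - mob_chain z (map (\<lambda>i. - cnj (\<alpha> (n - Suc i))) [0..<L]) 0)
    \<le> 2 * (2 * cmod z / (1 + (cmod z)\<^sup>2)) ^ L"
proof -
  define as where "as = rev (map (\<lambda>k. - cnj (\<alpha> k)) [0..<n])"
  have "take L as = map (\<lambda>i. - cnj (\<alpha> (n - Suc i))) [0..<L]"
    using L by (intro nth_equalityI) (auto simp: as_def rev_nth)
  then have split: "as = map (\<lambda>i. - cnj (\<alpha> (n - Suc i))) [0..<L] @ drop L as"
    using append_take_drop_id[of L as] by simp
  have "cmod (mob_chain z (drop L as) s) \<le> 1"
    using z s \<alpha> by (intro mob_chain_norm_le) (auto simp: as_def dest!: in_set_dropD)
  moreover have "rev_chain \<alpha> n z s = mob_chain z (map (\<lambda>i. - cnj (\<alpha> (n - Suc i))) [0..<L]) (mob_chain z (drop L as) s)"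
    unfolding rev_chain_def as_def[symmetric] by (subst split) simp
  moreover have "cmod a < 1" if "a \<in> set (map (\<lambda>i. - cnj (\<alpha> (n - Suc i))) [0..<L])" for a
    using that \<alpha> by auto
  ultimately show ?thesis
    using mob_chain_contraction[of z "map (\<lambda>i. - cnj (\<alpha> (n - Suc i))) [0..<L]" "mob_chain z (drop L as) s" 0] z by simp
qed

text \<open>The window length \<open>L\<close> is fixed first, so that the two truncation errors of
  \<open>2 * k ^ L\<close> are together below \<open>e\<close>; only then are the \<open>L\<close>
  remaining coefficients compared as \<open>j\<close> grows. The two starting values may
  differ.\<close>

lemma rev_chain_diff_tendsto:
  assumes \<alpha>: "\<And>n. cmod (\<alpha> n) < 1" and \<alpha>': "\<And>n. cmod (\<alpha>' n) < 1"
    and n: "filterlim n at_top sequentially"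
    and d: "\<And>i. (\<lambda>j. \<alpha> (n j - Suc i) - \<alpha>' (n j - Suc i)) \<longlonglongrightarrow> 0"
    and z: "cmod z < 1" and s: "cmod s \<le> 1" "cmod s' \<le> 1"
  shows "(\<lambda>j. rev_chain \<alpha> (n j) z s - rev_chain \<alpha>' (n j) z s') \<longlonglongrightarrow> 0"
proof (rule tendsto_zero_approx)
  fix e :: real assume e: "0 < e"
  define k where "k = 2 * cmod z / (1 + (cmod z)\<^sup>2)"
  have "(\<lambda>L. 4 * k ^ L) \<longlonglongrightarrow> 0"
    using kappa_less_1[OF z] by (intro tendsto_mult_right_zero LIMSEQ_power_zero) (auto simp: k_def)
  then have "eventually (\<lambda>L. 4 * k ^ L < e) sequentially" using e by (rule order_tendstoD)
  then obtain L where L: "4 * k ^ L < e" by (auto simp: eventually_sequentially)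
  define a where "a = (\<lambda>j i. - cnj (\<alpha> (n j - Suc i)))"
  define b where "b = (\<lambda>j i. - cnj (\<alpha>' (n j - Suc i)))"
  define Y where "Y = (\<lambda>j. mob_chain z (map (a j) [0..<L]) 0 - mob_chain z (map (b j) [0..<L]) 0)"
  have "(\<lambda>j. a j i - b j i) \<longlonglongrightarrow> 0" for i
  proof -
    have "(\<lambda>j. - cnj (\<alpha> (n j - Suc i) - \<alpha>' (n j - Suc i))) \<longlonglongrightarrow> - cnj 0" by (intro tendsto_intros d)
    then show ?thesis by (simp add: a_def b_def algebra_simps)
  qed
  then have "Y \<longlonglongrightarrow> 0"
    unfolding Y_def using \<alpha> \<alpha>' z by (intro mob_chain_param_tendsto) (auto simp: a_def b_def)
  moreover have "\<forall>\<^sub>F j in sequentially. cmod (rev_chain \<alpha> (n j) z s - rev_chain \<alpha>' (n j) z s') \<le> cmod (Y j) + e"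
    using filterlim_at_top[THEN iffD1, OF n, rule_format, of L]
  proof eventually_elim
    case (elim j)
    have 1: "cmod (rev_chain \<alpha> (n j) z s - mob_chain z (map (a j) [0..<L]) 0) \<le> 2 * k ^ L"
      unfolding a_def k_def by (rule rev_chain_head[OF \<alpha> z s(1) elim])
    have 2: "cmod (rev_chain \<alpha>' (n j) z s' - mob_chain z (map (b j) [0..<L]) 0) \<le> 2 * k ^ L"
      unfolding b_def k_def by (rule rev_chain_head[OF \<alpha>' z s(2) elim])
    have tri: "cmod (x - y) \<le> cmod (p - q) + cmod (x - p) + cmod (y - q)" for x y p q
      by (smt (verit) norm_triangle_sub norm_minus_commute norm_triangle_ineq4 add_diff_cancel diff_add_cancel diff_diff_eq2)
    show ?case using tri[of "rev_chain \<alpha> (n j) z s" "rev_chain \<alpha>' (n j) z s'"] 1 2 L unfolding Y_def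
      by (smt (verit))
  qed
  ultimately show "\<exists>Y. Y \<longlonglongrightarrow> 0 \<and> (\<forall>\<^sub>F j in sequentially. cmod (rev_chain \<alpha> (n j) z s - rev_chain \<alpha>' (n j) z s') \<le> cmod (Y j :: complex) + e)"
    by blast
qed

text \<open>The relation \<open>phyp\<close> becomes a number here because the error has to be
  integrated. Its estimates are applied to pairs in the open disc, where the denominator is
  nonzero.\<close>

definition pdist :: "complex \<Rightarrow> complex \<Rightarrow> real" where
  "pdist a b = cmod (a - b) / cmod (1 - cnj a * b)"

lemma pdist_measurable [measurable]:
  assumes [measurable]: "f \<in> borel_measurable M" "g \<in> borel_measurable M"
  shows "(\<lambda>z. pdist (f z) (g z)) \<in> borel_measurable M"
  unfolding pdist_def by measurable

lemma pdist_nonneg: "0 \<le> pdist a b"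
  by (simp add: pdist_def)

lemma
  assumes "cmod a < 1" "cmod b < 1"
  shows phyp_pdist: "phyp (pdist a b) (cnj a) (cnj b)" and pdist_le_1: "pdist a b \<le> 1"
proof -
  have ne: "cmod (1 - cnj a * b) > 0" using one_minus_cnj_mult_ne[of a b] assms by simp
  have "cmod (cnj a - cnj b) = cmod (a - b)" "cmod (1 - cnj (cnj a) * cnj b) = cmod (1 - cnj a * b)"
    using complex_mod_cnj[of "a - b"] complex_mod_cnj[of "1 - cnj a * b"] by simp_all
  then show "phyp (pdist a b) (cnj a) (cnj b)" using ne unfolding phyp_def pdist_def by simp
  show "pdist a b \<le> 1"
    using phyp_1[of a b] assms ne by (simp add: phyp_def pdist_def divide_le_eq)
qed

text \<open>For |z| = 1 the contraction factor is exactly 1, so the bound is uniform in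
  \<open>n\<close>.\<close>

lemma rev_chain_pdist:
  assumes "\<And>n. cmod (\<alpha> n) < 1" "cmod z = 1" "cmod a < 1" "cmod b < 1"
  shows "cmod (rev_chain \<alpha> n z (cnj a) - rev_chain \<alpha> n z (cnj b)) \<le> 2 * pdist a b"
proof -
  have "phyp (pdist a b * (2 * cmod z / (1 + (cmod z)\<^sup>2)) ^ length (rev (map (\<lambda>k. - cnj (\<alpha> k)) [0..<n])))
      (rev_chain \<alpha> n z (cnj a)) (rev_chain \<alpha> n z (cnj b))"
    unfolding rev_chain_def using assms by (intro phyp_mob_chain phyp_pdist pdist_nonneg) auto
  then have "phyp (pdist a b) (rev_chain \<alpha> n z (cnj a)) (rev_chain \<alpha> n z (cnj b))"
    using assms(2) by simp
  then show ?thesis using assms by (intro phyp_imp_dist rev_chain_norm_le pdist_nonneg) auto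
qed

text \<open>Approximants of finite range with values strictly inside the disc: the values serve as
  constant starting points of chains.\<close>

lemma disc_simple_approx:
  fixes f :: "'a \<Rightarrow> complex"
  assumes [measurable]: "f \<in> borel_measurable M"
  obtains c :: "nat \<Rightarrow> 'a \<Rightarrow> complex" where "\<And>k. simple_function M (c k)" "\<And>k z. cmod (c k z) < 1"
    "\<And>z. z \<in> space M \<Longrightarrow> cmod (f z) < 1 \<Longrightarrow> (\<lambda>k. c k z) \<longlonglongrightarrow> f z"
proof -
  obtain s where s: "\<And>i. simple_function M (s i)" "\<And>x. x \<in> space M \<Longrightarrow> (\<lambda>i. s i x) \<longlonglongrightarrow> f x"
    using borel_measurable_implies_sequence_metric[OF assms, of 0] by blast
  \<comment> \<open>Values outside the disc are reset to 0. If the limit lies inside, the reset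
    eventually no longer occurs.\<close>
  define g where "g = (\<lambda>w :: complex. if cmod w < 1 then w else 0)"
  show ?thesis
  proof (rule that[of "\<lambda>k. g \<circ> s k"])
    show "simple_function M (g \<circ> s k)" for k using s(1) by (rule simple_function_compose)
    show "cmod ((g \<circ> s k) z) < 1" for k z by (simp add: g_def)
    show "(\<lambda>k. (g \<circ> s k) z) \<longlonglongrightarrow> f z" if z: "z \<in> space M" "cmod (f z) < 1" for z
    proof -
      have "eventually (\<lambda>k. cmod (s k z) < 1) sequentially"
        using order_tendstoD(2)[OF tendsto_norm[OF s(2)[OF z(1)]] z(2)] .
      then have "eventually (\<lambda>k. s k z = (g \<circ> s k) z) sequentially"
        by eventually_elim (simp add: g_def)
      then show ?thesis using s(2)[OF z(1)] by (rule Lim_transform_eventually[rotated])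
    qed
  qed
qed

section \<open>Boundary values of Schur functions and the spectral density\<close>

context circle_prob
begin

text \<open>The radii belong to the data, since they are extracted for one sequence
  \<open>\<alpha>\<close>; two sequences may have different radii. The recursion and the bound are
  required at all points of the circle, only the radial limit almost everywhere.\<close>

definition schur_boundary :: "(nat \<Rightarrow> complex) \<Rightarrow> (nat \<Rightarrow> real) \<Rightarrow> (nat \<Rightarrow> complex \<Rightarrow> complex) \<Rightarrow> bool" where
  "schur_boundary \<alpha> r \<phi> \<longleftrightarrow> (\<forall>n. cmod (\<alpha> n) < 1) \<and> (\<forall>k. 0 < r k \<and> r k < 1) \<and> r \<longlonglongrightarrow> 1 \<and>
    (\<forall>n. \<phi> n \<in> borel_measurable borel) \<and> (\<forall>n z. cmod z = 1 \<longrightarrow> cmod (\<phi> n z) \<le> 1) \<and>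
    (\<forall>n z. \<phi> (Suc n) z = cnj z * disk_aut (- \<alpha> n) (\<phi> n z)) \<and>
    (AE z in M. \<forall>n. (\<lambda>k. schur_fun \<alpha> n (of_real (r k) * z)) \<longlonglongrightarrow> \<phi> n z)"

text \<open>Radii are extracted for the function of index 0 alone. The inverse Schur step is
  continuous on the closed disc because |\<alpha> n| < 1, so convergence at a point passes to every
  later index along the same radii.\<close>

lemma ex_schur_boundary:
  assumes \<alpha>: "\<And>n. cmod (\<alpha> n) < 1"
  shows "\<exists>r \<phi>. schur_boundary \<alpha> r \<phi>"
proof -
  obtain r where r: "\<And>k. 0 < r k" "\<And>k. r k < 1" "r \<longlonglongrightarrow> 1"
    and conv: "AE z in M. convergent (\<lambda>k. schur_fun \<alpha> 0 (of_real (r k) * z))"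
    using ex_boundary_values[where H = "schur_fun \<alpha> 0", OF schur_fun_holomorphic schur_fun_measurable schur_fun_norm_le] \<alpha> by blast
  define l where "l = (\<lambda>z. lim (\<lambda>k. schur_fun \<alpha> 0 (of_real (r k) * z)))"
  have [measurable]: "l \<in> borel_measurable borel" unfolding l_def by measurable
  \<comment> \<open>Where the limit is not in the closed disc, which happens only on a null set, the
    value 0 is substituted so that the bound holds everywhere on the circle.\<close>
  define \<phi> where "\<phi> = rec_nat (\<lambda>z. if cmod (l z) \<le> 1 then l z else 0) (\<lambda>n f z. cnj z * disk_aut (- \<alpha> n) (f z))"
  have \<phi>0: "\<phi> 0 = (\<lambda>z. if cmod (l z) \<le> 1 then l z else 0)" by (simp add: \<phi>_def)
  have \<phi>S: "\<phi> (Suc n) z = cnj z * disk_aut (- \<alpha> n) (\<phi> n z)" for n z by (simp add: \<phi>_def)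
  have meas: "\<phi> n \<in> borel_measurable borel" for n
  proof (induction n)
    case 0
    show ?case unfolding \<phi>0 by measurable
  next
    case (Suc n)
    note [measurable] = Suc
    have "\<phi> (Suc n) = (\<lambda>z. cnj z * disk_aut (- \<alpha> n) (\<phi> n z))" by (rule ext) (rule \<phi>S)
    then show ?case by simp
  qed
  have le: "cmod (\<phi> n z) \<le> 1" if z: "cmod z = 1" for n z
  proof (induction n)
    case (Suc n)
    have "cmod (disk_aut (- \<alpha> n) (\<phi> n z)) \<le> 1" using \<alpha>[of n] Suc by (intro disk_aut_norm_le) auto
    then show ?case using z by (simp add: \<phi>S norm_mult)
  qed (simp add: \<phi>0)
  have "AE z in M. \<forall>n. (\<lambda>k. schur_fun \<alpha> n (of_real (r k) * z)) \<longlonglongrightarrow> \<phi> n z"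
    using conv AE_norm
  proof eventually_elim
    case (elim z)
    have rz: "cmod (of_real (r k) * z) < 1" "of_real (r k) * z \<noteq> 0" for k
      using r(1,2)[of k] elim(2) by (auto simp: norm_mult)
    have lz: "(\<lambda>k. schur_fun \<alpha> 0 (of_real (r k) * z)) \<longlonglongrightarrow> l z"
      using elim(1) unfolding l_def by (simp add: convergent_LIMSEQ_iff)
    have "cmod (l z) \<le> 1"
      by (rule tendsto_upperbound[OF tendsto_norm[OF lz]]) (auto intro!: always_eventually schur_fun_norm_le \<alpha> rz)
    have "(\<lambda>k. schur_fun \<alpha> n (of_real (r k) * z)) \<longlonglongrightarrow> \<phi> n z" for n
    proof (induction n)
      case 0
      then show ?case using lz \<open>cmod (l z) \<le> 1\<close> by (simp add: \<phi>0)
    next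
      case (Suc n)
      have zz: "z \<noteq> 0" "cnj z = 1 / z"
        using elim(2) complex_norm_square[of z] by (auto simp: eq_divide_eq mult.commute)
      have "1 + cnj (- \<alpha> n) * \<phi> n z \<noteq> 0" using \<alpha>[of n] le[OF elim(2)] by (intro disk_aut_denom_ne) auto
      then have "(\<lambda>k. disk_aut (- \<alpha> n) (schur_fun \<alpha> n (of_real (r k) * z)) / (of_real (r k) * z))
          \<longlonglongrightarrow> disk_aut (- \<alpha> n) (\<phi> n z) / (of_real 1 * z)"
        unfolding disk_aut_def using zz by (intro tendsto_intros Suc r) auto
      then show ?case
        unfolding schur_fun_next[OF \<alpha> rz] \<phi>S by (simp add: zz)
    qed
    then show ?case by blast
  qed
  then have "schur_boundary \<alpha> r \<phi>" unfolding schur_boundary_def using \<alpha> r meas le \<phi>S by blast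
  then show ?thesis by blast
qed

context
  fixes \<alpha> r \<phi>
  assumes sb: "schur_boundary \<alpha> r \<phi>"
begin

lemma
  shows sb_\<alpha>: "cmod (\<alpha> n) < 1" and sb_r: "0 < r k" "r k < 1" "r \<longlonglongrightarrow> 1"
    and sb_measurable: "\<phi> n \<in> borel_measurable borel"
    and sb_norm_le: "cmod z = 1 \<Longrightarrow> cmod (\<phi> n z) \<le> 1"
    and sb_Suc: "\<phi> (Suc n) z = cnj z * disk_aut (- \<alpha> n) (\<phi> n z)"
    and sb_tendsto: "AE z in M. \<forall>n. (\<lambda>k. schur_fun \<alpha> n (of_real (r k) * z)) \<longlonglongrightarrow> \<phi> n z"
  using sb unfolding schur_boundary_def by blast+

lemma sb_rev_chain: "cnj (\<phi> n z) = rev_chain \<alpha> n z (cnj (\<phi> 0 z))"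
  by (induction n) (simp_all add: rev_chain_0 rev_chain_Suc sb_Suc cnj_disk_aut)

lemma sb_rev_chain_approx:
  assumes "cmod z = 1" "cmod (\<phi> 0 z) < 1" "cmod c < 1"
  shows "cmod (\<phi> n z - cnj (rev_chain \<alpha> n z (cnj c))) \<le> 2 * pdist (\<phi> 0 z) c"
proof -
  have "cmod (\<phi> n z - cnj (rev_chain \<alpha> n z (cnj c))) = cmod (cnj (\<phi> n z) - rev_chain \<alpha> n z (cnj c))"
    using complex_mod_cnj[of "\<phi> n z - cnj (rev_chain \<alpha> n z (cnj c))"] by simp
  then show ?thesis
    unfolding sb_rev_chain[of n] using rev_chain_pdist[OF sb_\<alpha> assms] by simp
qed

lemma sb_disc: "cmod z = 1 \<Longrightarrow> cmod (of_real (r k) * z) < 1"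
  using sb_r(1,2)[of k] by (simp add: norm_mult)

text \<open>The mean value property recovers \<open>\<alpha> n\<close> as the value at 0 of the
  Schur function; the entire factor \<open>G\<close> is the test function with which the boundary
  integral can be localised.\<close>

lemma sb_integral:
  assumes G: "G holomorphic_on UNIV"
  shows "(\<integral>z. \<phi> n z * G z \<partial>M) = \<alpha> n * G 0"
proof -
  note [measurable] = sb_measurable entire_measurable[OF G]
  obtain B where B: "\<And>z. cmod z \<le> 1 \<Longrightarrow> cmod (G z) \<le> B" using entire_circle_bounded[OF G] by blast
  have "(\<integral>z. schur_fun \<alpha> n (of_real (r k) * z) * G (of_real (r k) * z) \<partial>M) = \<alpha> n * G 0" for k
  proof -
    have "(\<lambda>z. schur_fun \<alpha> n z * G z) holomorphic_on ball 0 1"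
      using G by (intro holomorphic_intros schur_fun_holomorphic sb_\<alpha>) (auto intro: holomorphic_on_subset)
    from mean_value[OF this _, of "r k"] show ?thesis
      using sb_r(1,2)[of k] schur_fun_0[OF sb_\<alpha>] by simp
  qed
  moreover have "(\<lambda>k. \<integral>z. schur_fun \<alpha> n (of_real (r k) * z) * G (of_real (r k) * z) \<partial>M) \<longlonglongrightarrow> (\<integral>z. \<phi> n z * G z \<partial>M)"
  proof (rule dominated_convergence_circle)
    show "AE z in M. (\<lambda>k. schur_fun \<alpha> n (of_real (r k) * z) * G (of_real (r k) * z)) \<longlonglongrightarrow> \<phi> n z * G z"
      using sb_tendsto by eventually_elim (intro tendsto_mult entire_radial_tendsto[OF G sb_r(3)], blast)
    show "norm (schur_fun \<alpha> n (of_real (r k) * z) * G (of_real (r k) * z)) \<le> 1 * B" if "cmod z = 1" for k z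
      unfolding norm_mult using sb_disc[OF that, of k] by (intro mult_mono schur_fun_norm_le[OF sb_\<alpha>] B) auto
  qed measurable
  ultimately show ?thesis by (simp add: LIMSEQ_const_iff)
qed

text \<open>\<open>1 - z f\<close> has value \<open>1\<close> at \<open>0\<close>, so its boundary function cannot vanish on a set of positive measure.\<close>

lemma sb_ne_one: "AE z in M. z * \<phi> 0 z \<noteq> 1"
proof -
  note [measurable] = sb_measurable
  define A where "A = {z. z * \<phi> 0 z = 1}"
  have [measurable]: "A \<in> sets borel" unfolding A_def by measurable
  have "measure M A = 0"
  proof (rule ccontr)
    assume "measure M A \<noteq> 0"
    then have "0 < measure M A" using measure_nonneg[of M A] by linarith
    then obtain G where G: "G holomorphic_on UNIV" "G 0 = 1" and small: "(\<integral>z. indicator (- A) z * cmod (G z) \<partial>M) \<le> 1/4"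
      using concentrating_function[of A "1/4"] by auto
    note [measurable] = entire_measurable[OF G(1)]
    obtain B where B: "\<And>z. cmod z \<le> 1 \<Longrightarrow> cmod (G z) \<le> B" using entire_circle_bounded[OF G(1)] by blast
    have iG: "integrable M G" by (rule entire_integrable[OF G(1)])
    have i2: "integrable M (\<lambda>z. \<phi> 0 z * (z * G z))"
    proof (rule integrable_bounded[where B = B])
      show "norm (\<phi> 0 z * (z * G z)) \<le> B" if z: "cmod z = 1" for z
        using mult_mono[OF sb_norm_le[OF z, of 0] B[of z]] z by (simp add: norm_mult)
    qed measurable
    have i3: "integrable M (\<lambda>z. indicator (- A) z * cmod (G z))"
      by (rule integrable_bounded[where B = B]) (use B order_trans[OF norm_ge_zero B[of 0]] in \<open>auto simp: indicator_def\<close>)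
    have "(\<integral>z. \<phi> 0 z * (z * G z) \<partial>M) = \<alpha> 0 * (0 * G 0)"
      by (rule sb_integral) (intro holomorphic_intros G)
    moreover have "(\<integral>z. G (of_real 1 * z) \<partial>M) = G 0"
      by (rule mean_value[where R = 2]) (use G holomorphic_on_subset in auto)
    \<comment> \<open>The integrand is (1 - z f) G, with value 1 at 0. Its first factor vanishes on
      \<open>A\<close> and is at most 2 elsewhere, so the mean modulus is at most 2 * 1/4, a
      contradiction.\<close>
    ultimately have "(\<integral>z. G z - \<phi> 0 z * (z * G z) \<partial>M) = 1" using iG i2 G(2) by simp
    then have "1 \<le> (\<integral>z. cmod (G z - \<phi> 0 z * (z * G z)) \<partial>M)"
      using integral_norm_bound[of M "\<lambda>z. G z - \<phi> 0 z * (z * G z)"] by simp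
    also have "\<dots> \<le> (\<integral>z. 2 * (indicator (- A) z * cmod (G z)) \<partial>M)"
    proof (rule integral_mono_circle)
      show "cmod (G z - \<phi> 0 z * (z * G z)) \<le> 2 * (indicator (- A) z * cmod (G z))" if elim: "cmod z = 1" for z
      proof -
        have eq: "G z - \<phi> 0 z * (z * G z) = (1 - z * \<phi> 0 z) * G z" by (simp add: algebra_simps)
        show ?thesis
        proof (cases "z \<in> A")
          case False
          have "cmod (z * \<phi> 0 z) \<le> 1" using sb_norm_le[OF elim, of 0] elim by (simp add: norm_mult)
          then have "cmod (1 - z * \<phi> 0 z) \<le> 2" using norm_triangle_ineq4[of 1 "z * \<phi> 0 z"] by simp
          then have "cmod (1 - z * \<phi> 0 z) * cmod (G z) \<le> 2 * cmod (G z)" by (intro mult_right_mono) auto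
          then show ?thesis using False by (simp add: eq norm_mult)
        qed (simp add: eq A_def)
      qed
    qed (use iG i2 i3 in auto)
    also have "\<dots> \<le> 1 / 2" using small by simp
    finally show False by simp
  qed
  then have "AE z in M. z \<notin> A" by (intro AE_not_in) (auto simp: null_sets_def emeasure_eq_measure)
  then show ?thesis by eventually_elim (simp add: A_def)
qed

text \<open>The Poisson integral of \<open>min W 1\<close> is dominated by that of \<open>\<mu>\<close>, which is
  \<open>(1 - |z f|\<^sup>2) / |1 - z f|\<^sup>2\<close>; this tends to \<open>0\<close> where the boundary values of \<open>f\<close> are unimodular.\<close>

lemma density_pos_imp_less_one:
  assumes sp: "is_spectral_measure (cmv \<alpha>) \<mu>"
    and [measurable]: "W \<in> borel_measurable borel" and W0: "\<And>z. 0 \<le> W z"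
    and dom: "\<And>A. A \<in> sets borel \<Longrightarrow> (\<integral>\<^sup>+z\<in>A. ennreal (W z) \<partial>M) \<le> emeasure \<mu> A"
  shows "AE z in M. 0 < W z \<longrightarrow> cmod (\<phi> 0 z) < 1"
proof -
  note [measurable] = sb_measurable
  have sets_\<mu> [measurable_cong]: "sets \<mu> = sets borel" using sp by (simp add: is_spectral_measure_def)
  \<comment> \<open>The truncation makes the density bounded, as \<open>poisson_limit_zero\<close>
    requires, and preserves the set where it is positive.\<close>
  define w where "w = (\<lambda>z. min (W z) 1)"
  have [measurable]: "w \<in> borel_measurable borel" unfolding w_def by measurable
  have w: "0 \<le> w z" "w z \<le> 1" for z using W0 by (auto simp: w_def)
  \<comment> \<open>Points with z f = 1 are left out because the denominator of the Poisson quotient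
    tends to 0 there; they form a null set by \<open>sb_ne_one\<close>.\<close>
  define E where "E = {z. \<not> cmod (\<phi> 0 z) < 1 \<and> z * \<phi> 0 z \<noteq> 1}"
  have [measurable]: "E \<in> sets borel" unfolding E_def by measurable
  have le: "density M (\<lambda>z. ennreal (w z)) \<le> \<mu>"
  proof (subst le_measure)
    show "sets (density M (\<lambda>z. ennreal (w z))) = sets \<mu>" by (simp add: sets_eq sets_\<mu>)
    show "\<forall>A\<in>sets (density M (\<lambda>z. ennreal (w z))). emeasure (density M (\<lambda>z. ennreal (w z))) A \<le> emeasure \<mu> A"
    proof
      fix A assume "A \<in> sets (density M (\<lambda>z. ennreal (w z)))"
      then have [measurable]: "A \<in> sets borel" by (simp add: sets_eq)
      have "emeasure (density M (\<lambda>z. ennreal (w z))) A = (\<integral>\<^sup>+z\<in>A. ennreal (w z) \<partial>M)"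
        by (rule emeasure_density) (auto simp: sets_eq)
      also have "\<dots> \<le> (\<integral>\<^sup>+z\<in>A. ennreal (W z) \<partial>M)"
        by (intro nn_integral_mono mult_right_mono ennreal_leI) (auto simp: w_def)
      also have "\<dots> \<le> emeasure \<mu> A" by (rule dom) measurable
      finally show "emeasure (density M (\<lambda>z. ennreal (w z))) A \<le> emeasure \<mu> A" .
    qed
  qed
  define y where "y = (\<lambda>k z. of_real (r k) * z * schur_fun \<alpha> 0 (of_real (r k) * z))"
  define u where "u = (\<lambda>k z. (1 - (cmod (y k z))\<^sup>2) / (cmod (1 - y k z))\<^sup>2)"
  have u: "0 \<le> (\<integral>e. poisson e (of_real (r k) * z) * w e \<partial>M) \<and> (\<integral>e. poisson e (of_real (r k) * z) * w e \<partial>M) \<le> u k z"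
    if z: "cmod z = 1" for k z
  proof -
    define a where "a = of_real (r k) * z"
    have a: "cmod a < 1" "a \<noteq> 0" using sb_r(1,2)[of k] z by (auto simp: a_def norm_mult)
    have pw0: "0 \<le> poisson e a * w e" for e using poisson_nonneg[OF a(1)] w by simp
    have int: "integrable M (\<lambda>e. poisson e a * w e)"
      using w by (intro poisson_mult_integrable[of _ 1] a(1)) auto
    have "ennreal (\<integral>e. poisson e a * w e \<partial>M) = (\<integral>\<^sup>+e. ennreal (poisson e a * w e) \<partial>M)"
      using int pw0 by (intro nn_integral_eq_integral[symmetric]) auto
    also have "\<dots> = (\<integral>\<^sup>+e. ennreal (w e) * ennreal (poisson e a) \<partial>M)"
      using w poisson_nonneg[OF a(1)] by (simp add: ennreal_mult mult.commute)
    also have "\<dots> = (\<integral>\<^sup>+e. ennreal (poisson e a) \<partial>density M (\<lambda>z. ennreal (w z)))"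
      by (rule nn_integral_density[symmetric]) measurable
    also have "\<dots> \<le> (\<integral>\<^sup>+e. ennreal (poisson e a) \<partial>\<mu>)"
      by (rule nn_integral_mono_measure[OF _ le]) (simp add: sets_eq sets_\<mu>)
    also have "\<dots> = ennreal (u k z)"
      unfolding poisson_def spectral_measure_poisson[OF sb_\<alpha> sp a] by (simp add: u_def y_def a_def)
    finally have "ennreal (\<integral>e. poisson e a * w e \<partial>M) \<le> ennreal (u k z)" .
    moreover have "0 \<le> u k z"
    proof -
      have "cmod (y k z) \<le> 1"
        unfolding y_def a_def[symmetric] norm_mult using a schur_fun_norm_le[OF sb_\<alpha> a(1)] by (intro mult_le_one) auto
      then show ?thesis by (simp add: u_def power_le_one)
    qed
    moreover have "0 \<le> (\<integral>e. poisson e a * w e \<partial>M)" using pw0 by (intro integral_nonneg_AE) auto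
    ultimately show ?thesis by (simp add: a_def ennreal_le_iff)
  qed
  have "AE x in M. x \<in> E \<longrightarrow> (\<lambda>k. \<integral>e. poisson e (of_real (r k) * x) * w e \<partial>M) \<longlonglongrightarrow> 0"
    using AE_norm sb_tendsto
  proof eventually_elim
    case (elim x)
    show ?case
    proof
      assume x: "x \<in> E"
      have one: "cmod (x * \<phi> 0 x) = 1" using x sb_norm_le[OF elim(1), of 0] elim(1) by (simp add: E_def norm_mult)
      have "(\<lambda>k. y k x) \<longlonglongrightarrow> of_real 1 * x * \<phi> 0 x"
        unfolding y_def using elim(2) by (intro tendsto_intros sb_r) auto
      then have yl: "(\<lambda>k. y k x) \<longlonglongrightarrow> x * \<phi> 0 x" by simp
      have "(\<lambda>k. u k x) \<longlonglongrightarrow> (1 - (cmod (x * \<phi> 0 x))\<^sup>2) / (cmod (1 - x * \<phi> 0 x))\<^sup>2"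
        unfolding u_def using x by (intro tendsto_intros yl) (auto simp: E_def)
      then have "(\<lambda>k. u k x) \<longlonglongrightarrow> 0" by (simp add: one)
      then show "(\<lambda>k. \<integral>e. poisson e (of_real (r k) * x) * w e \<partial>M) \<longlonglongrightarrow> 0"
        by (rule tendsto_sandwich[OF _ _ tendsto_const, rotated 2]) (use u[OF elim(1)] in auto)
    qed
  qed
  then have "AE x in M. x \<in> E \<longrightarrow> w x = 0"
    by (intro poisson_limit_zero[where r = r] w sb_r) auto
  then show ?thesis
    using sb_ne_one
  proof eventually_elim
    case (elim x)
    then show ?case by (auto simp: E_def w_def min_def split: if_splits)
  qed
qed

end

text \<open>On \<open>A\<close> the two initial functions are replaced by simple functions, with an
  error in \<open>pdist\<close> that is small in the mean and does not grow with \<open>j\<close>.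
  On each common level set the comparison functions are analytic in z, and their difference tends
  weakly to 0.\<close>

lemma boundary_weakly_equal:
  assumes sb: "schur_boundary \<alpha> r \<phi>" and sb': "schur_boundary \<alpha>' r' \<phi>'"
    and n: "filterlim n at_top sequentially"
    and d: "\<And>i. (\<lambda>j. \<alpha> (n j - Suc i) - \<alpha>' (n j - Suc i)) \<longlonglongrightarrow> 0"
    and [measurable]: "A \<in> sets borel" and A: "\<And>z. z \<in> A \<Longrightarrow> cmod (\<phi> 0 z) < 1 \<and> cmod (\<phi>' 0 z) < 1"
    and [measurable]: "v \<in> borel_measurable borel" and v: "\<And>z. cmod z = 1 \<Longrightarrow> cmod (v z) \<le> B" and B: "0 < B"
  shows "(\<lambda>j. \<integral>z. indicator A z * (\<phi> (n j) z - \<phi>' (n j) z) * v z \<partial>M) \<longlonglongrightarrow> 0"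
proof (rule tendsto_zero_approx)
  fix e :: real assume e: "0 < e"
  note [measurable] = sb_measurable[OF sb] sb_measurable[OF sb']
  note \<alpha> = sb_\<alpha>[OF sb] and \<alpha>' = sb_\<alpha>[OF sb']
  obtain cs where cs: "\<And>k. simple_function M (cs k)" "\<And>k z. cmod (cs k z) < 1"
    "\<And>z. z \<in> space M \<Longrightarrow> cmod (\<phi> 0 z) < 1 \<Longrightarrow> (\<lambda>k. cs k z) \<longlonglongrightarrow> \<phi> 0 z"
    using disc_simple_approx[of "\<phi> 0" M] by auto
  obtain cs' where cs': "\<And>k. simple_function M (cs' k)" "\<And>k z. cmod (cs' k z) < 1"
    "\<And>z. z \<in> space M \<Longrightarrow> cmod (\<phi>' 0 z) < 1 \<Longrightarrow> (\<lambda>k. cs' k z) \<longlonglongrightarrow> \<phi>' 0 z"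
    using disc_simple_approx[of "\<phi>' 0" M] by auto
  have meas: "cs k \<in> borel_measurable borel" "cs' k \<in> borel_measurable borel" for k
    using borel_measurable_simple_function[OF cs(1), of k] borel_measurable_simple_function[OF cs'(1), of k]
    by (simp_all cong: measurable_cong_sets add: sets_eq)
  note [measurable] = meas
  \<comment> \<open>The mean of \<open>D\<close> tends to 0 by dominated convergence, since
    \<open>pdist\<close> is at most 1; the pairs lie in the open disc on \<open>A\<close>.\<close>
  define D where "D = (\<lambda>k z. indicator A z * (pdist (\<phi> 0 z) (cs k z) + pdist (\<phi>' 0 z) (cs' k z)))"
  have [measurable]: "D k \<in> borel_measurable borel" for k unfolding D_def by measurable
  have D2: "0 \<le> D k z \<and> D k z \<le> 2" for k z
    using pdist_le_1[of "\<phi> 0 z" "cs k z"] pdist_le_1[of "\<phi>' 0 z" "cs' k z"] A[of z] cs(2)[of k z] cs'(2)[of k z]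
    by (auto simp: D_def indicator_def pdist_nonneg)
  have "(\<lambda>k. \<integral>z. D k z \<partial>M) \<longlonglongrightarrow> (\<integral>z. 0 \<partial>M)"
  proof (rule dominated_convergence_circle[where B = 2])
    show "AE z in M. (\<lambda>k. D k z) \<longlonglongrightarrow> 0"
    proof (rule AE_I2)
      fix z
      show "(\<lambda>k. D k z) \<longlonglongrightarrow> 0"
      proof (cases "z \<in> A")
        case True
        have ne: "cmod (1 - cnj (\<phi> 0 z) * \<phi> 0 z) \<noteq> 0" "cmod (1 - cnj (\<phi>' 0 z) * \<phi>' 0 z) \<noteq> 0"
          using A[OF True] one_minus_cnj_mult_ne[of "\<phi> 0 z" "\<phi> 0 z"] one_minus_cnj_mult_ne[of "\<phi>' 0 z" "\<phi>' 0 z"] by auto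
        have "(\<lambda>k. pdist (\<phi> 0 z) (cs k z) + pdist (\<phi>' 0 z) (cs' k z)) \<longlonglongrightarrow>
            cmod (\<phi> 0 z - \<phi> 0 z) / cmod (1 - cnj (\<phi> 0 z) * \<phi> 0 z) + cmod (\<phi>' 0 z - \<phi>' 0 z) / cmod (1 - cnj (\<phi>' 0 z) * \<phi>' 0 z)"
          unfolding pdist_def using A[OF True] ne by (intro tendsto_intros cs(3) cs'(3)) auto
        then show ?thesis using True by (simp add: D_def)
      qed (simp add: D_def)
    qed
  qed (use D2 in auto)
  then have "eventually (\<lambda>k. (\<integral>z. D k z \<partial>M) < e / (2 * B)) sequentially"
    using e B by (intro order_tendstoD(2)) auto
  then obtain k where k: "(\<integral>z. D k z \<partial>M) < e / (2 * B)" by (auto simp: eventually_sequentially)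
  define c where "c = cs k" define c' where "c' = cs' k"
  have [measurable]: "c \<in> borel_measurable borel" "c' \<in> borel_measurable borel" by (auto simp: c_def c'_def)
  have c1: "cmod (c z) < 1" "cmod (c' z) < 1" for z using cs(2) cs'(2) by (auto simp: c_def c'_def)
  \<comment> \<open>All pairs of values of \<open>c\<close> and \<open>c'\<close>. Finiteness splits
    the comparison integral into a finite sum in which each pair of constants is fixed and the test
    function \<open>q\<close> is cut off to its level set.\<close>
  define R where "R = range c \<times> range c'"
  have R: "finite R"
    using simple_functionD(1)[OF cs(1), of k] simple_functionD(1)[OF cs'(1), of k] by (simp add: R_def c_def c'_def)
  define K where "K = (\<lambda>p j z. rev_chain \<alpha> (n j) z (cnj (fst p)) - rev_chain \<alpha>' (n j) z (cnj (snd p)))"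
  have [measurable]: "K p j \<in> borel_measurable borel" for p j unfolding K_def by measurable
  define q where "q = (\<lambda>p z. if c z = fst p \<and> c' z = snd p then indicator A z * v z else 0)"
  have [measurable]: "q p \<in> borel_measurable borel" for p unfolding q_def by measurable
  have K2: "cmod (K p j z) \<le> 2" if "p \<in> R" "cmod z \<le> 1" for p j z
  proof -
    have "cmod (fst p) < 1" "cmod (snd p) < 1" using that c1 by (auto simp: R_def)
    then have "cmod (rev_chain \<alpha> (n j) z (cnj (fst p))) \<le> 1" "cmod (rev_chain \<alpha>' (n j) z (cnj (snd p))) \<le> 1"
      using that \<alpha> \<alpha>' by (auto intro!: rev_chain_norm_le)
    then show ?thesis unfolding K_def using norm_triangle_ineq4 by (smt (verit))
  qed
  have qB: "cmod (q p z) \<le> B" if "cmod z = 1" for p z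
    using v[OF that] B by (auto simp: q_def indicator_def)
  define T where "T = (\<lambda>j z. \<Sum>p\<in>R. cnj (K p j z) * q p z)"
  have iKq: "integrable M (\<lambda>z. cnj (K p j z) * q p z)" if p: "p \<in> R" for p j
  proof (rule integrable_bounded[where B = "2 * B"])
    show "norm (cnj (K p j z) * q p z) \<le> 2 * B" if "cmod z = 1" for z
      unfolding norm_mult complex_mod_cnj using K2[OF p] qB that by (intro mult_mono) auto
  qed measurable
  have "(\<lambda>j. \<integral>z. cnj (K p j z) * q p z \<partial>M) \<longlonglongrightarrow> 0" if p: "p \<in> R" for p
  proof -
    have ps: "cmod (cnj (fst p)) \<le> 1" "cmod (cnj (snd p)) \<le> 1" using p c1 by (auto simp: R_def less_imp_le)
    \<comment> \<open>The boundary functions are close to conjugates of chains, whereas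
      \<open>weak_null\<close> concerns analytic functions. Hence the test function is conjugated,
      and the resulting limit is conjugated back.\<close>
    have "(\<lambda>j. \<integral>z. K p j z * cnj (q p z) \<partial>M) \<longlonglongrightarrow> 0"
    proof (rule weak_null)
      show "K p j holomorphic_on ball 0 1" for j
        unfolding K_def rev_chain_def using \<alpha> \<alpha>' ps by (intro holomorphic_on_diff mob_chain_holomorphic) auto
      show "continuous_on (cball 0 1) (K p j)" for j
        unfolding K_def rev_chain_def using \<alpha> \<alpha>' ps by (intro continuous_on_diff mob_chain_continuous_on) auto
      show "(\<lambda>j. K p j z) \<longlonglongrightarrow> 0" if "cmod z < 1" for z
        unfolding K_def by (rule rev_chain_diff_tendsto[OF \<alpha> \<alpha>' n d that ps])
      show "integrable M (\<lambda>z. cnj (q p z))" by (rule integrable_bounded[where B = B]) (use qB in auto)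
    qed (use K2[OF p] in auto)
    then have "(\<lambda>j. cnj (\<integral>z. K p j z * cnj (q p z) \<partial>M)) \<longlonglongrightarrow> cnj 0" by (rule tendsto_cnj)
    moreover have "cnj (\<integral>z. K p j z * cnj (q p z) \<partial>M) = (\<integral>z. cnj (K p j z) * q p z \<partial>M)" for j
      by (subst Bochner_Integration.integral_cnj[symmetric]) simp
    ultimately show ?thesis by simp
  qed
  then have "(\<lambda>j. \<Sum>p\<in>R. \<integral>z. cnj (K p j z) * q p z \<partial>M) \<longlonglongrightarrow> 0" by (rule tendsto_null_sum)
  then have Tlim: "(\<lambda>j. \<integral>z. T j z \<partial>M) \<longlonglongrightarrow> 0"
    unfolding T_def using iKq by (simp add: Bochner_Integration.integral_sum)
  have iT: "integrable M (T j)" for j unfolding T_def using iKq by auto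
  have Teq: "T j z = indicator A z * (cnj (rev_chain \<alpha> (n j) z (cnj (c z))) - cnj (rev_chain \<alpha>' (n j) z (cnj (c' z)))) * v z" for j z
  proof -
    have "T j z = (\<Sum>p\<in>R. if p = (c z, c' z) then cnj (K p j z) * (indicator A z * v z) else 0)"
      unfolding T_def by (intro sum.cong refl) (auto simp: q_def)
    also have "\<dots> = cnj (K (c z, c' z) j z) * (indicator A z * v z)"
      using R by (simp add: sum.delta R_def)
    finally show ?thesis by (simp add: K_def)
  qed
  have iD: "integrable M (D k)" by (rule integrable_bounded[where B = 2]) (use D2 in auto)
  have "cmod (\<integral>z. indicator A z * (\<phi> (n j) z - \<phi>' (n j) z) * v z \<partial>M) \<le> cmod (\<integral>z. T j z \<partial>M) + e" for j
  proof -
    let ?X = "\<lambda>z. indicator A z * (\<phi> (n j) z - \<phi>' (n j) z) * v z"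
    have iX: "integrable M ?X"
    proof (rule integrable_bounded[where B = "2 * B"])
      show "norm (?X z) \<le> 2 * B" if z: "cmod z = 1" for z
      proof -
        have "cmod (\<phi> (n j) z - \<phi>' (n j) z) \<le> 2"
          using norm_triangle_ineq4[of "\<phi> (n j) z" "\<phi>' (n j) z"] sb_norm_le[OF sb z, of "n j"] sb_norm_le[OF sb' z, of "n j"] by simp
        then have "cmod (\<phi> (n j) z - \<phi>' (n j) z) * cmod (v z) \<le> 2 * B" using v[OF z] by (intro mult_mono) auto
        then show ?thesis using B by (auto simp: norm_mult indicator_def)
      qed
    qed measurable
    have pt: "cmod (?X z - T j z) \<le> 2 * B * D k z" if z: "cmod z = 1" for z
    proof (cases "z \<in> A")
      case True
      note 1 = sb_rev_chain_approx[OF sb z conjunct1[OF A[OF True]] c1(1), of "n j" z]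
      note 2 = sb_rev_chain_approx[OF sb' z conjunct2[OF A[OF True]] c1(2), of "n j" z]
      have "?X z - T j z = ((\<phi> (n j) z - cnj (rev_chain \<alpha> (n j) z (cnj (c z)))) - (\<phi>' (n j) z - cnj (rev_chain \<alpha>' (n j) z (cnj (c' z))))) * v z"
        using True by (simp add: Teq algebra_simps)
      also have "cmod \<dots> \<le> (2 * pdist (\<phi> 0 z) (c z) + 2 * pdist (\<phi>' 0 z) (c' z)) * B"
        unfolding norm_mult using 1 2 v[OF z] pdist_nonneg[of "\<phi> 0 z" "c z"] pdist_nonneg[of "\<phi>' 0 z" "c' z"]
        by (intro mult_mono order_trans[OF norm_triangle_ineq4 add_mono]) auto
      also have "\<dots> = 2 * B * D k z" using True by (simp add: D_def c_def c'_def)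
      finally show ?thesis .
    qed (use D2[of k z] B in \<open>simp add: Teq\<close>)
    have "(\<integral>z. ?X z \<partial>M) - (\<integral>z. T j z \<partial>M) = (\<integral>z. ?X z - T j z \<partial>M)" using iX iT by simp
    also have "cmod \<dots> \<le> (\<integral>z. cmod (?X z - T j z) \<partial>M)" by (rule integral_norm_bound)
    also have "\<dots> \<le> (\<integral>z. 2 * B * D k z \<partial>M)"
      using iX iT iD pt by (intro integral_mono_circle) auto
    also have "\<dots> \<le> e" using k B by (simp add: field_simps)
    finally show ?thesis
      using norm_triangle_sub[of "\<integral>z. ?X z \<partial>M" "\<integral>z. T j z \<partial>M"] by linarith
  qed
  then show "\<exists>Y. Y \<longlonglongrightarrow> 0 \<and> (\<forall>\<^sub>F j in sequentially.
      cmod (\<integral>z. indicator A z * (\<phi> (n j) z - \<phi>' (n j) z) * v z \<partial>M) \<le> cmod (Y j :: complex) + e)"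
    using Tlim by (intro exI[of _ "\<lambda>j. \<integral>z. T j z \<partial>M"]) auto
qed

theorem common_disc_set_imp_tendsto:
  assumes sb: "schur_boundary \<alpha> r \<phi>" and sb': "schur_boundary \<alpha>' r' \<phi>'"
    and n: "filterlim n at_top sequentially"
    and d: "\<And>i. (\<lambda>j. \<alpha> (n j - Suc i) - \<alpha>' (n j - Suc i)) \<longlonglongrightarrow> 0"
    and pos: "measure M {z. cmod (\<phi> 0 z) < 1 \<and> cmod (\<phi>' 0 z) < 1} > 0"
  shows "(\<lambda>j. \<alpha> (n j) - \<alpha>' (n j)) \<longlonglongrightarrow> 0"
proof (rule tendsto_zero_approx)
  fix e :: real assume e: "0 < e"
  note [measurable] = sb_measurable[OF sb] sb_measurable[OF sb']
  define A where "A = {z. cmod (\<phi> 0 z) < 1 \<and> cmod (\<phi>' 0 z) < 1}"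
  have [measurable]: "A \<in> sets borel" unfolding A_def by measurable
  obtain G where G: "G holomorphic_on UNIV" "G 0 = 1" and small: "(\<integral>z. indicator (- A) z * cmod (G z) \<partial>M) \<le> e / 2"
    using concentrating_function[of A "e / 2"] pos e by (auto simp: A_def[symmetric])
  note [measurable] = entire_measurable[OF G(1)]
  obtain B0 where B0: "\<And>z. cmod z \<le> 1 \<Longrightarrow> cmod (G z) \<le> B0" using entire_circle_bounded[OF G(1)] by blast
  define B where "B = \<bar>B0\<bar> + 1"
  have B1: "cmod (G z) \<le> B" if "cmod z = 1" for z using B0[of z] that by (auto simp: B_def)
  have B: "0 < B" "\<And>z. cmod z = 1 \<Longrightarrow> cmod (G z) \<le> B" using B1 by (auto simp: B_def)
  define Y where "Y = (\<lambda>j. \<integral>z. indicator A z * (\<phi> (n j) z - \<phi>' (n j) z) * G z \<partial>M)"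
  have "Y \<longlonglongrightarrow> 0"
    unfolding Y_def by (rule boundary_weakly_equal[OF sb sb' n d _ _ _ B(2) B(1)]) (auto simp: A_def)
  moreover have "cmod (\<alpha> (n j) - \<alpha>' (n j)) \<le> cmod (Y j) + e" for j
  proof -
    have le: "cmod (\<phi> (n j) z - \<phi>' (n j) z) * cmod (G z) \<le> 2 * cmod (G z)" if z: "cmod z = 1" for z
      using norm_triangle_ineq4[of "\<phi> (n j) z" "\<phi>' (n j) z"] sb_norm_le[OF sb z, of "n j"] sb_norm_le[OF sb' z, of "n j"]
      by (intro mult_right_mono) auto
    have i1: "integrable M (\<lambda>z. \<phi> (n j) z * G z)" "integrable M (\<lambda>z. \<phi>' (n j) z * G z)"
    proof -
      have "cmod (\<phi> (n j) z) * cmod (G z) \<le> 1 * B \<and> cmod (\<phi>' (n j) z) * cmod (G z) \<le> 1 * B" if z: "cmod z = 1" for z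
        using sb_norm_le[OF sb z] sb_norm_le[OF sb' z] B(2)[OF z] by (intro conjI mult_mono) auto
      then show "integrable M (\<lambda>z. \<phi> (n j) z * G z)" "integrable M (\<lambda>z. \<phi>' (n j) z * G z)"
        by (auto intro!: integrable_bounded[where B = B] simp: norm_mult)
    qed
    have i2: "integrable M (\<lambda>z. indicator S z * (\<phi> (n j) z - \<phi>' (n j) z) * G z)" if [measurable]: "S \<in> sets borel" for S
    proof (rule integrable_bounded[where B = "2 * B"])
      show "norm (indicator S z * (\<phi> (n j) z - \<phi>' (n j) z) * G z) \<le> 2 * B" if "cmod z = 1" for z
        using le[OF that] B(1) B(2)[OF that] by (auto simp: norm_mult indicator_def)
    qed measurable
    have i3: "integrable M (\<lambda>z. indicator (- A) z * cmod (G z))"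
      by (rule integrable_bounded[where B = B]) (use B in \<open>auto simp: indicator_def\<close>)
    \<comment> \<open>Since \<open>G 0 = 1\<close>, the coefficients are the integrals of the
      boundary functions against \<open>G\<close>. The part over \<open>A\<close> is
      \<open>Y j\<close>; the part off \<open>A\<close> is at most 2 times e / 2.\<close>
    have "\<alpha> (n j) - \<alpha>' (n j) = (\<integral>z. \<phi> (n j) z * G z \<partial>M) - (\<integral>z. \<phi>' (n j) z * G z \<partial>M)"
      by (simp add: sb_integral[OF sb G(1)] sb_integral[OF sb' G(1)] G(2))
    also have "\<dots> = (\<integral>z. indicator A z * (\<phi> (n j) z - \<phi>' (n j) z) * G z + indicator (- A) z * (\<phi> (n j) z - \<phi>' (n j) z) * G z \<partial>M)"
      unfolding Bochner_Integration.integral_diff[OF i1, symmetric]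
      by (intro Bochner_Integration.integral_cong) (auto simp: indicator_def algebra_simps)
    also have "\<dots> = Y j + (\<integral>z. indicator (- A) z * (\<phi> (n j) z - \<phi>' (n j) z) * G z \<partial>M)"
      unfolding Y_def by (intro Bochner_Integration.integral_add i2) auto
    finally have eq: "\<alpha> (n j) - \<alpha>' (n j) = Y j + (\<integral>z. indicator (- A) z * (\<phi> (n j) z - \<phi>' (n j) z) * G z \<partial>M)" .
    have "cmod (\<integral>z. indicator (- A) z * (\<phi> (n j) z - \<phi>' (n j) z) * G z \<partial>M) \<le>
        (\<integral>z. cmod (indicator (- A) z * (\<phi> (n j) z - \<phi>' (n j) z) * G z) \<partial>M)"
      by (rule integral_norm_bound)
    also have "\<dots> \<le> (\<integral>z. 2 * (indicator (- A) z * cmod (G z)) \<partial>M)"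
    proof (rule integral_mono_circle)
      show "cmod (indicator (- A) z * (\<phi> (n j) z - \<phi>' (n j) z) * G z) \<le> 2 * (indicator (- A) z * cmod (G z))" if "cmod z = 1" for z
        using le[OF that] by (auto simp: norm_mult indicator_def)
    qed (use i2[of "- A"] i3 in auto)
    also have "\<dots> \<le> e" using small by simp
    finally show ?thesis unfolding eq using norm_triangle_ineq[of "Y j"] by (smt (verit))
  qed
  ultimately show "\<exists>Y. Y \<longlonglongrightarrow> 0 \<and> (\<forall>\<^sub>F j in sequentially. cmod (\<alpha> (n j) - \<alpha>' (n j)) \<le> cmod (Y j :: complex) + e)"
    by (intro exI[of _ Y]) auto
qed

end

section \<open>Normalised Lebesgue measure and the theorem\<close>

lemma Arg2pi_measurable [measurable]: "Arg2pi \<in> borel_measurable borel"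
  by (rule borel_measurableI_greater) (simp add: borel_open open_Arg2pi2pi_gt)

lemma Arg2pi_cis: "0 \<le> \<theta> \<Longrightarrow> \<theta> < 2 * pi \<Longrightarrow> Arg2pi (cis \<theta>) = \<theta>"
  by (rule Arg2pi_unique[of 1]) (auto simp: cis_conv_exp)

lemma cis_measurable [measurable]: "cis \<in> borel_measurable borel"
  by (intro borel_measurable_continuous_onI continuous_intros)

lemma cis_measurable_restrict [measurable]: "cis \<in> borel_measurable (restrict_space lborel \<Omega>)"
  by (rule measurable_restrict_space1) simp

lemma sets_circle_lebesgue [measurable_cong]: "sets circle_lebesgue = sets borel"
  by (simp add: circle_lebesgue_def)

lemma nn_integral_circle_lebesgue:
  assumes [measurable]: "f \<in> borel_measurable borel"
  shows "(\<integral>\<^sup>+z. f z \<partial>circle_lebesgue) = (\<integral>\<^sup>+\<theta>\<in>{0..<2 * pi}. f (cis \<theta>) \<partial>lborel)"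
proof -
  have "(\<integral>\<^sup>+z. f z \<partial>circle_lebesgue) = (\<integral>\<^sup>+\<theta>. f (cis \<theta>) \<partial>restrict_space lborel {0..<2 * pi})"
    unfolding circle_lebesgue_def by (rule nn_integral_distr) measurable
  also have "\<dots> = (\<integral>\<^sup>+\<theta>\<in>{0..<2 * pi}. f (cis \<theta>) \<partial>lborel)"
    by (rule nn_integral_restrict_space) simp
  finally show ?thesis .
qed

lemma emeasure_circle_lebesgue_UNIV: "emeasure circle_lebesgue UNIV = ennreal (2 * pi)"
  using nn_integral_circle_lebesgue[of "\<lambda>_. 1"]
  by (simp add: sets_eq_imp_space_eq[OF sets_circle_lebesgue])

lemma AE_circle_lebesgue:
  assumes "{z. P z} \<in> sets borel"
  shows "(AE z in circle_lebesgue. P z) \<longleftrightarrow> (AE \<theta> in lborel. \<theta> \<in> {0..<2 * pi} \<longrightarrow> P (cis \<theta>))"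
proof -
  have "(AE z in circle_lebesgue. P z) \<longleftrightarrow> (AE \<theta> in restrict_space lborel {0..<2 * pi}. P (cis \<theta>))"
    unfolding circle_lebesgue_def by (rule AE_distr_iff) (use assms in simp_all)
  also have "\<dots> \<longleftrightarrow> (AE \<theta> in lborel. \<theta> \<in> {0..<2 * pi} \<longrightarrow> P (cis \<theta>))"
    by (rule AE_restrict_space_iff) simp
  finally show ?thesis .
qed

lemma circle_lebesgue_moment:
  assumes n: "0 < n"
  shows "(\<integral>z. z ^ n \<partial>circle_lebesgue) = 0"
proof -
  define F where "F = (\<lambda>\<theta>. cis (real n * \<theta>) / (\<i> * of_nat n))"
  have "(\<integral>z. z ^ n \<partial>circle_lebesgue) = (\<integral>\<theta>. cis \<theta> ^ n \<partial>restrict_space lborel {0..<2 * pi})"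
    unfolding circle_lebesgue_def by (rule integral_distr) measurable
  also have "\<dots> = (\<integral>\<theta>. indicator {0..<2 * pi} \<theta> *\<^sub>R cis \<theta> ^ n \<partial>lborel)"
    by (rule integral_restrict_space) simp
  \<comment> \<open>The half-open interval is closed up at one point of measure 0, so that the
    fundamental theorem of calculus applies.\<close>
  also have "\<dots> = (\<integral>\<theta>. indicator {0..2 * pi} \<theta> *\<^sub>R cis (real n * \<theta>) \<partial>lborel)"
  proof (rule integral_cong_AE)
    show "AE \<theta> in lborel. indicator {0..<2 * pi} \<theta> *\<^sub>R cis \<theta> ^ n = indicator {0..2 * pi} \<theta> *\<^sub>R cis (real n * \<theta>)"
      using AE_lborel_singleton[of "2 * pi"] by eventually_elim (auto simp: indicator_def Complex.DeMoivre)
  qed measurable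
  also have "\<dots> = F (2 * pi) - F 0"
  proof (rule integral_FTC_atLeastAtMost)
    show "(F has_vector_derivative cis (real n * \<theta>)) (at \<theta> within {0..2 * pi})" for \<theta>
    proof -
      have "((\<lambda>\<zeta>. exp (\<i> * of_nat n * \<zeta>) / (\<i> * of_nat n)) has_field_derivative exp (\<i> * of_nat n * of_real \<theta>)) (at (of_real \<theta>))"
        using n by (auto intro!: derivative_eq_intros)
      from has_vector_derivative_real_field[OF this, of "{0..2 * pi}"] show ?thesis
        by (simp add: F_def cis_conv_exp mult_ac)
    qed
  qed (auto intro!: continuous_intros)
  also have "F (2 * pi) = F 0"
    using cis_multiple_2pi[of "real n"] by (simp add: F_def mult_ac)
  finally show ?thesis by simp
qed

definition circle_uniform :: "complex measure" where
  "circle_uniform = density circle_lebesgue (\<lambda>_. ennreal (1 / (2 * pi)))"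

lemma circle_prob_uniform: "circle_prob circle_uniform"
proof (intro circle_prob.intro circle_prob_axioms.intro prob_spaceI)
  show "sets circle_uniform = sets borel" by (simp add: circle_uniform_def sets_circle_lebesgue)
  have "emeasure circle_uniform (space circle_uniform) = ennreal (1 / (2 * pi)) * ennreal (2 * pi)"
    using sets_eq_imp_space_eq[OF sets_circle_lebesgue]
    by (simp add: circle_uniform_def emeasure_density_const emeasure_circle_lebesgue_UNIV)
  then show "emeasure circle_uniform (space circle_uniform) = 1"
    by (simp add: ennreal_mult[symmetric])
  have "AE z in circle_lebesgue. cmod z = 1" by (subst AE_circle_lebesgue) auto
  then show "AE z in circle_uniform. cmod z = 1"
    unfolding circle_uniform_def by (subst AE_density) auto
  show "(\<integral>z. z ^ n \<partial>circle_uniform) = 0" if "0 < n" for n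
    unfolding circle_uniform_def
    by (subst integral_density) (auto simp: circle_lebesgue_moment[OF that] scaleR_conv_of_real)
qed

interpretation C: circle_prob circle_uniform
  by (rule circle_prob_uniform)

lemma null_sets_circle_uniform: "emeasure circle_uniform A = 0 \<longleftrightarrow> emeasure circle_lebesgue A = 0"
  if "A \<in> sets borel"
  using that by (simp add: circle_uniform_def emeasure_density_const sets_circle_lebesgue)

text \<open>The factor 2 pi converts a density for arc length into one for the normalised measure.
  The inequality comes from dropping the singular part.\<close>

lemma lebesgue_decomposition_dominates:
  assumes dec: "lebesgue_decomposition \<mu> w \<sigma>"
  defines "W \<equiv> \<lambda>z. 2 * pi * w (Arg2pi z)"
  shows "W \<in> borel_measurable borel" "0 \<le> W z"
    "A \<in> sets borel \<Longrightarrow> (\<integral>\<^sup>+z\<in>A. ennreal (W z) \<partial>circle_uniform) \<le> emeasure \<mu> A"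
proof -
  have [measurable]: "w \<in> borel_measurable borel" and w0: "0 \<le> w \<theta>" for \<theta>
    using dec by (auto simp: lebesgue_decomposition_def)
  show W [measurable]: "W \<in> borel_measurable borel" unfolding W_def by measurable
  show "0 \<le> W z" using w0 by (simp add: W_def)
  show "(\<integral>\<^sup>+z\<in>A. ennreal (W z) \<partial>circle_uniform) \<le> emeasure \<mu> A" if [measurable]: "A \<in> sets borel"
  proof -
    have "(\<integral>\<^sup>+z\<in>A. ennreal (W z) \<partial>circle_uniform) =
        (\<integral>\<^sup>+z. ennreal (1 / (2 * pi)) * (ennreal (W z) * indicator A z) \<partial>circle_lebesgue)"
      unfolding circle_uniform_def by (rule nn_integral_density) measurable
    also have "\<dots> = (\<integral>\<^sup>+\<theta>\<in>{0..<2 * pi}. ennreal (1 / (2 * pi)) * (ennreal (W (cis \<theta>)) * indicator A (cis \<theta>)) \<partial>lborel)"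
      by (rule nn_integral_circle_lebesgue) measurable
    also have "\<dots> = (\<integral>\<^sup>+\<theta>\<in>{0..<2 * pi}. ennreal (w \<theta>) * indicator A (cis \<theta>) \<partial>lborel)"
    proof (rule nn_integral_cong)
      fix \<theta> :: real
      have "ennreal (1 / (2 * pi)) * (ennreal (2 * pi * w \<theta>) * i) = ennreal (w \<theta>) * i" for i
        using w0[of \<theta>] by (simp add: mult.assoc[symmetric] ennreal_mult[symmetric])
      then show "ennreal (1 / (2 * pi)) * (ennreal (W (cis \<theta>)) * indicator A (cis \<theta>)) * indicator {0..<2 * pi} \<theta> =
          ennreal (w \<theta>) * indicator A (cis \<theta>) * indicator {0..<2 * pi} \<theta>"
        by (cases "\<theta> \<in> {0..<2 * pi}") (simp_all add: W_def Arg2pi_cis)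
    qed
    also have "\<dots> \<le> emeasure \<mu> A"
      using dec that by (simp add: lebesgue_decomposition_def)
    finally show ?thesis .
  qed
qed

text \<open>Exhaustion: among the null sets of \<open>M\<close>, one of maximal mass for
  \<open>N\<close> is removed, and what remains has no mass on null sets.\<close>

lemma singular_part_set:
  assumes "finite_measure N" "finite_measure M" and sets_eq: "sets N = sets M"
  obtains B where "B \<in> sets M" "emeasure M B = 0"
    "absolutely_continuous M (density N (indicator (space M - B)))"
proof -
  interpret N: finite_measure N by fact
  interpret M: finite_measure M by fact
  note [measurable_cong] = sets_eq
  have space_eq: "space N = space M" using sets_eq by (rule sets_eq_imp_space_eq)
  define s where "s = (SUP A\<in>null_sets M. emeasure N A)"
  obtain f where f: "range f \<subseteq> (\<lambda>A. emeasure N A) ` null_sets M" "s = (SUP i::nat. f i)"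
    using ennreal_Sup_countable_SUP[of "emeasure N ` null_sets M"] null_sets.empty_sets unfolding s_def by blast
  then have "\<forall>i. \<exists>A\<in>null_sets M. f i = emeasure N A" by blast
  \<comment> \<open>A sequence approaching the supremum; its union is again a null set, so the
    supremum is attained.\<close>
  then obtain A where A: "\<And>i. A i \<in> null_sets M" "\<And>i. f i = emeasure N (A i)" by metis
  define B where "B = (\<Union>i. A i)"
  have B: "B \<in> null_sets M" unfolding B_def using A by auto
  have le: "emeasure N C \<le> emeasure N B" if "C \<in> null_sets M" for C
  proof -
    have "emeasure N C \<le> s" unfolding s_def using that by (rule SUP_upper)
    also have "\<dots> \<le> emeasure N B"
      unfolding f(2) A(2) B_def using A(1) sets_eq by (intro SUP_least emeasure_mono) auto
    finally show ?thesis .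
  qed
  have "absolutely_continuous M (density N (indicator (space M - B)))"
    unfolding absolutely_continuous_def
  proof
    fix C assume C: "C \<in> null_sets M"
    have [measurable]: "B \<in> sets M" "C \<in> sets M" using B C by auto
    \<comment> \<open>Mass of \<open>C\<close> outside \<open>B\<close> would let the null set
      \<open>B \<union> C\<close> exceed the maximum; finiteness of \<open>N\<close> permits the
      cancellation.\<close>
    have "emeasure N B + emeasure N (C - B) = emeasure N (B \<union> (C - B))"
      by (rule plus_emeasure) (auto simp: sets_eq)
    also have "\<dots> \<le> emeasure N B + 0"
      using B C le[of "B \<union> C"] by (simp add: Un_Diff_cancel null_sets.Un)
    finally have "emeasure N (C - B) = 0"
      by (simp add: N.emeasure_finite)
    moreover have "(space M - B) \<inter> C = C - B" using sets.sets_into_space[OF \<open>C \<in> sets M\<close>] by auto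
    ultimately have "emeasure (density N (indicator (space M - B))) C = 0"
      by (subst emeasure_density) (auto simp: sets_eq indicator_inter_arith[symmetric])
    then show "C \<in> null_sets (density N (indicator (space M - B)))"
      using C sets_eq by (auto simp: null_sets_def)
  qed
  then show ?thesis using that B by (auto simp: null_sets_def)
qed

lemma limsup_pos_frequently:
  assumes "limsup (\<lambda>n. ereal (x n)) > 0"
  obtains c where "0 < c" "infinite {n. c \<le> x n}"
proof -
  obtain c where c: "0 < ereal c" "ereal c < limsup (\<lambda>n. ereal (x n))"
    using ereal_dense2[OF assms] by auto
  have "\<not> (\<forall>\<^sub>F n in sequentially. ereal (x n) \<le> ereal c)"
    using Limsup_bounded[of "\<lambda>n. ereal (x n)" "ereal c" sequentially] c(2) by auto
  then have "\<exists>\<^sub>F n in sequentially. c \<le> x n"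
    unfolding frequently_def by (rule contrapos_nn) (auto elim!: eventually_mono)
  then have "infinite {n. c \<le> x n}"
    by (simp add: cofinite_eq_sequentially[symmetric] frequently_cofinite)
  then show ?thesis using that c(1) by simp
qed

lemma less_one_null_or_tendsto:
  assumes "C.schur_boundary \<alpha> r \<phi>" "C.schur_boundary \<alpha>' r' \<phi>'" "filterlim n at_top sequentially"
    "\<And>i. (\<lambda>j. \<alpha> (n j - Suc i) - \<alpha>' (n j - Suc i)) \<longlonglongrightarrow> 0"
    and not: "\<not> (\<lambda>j. \<alpha> (n j) - \<alpha>' (n j)) \<longlonglongrightarrow> 0"
  shows "AE z in circle_uniform. \<not> (cmod (\<phi> 0 z) < 1 \<and> cmod (\<phi>' 0 z) < 1)"
proof -
  note [measurable] = C.sb_measurable[OF assms(1)] C.sb_measurable[OF assms(2)]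
  let ?A = "{z. cmod (\<phi> 0 z) < 1 \<and> cmod (\<phi>' 0 z) < 1}"
  have [measurable]: "?A \<in> sets borel" by measurable
  have "\<not> 0 < measure circle_uniform ?A"
    using C.common_disc_set_imp_tendsto[OF assms(1-4)] not by blast
  then have "measure circle_uniform ?A = 0" using measure_nonneg[of circle_uniform ?A] by linarith
  then have "AE z in circle_uniform. z \<notin> ?A"
    by (intro AE_not_in) (auto simp: null_sets_def C.emeasure_eq_measure C.sets_eq)
  then show ?thesis by simp
qed

theorem disjoint_ac_supports:
  fixes \<alpha> \<alpha>' :: "nat \<Rightarrow> complex" and m n :: "nat \<Rightarrow> nat"
  assumes lt: "\<And>k. cmod (\<alpha> k) < 1" "\<And>k. cmod (\<alpha>' k) < 1"
    and gap: "filterlim (\<lambda>j. int (n j) - int (m j)) at_top sequentially"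
    and close: "(\<lambda>j. SUP k\<in>{m j..<n j}. cmod (\<alpha>' k - \<alpha> k)) \<longlonglongrightarrow> 0"
    and far: "limsup (\<lambda>j. ereal (cmod (\<alpha>' (n j) - \<alpha> (n j)))) > 0"
    and S: "is_ac_support (cmv \<alpha>) S" and S': "is_ac_support (cmv \<alpha>') S'"
  shows "S \<inter> S' \<in> null_sets lborel"
proof -
  obtain \<mu> w \<sigma> where sp: "is_spectral_measure (cmv \<alpha>) \<mu>" and dec: "lebesgue_decomposition \<mu> w \<sigma>"
    and Sw: "S = {\<theta> \<in> {0..<2 * pi}. w \<theta> > 0}"
    using S unfolding is_ac_support_def by blast
  obtain \<mu>' w' \<sigma>' where sp': "is_spectral_measure (cmv \<alpha>') \<mu>'" and dec': "lebesgue_decomposition \<mu>' w' \<sigma>'"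
    and Sw': "S' = {\<theta> \<in> {0..<2 * pi}. w' \<theta> > 0}"
    using S' unfolding is_ac_support_def by blast
  have [measurable]: "w \<in> borel_measurable borel" "w' \<in> borel_measurable borel"
    using dec dec' by (auto simp: lebesgue_decomposition_def)
  obtain r \<phi> r' \<phi>' where sb: "C.schur_boundary \<alpha> r \<phi>" and sb': "C.schur_boundary \<alpha>' r' \<phi>'"
    using C.ex_schur_boundary lt by metis
  have large: "\<forall>\<^sub>F j in sequentially. int K \<le> int (n j) - int (m j)" for K
    using gap by (simp add: filterlim_at_top)
  have n: "filterlim n at_top sequentially"
    unfolding filterlim_at_top
  proof
    fix K
    show "\<forall>\<^sub>F j in sequentially. K \<le> n j" using large[of K] by eventually_elim simp
  qed
  have d: "(\<lambda>j. \<alpha> (n j - Suc i) - \<alpha>' (n j - Suc i)) \<longlonglongrightarrow> 0" for i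
  \<comment> \<open>For fixed \<open>i\<close> the index \<open>n j - Suc i\<close> lies in the
    window from \<open>m j\<close> to \<open>n j\<close> once its length is at least i + 1.\<close>
  proof (rule Lim_null_comparison[OF _ close])
    show "\<forall>\<^sub>F j in sequentially. norm (\<alpha> (n j - Suc i) - \<alpha>' (n j - Suc i)) \<le> (SUP k\<in>{m j..<n j}. cmod (\<alpha>' k - \<alpha> k))"
      using large[of "Suc i"]
    proof eventually_elim
      case (elim j)
      have "cmod (\<alpha>' (n j - Suc i) - \<alpha> (n j - Suc i)) \<le> (SUP k\<in>{m j..<n j}. cmod (\<alpha>' k - \<alpha> k))"
        using elim by (intro cSUP_upper) auto
      then show ?case by (simp add: norm_minus_commute)
    qed
  qed
  have "\<not> (\<lambda>j. \<alpha> (n j) - \<alpha>' (n j)) \<longlonglongrightarrow> 0"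
  proof
    assume "(\<lambda>j. \<alpha> (n j) - \<alpha>' (n j)) \<longlonglongrightarrow> 0"
    then have "(\<lambda>j. cmod (\<alpha>' (n j) - \<alpha> (n j))) \<longlonglongrightarrow> 0"
      using tendsto_norm_zero by (subst norm_minus_commute) blast
    then have "(\<lambda>j. ereal (cmod (\<alpha>' (n j) - \<alpha> (n j)))) \<longlonglongrightarrow> ereal 0" by (rule tendsto_ereal)
    then have "limsup (\<lambda>j. ereal (cmod (\<alpha>' (n j) - \<alpha> (n j)))) = ereal 0"
      by (rule lim_imp_Limsup[OF sequentially_bot])
    then show False using far by simp
  qed
  then have null: "AE z in circle_uniform. \<not> (cmod (\<phi> 0 z) < 1 \<and> cmod (\<phi>' 0 z) < 1)"
    by (rule less_one_null_or_tendsto[OF sb sb' n d])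
  note W = lebesgue_decomposition_dominates[OF dec] and W' = lebesgue_decomposition_dominates[OF dec']
  have "AE z in circle_uniform. 0 < 2 * pi * w (Arg2pi z) \<longrightarrow> cmod (\<phi> 0 z) < 1"
    by (rule C.density_pos_imp_less_one[OF sb sp W(1,2)]) (rule W(3))
  moreover have "AE z in circle_uniform. 0 < 2 * pi * w' (Arg2pi z) \<longrightarrow> cmod (\<phi>' 0 z) < 1"
    by (rule C.density_pos_imp_less_one[OF sb' sp' W'(1,2)]) (rule W'(3))
  ultimately have "AE z in circle_uniform. \<not> (0 < w (Arg2pi z) \<and> 0 < w' (Arg2pi z))"
    using null by eventually_elim (auto simp: zero_less_mult_iff)
  then have "AE z in circle_lebesgue. \<not> (0 < w (Arg2pi z) \<and> 0 < w' (Arg2pi z))"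
    unfolding circle_uniform_def by (subst (asm) AE_density) auto
  then have "AE \<theta> in lborel. \<theta> \<in> {0..<2 * pi} \<longrightarrow> \<not> (0 < w (Arg2pi (cis \<theta>)) \<and> 0 < w' (Arg2pi (cis \<theta>)))"
    by (subst (asm) AE_circle_lebesgue) measurable
  then have "AE \<theta> in lborel. \<theta> \<notin> S \<inter> S'"
    by eventually_elim (auto simp: Sw Sw' Arg2pi_cis)
  moreover have "S \<inter> S' \<in> sets borel" unfolding Sw Sw' by measurable
  ultimately show ?thesis by (subst AE_iff_null_sets) auto
qed

text \<open>The zero sequence has vanishing Schur function, so its modulus is below 1 almost
  everywhere on the circle. Comparison with it therefore forces the boundary values of f_0 for
  \<open>\<alpha>\<close> to be unimodular almost everywhere, which rules out a density.\<close>

theorem asymptotically_sparse_imp_singular: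
  fixes \<alpha> :: "nat \<Rightarrow> complex"
  assumes lt: "\<And>k. cmod (\<alpha> k) < 1"
    and prod: "\<And>k. 1 \<le> k \<Longrightarrow> (\<lambda>n. \<alpha> n * \<alpha> (n + k)) \<longlonglongrightarrow> 0"
    and far: "limsup (\<lambda>n. ereal (cmod (\<alpha> n))) > 0"
  shows "purely_singular_spectrum (cmv \<alpha>)"
  unfolding purely_singular_spectrum_def
proof (intro allI impI)
  fix \<mu> assume sp: "is_spectral_measure (cmv \<alpha>) \<mu>"
  obtain c where c: "0 < c" and inf: "infinite {n. c \<le> cmod (\<alpha> n)}"
    using limsup_pos_frequently[OF far] by blast
  \<comment> \<open>Along indices with |\<alpha> n| >= c the product hypothesis with shift i + 1 can
    be divided by \<open>c\<close>, so each of the preceding coefficients tends to 0.\<close>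
  define n where "n = enumerate {n. c \<le> cmod (\<alpha> n)}"
  have nc: "c \<le> cmod (\<alpha> (n j))" for j using enumerate_in_set[OF inf, of j] by (simp add: n_def)
  have n: "filterlim n at_top sequentially"
    unfolding n_def using strict_mono_enumerate[OF inf] by (rule filterlim_subseq)
  obtain r \<phi> r' \<phi>' where sb: "C.schur_boundary \<alpha> r \<phi>" and sb': "C.schur_boundary (\<lambda>_. 0) r' \<phi>'"
    using C.ex_schur_boundary lt C.ex_schur_boundary[of "\<lambda>_. 0"] by fastforce
  have d: "(\<lambda>j. \<alpha> (n j - Suc i) - 0) \<longlonglongrightarrow> 0" for i
  proof (rule Lim_null_comparison)
    have "filterlim (\<lambda>j. n j - Suc i) at_top sequentially"
      using filterlim_compose[OF filterlim_minus_const_nat_at_top n] .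
    then have "(\<lambda>j. \<alpha> (n j - Suc i) * \<alpha> (n j - Suc i + Suc i)) \<longlonglongrightarrow> 0"
      by (rule filterlim_compose[OF prod, rotated]) simp
    then have "(\<lambda>j. cmod (\<alpha> (n j - Suc i) * \<alpha> (n j - Suc i + Suc i)) / c) \<longlonglongrightarrow> 0 / c"
      using c by (intro tendsto_intros tendsto_norm_zero) auto
    then show "(\<lambda>j. cmod (\<alpha> (n j - Suc i) * \<alpha> (n j - Suc i + Suc i)) / c) \<longlonglongrightarrow> 0" by simp
    show "\<forall>\<^sub>F j in sequentially. norm (\<alpha> (n j - Suc i) - 0) \<le> cmod (\<alpha> (n j - Suc i) * \<alpha> (n j - Suc i + Suc i)) / c"
      using filterlim_at_top[THEN iffD1, OF n, rule_format, of "Suc i"]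
    proof eventually_elim
      case (elim j)
      have "cmod (\<alpha> (n j - Suc i)) * c \<le> cmod (\<alpha> (n j - Suc i)) * cmod (\<alpha> (n j))"
        using nc by (intro mult_left_mono) auto
      then show ?case using c elim by (simp add: pos_le_divide_eq norm_mult)
    qed
  qed
  have not: "\<not> (\<lambda>j. \<alpha> (n j) - 0) \<longlonglongrightarrow> 0"
  proof
    assume "(\<lambda>j. \<alpha> (n j) - 0) \<longlonglongrightarrow> 0"
    then have "(\<lambda>j. cmod (\<alpha> (n j))) \<longlonglongrightarrow> 0" using tendsto_norm_zero by fastforce
    then have "c \<le> 0" by (rule LIMSEQ_le_const) (use nc in auto)
    then show False using c by simp
  qed
  have free: "AE z in circle_uniform. \<phi>' 0 z = 0"
    using C.sb_tendsto[OF sb'] C.AE_norm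
  proof eventually_elim
    case (elim z)
    have "schur_fun (\<lambda>_. 0) 0 (of_real (r' k) * z) = 0" for k
    proof -
      have "of_real (r' k) * z \<noteq> 0" using C.sb_r(1)[OF sb', of k] elim(2) by auto
      moreover have "0 = of_real (r' k) * z * schur_fun (\<lambda>_. 0) 0 (of_real (r' k) * z)"
        by (rule schur_fun_unique[where s = "\<lambda>_. 0"]) (use C.sb_disc[OF sb' elim(2)] in \<open>auto simp: disk_aut_def\<close>)
      ultimately show ?thesis by simp
    qed
    then show ?case using elim(1) by (auto simp: LIMSEQ_const_iff dest: spec[of _ 0])
  qed
  have null: "AE z in circle_uniform. \<not> cmod (\<phi> 0 z) < 1"
    using less_one_null_or_tendsto[OF sb sb' n d not] free by eventually_elim auto
  have sets_\<mu> [measurable_cong]: "sets \<mu> = sets borel" and "prob_space \<mu>"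
    using sp by (auto simp: is_spectral_measure_def)
  interpret P: prob_space \<mu> by fact
  \<comment> \<open>The spectral measure is given without a density. Removing a null set that
    carries its singular part leaves an absolutely continuous measure, to which Radon-Nikodym
    applies.\<close>
  obtain B where B: "B \<in> sets circle_uniform" "emeasure circle_uniform B = 0"
    and ac: "absolutely_continuous circle_uniform (density \<mu> (indicator (space circle_uniform - B)))"
    by (rule singular_part_set[of \<mu> circle_uniform])
      (auto simp: sets_\<mu> C.sets_eq P.finite_measure_axioms C.finite_measure_axioms)
  have [measurable]: "B \<in> sets borel" using B by (simp add: C.sets_eq)
  define N where "N = density \<mu> (indicator (- B))"
  have N_le: "emeasure N A = emeasure \<mu> (A - B)" if [measurable]: "A \<in> sets borel" for A
  proof -
    have "emeasure N A = (\<integral>\<^sup>+z. indicator (- B) z * indicator A z \<partial>\<mu>)"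
      unfolding N_def by (rule emeasure_density) (auto simp: sets_\<mu>)
    also have "\<dots> = (\<integral>\<^sup>+z. indicator (A - B) z \<partial>\<mu>)"
      by (intro nn_integral_cong) (auto simp: indicator_def)
    finally show ?thesis by (simp add: sets_\<mu>)
  qed
  have "absolutely_continuous circle_uniform N" using ac by (simp add: N_def Compl_eq_Diff_UNIV)
  then obtain f where f [measurable]: "f \<in> borel_measurable circle_uniform" and fN: "density circle_uniform f = N"
    using C.Radon_Nikodym[of N] by (auto simp: N_def sets_\<mu> C.sets_eq)
  have f' [measurable]: "f \<in> borel_measurable borel" using f by simp
  have int_f: "(\<integral>\<^sup>+z\<in>A. f z \<partial>circle_uniform) = emeasure \<mu> (A - B)" if "A \<in> sets borel" for A
    using N_le[OF that] that f unfolding fN[symmetric] by (subst (asm) emeasure_density) (auto simp: C.sets_eq)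
  have "(\<integral>\<^sup>+z. f z \<partial>circle_uniform) \<noteq> \<infinity>"
    using int_f[of UNIV] P.emeasure_finite by simp
  then have fin: "AE z in circle_uniform. f z \<noteq> \<infinity>" by (intro nn_integral_PInf_AE) auto
  \<comment> \<open>\<open>enn2real\<close> sends infinity to 0, so the real-valued density remains
    below \<open>f\<close> and is dominated by \<open>\<mu>\<close>.\<close>
  have "(\<integral>\<^sup>+z\<in>A. ennreal (enn2real (f z)) \<partial>circle_uniform) \<le> emeasure \<mu> A" if [measurable]: "A \<in> sets borel" for A
  proof -
    have "(\<integral>\<^sup>+z\<in>A. ennreal (enn2real (f z)) \<partial>circle_uniform) \<le> (\<integral>\<^sup>+z\<in>A. f z \<partial>circle_uniform)"
      by (intro nn_integral_mono mult_right_mono) (auto simp: ennreal_enn2real_if)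
    also have "\<dots> \<le> emeasure \<mu> A" unfolding int_f[OF that] by (intro emeasure_mono) (auto simp: sets_\<mu>)
    finally show ?thesis .
  qed
  then have "AE z in circle_uniform. 0 < enn2real (f z) \<longrightarrow> cmod (\<phi> 0 z) < 1"
    by (intro C.density_pos_imp_less_one[OF sb sp]) auto
  then have "AE z in circle_uniform. f z = 0"
    using null fin by eventually_elim (auto simp: enn2real_positive_iff less_top zero_less_iff_neq_zero)
  then have "(\<integral>\<^sup>+z\<in>UNIV. f z \<partial>circle_uniform) = 0"
    by (subst nn_integral_0_iff_AE) auto
  then have "emeasure \<mu> (- B) = 0" using int_f[of UNIV] by (simp add: Compl_eq_Diff_UNIV)
  moreover have "emeasure circle_lebesgue B = 0"
    using B(2) null_sets_circle_uniform[of B] by simp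
  moreover have "space circle_lebesgue - (- B) = B"
    using sets_eq_imp_space_eq[OF sets_circle_lebesgue] by auto
  ultimately show "mutually_singular \<mu> circle_lebesgue"
    \<comment> \<open>The witness is \<open>- B\<close>: it is null for \<open>\<mu>\<close>, and
      its complement \<open>B\<close> is null for arc length.\<close>
    unfolding mutually_singular_def by (auto simp: sets_\<mu> sets_circle_lebesgue intro!: bexI[of _ "- B"])
qed

theorem theorem1p1:
  shows "(\<forall>(\<alpha> :: nat \<Rightarrow> complex) (\<alpha>' :: nat \<Rightarrow> complex) (m :: nat \<Rightarrow> nat) (n :: nat \<Rightarrow> nat) S S'.
            (\<forall>k. cmod (\<alpha> k) < 1 \<and> cmod (\<alpha>' k) < 1) \<and>
            filterlim (\<lambda>j. int (n j) - int (m j)) at_top sequentially \<and>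
            (\<lambda>j. SUP k\<in>{m j..<n j}. cmod (\<alpha>' k - \<alpha> k)) \<longlonglongrightarrow> 0 \<and>
            limsup (\<lambda>j. ereal (cmod (\<alpha>' (n j) - \<alpha> (n j)))) > 0 \<and>
            is_ac_support (cmv \<alpha>) S \<and> is_ac_support (cmv \<alpha>') S'
            \<longrightarrow> S \<inter> S' \<in> null_sets lborel)
         \<and>
         (\<forall>\<alpha> :: nat \<Rightarrow> complex.
            (\<forall>k. cmod (\<alpha> k) < 1) \<and>
            (\<forall>k\<ge>1. (\<lambda>n. \<alpha> n * \<alpha> (n + k)) \<longlonglongrightarrow> 0) \<and>
            limsup (\<lambda>n. ereal (cmod (\<alpha> n))) > 0
            \<longrightarrow> purely_singular_spectrum (cmv \<alpha>))"
  by (intro conjI allI impI) (auto intro: disjoint_ac_supports asymptotically_sparse_imp_singular)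

end
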